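(* Let $V_4\cong\mathbb{Z}_2\times\mathbb{Z}_2$ be a Klein four-subgroup of $A_5$, acting on Bring's curve $\mathcal{B}$ by even permutations of coordinates. The quotient curve $\mathcal{B}/_{V_4}$ is given by (i.e. is isomorphic over $\mathbb{C}$ to the curve with) the equation $$y^2 = x^4 + 10x^3 +25x^2 -100x.$$
   Context: Bring's curve $\mathcal{B}\subset\mathbb{CP}^4$ is the genus-4 curve defined by $\sum_{i=1}^5 x_i=\sum_{i=1}^5 x_i^2=\sum_{i=1}^5 x_i^3=0$. The group $A_5$ acts on $\mathcal{B}$ by even permutations of the five homogeneous coordinates (it is the automorphism group of the dessin d'enfant $I_4$, the icosahedron of genus 4, embedded in $\mathcal{B}$); e.g. one may take $V_4=\{\mathrm{id},(24)(35),(23)(45),(25)(34)\}$. For a subgroup $G\subset A_5$, $\mathcal{B}/_G$ denotes the quotient compact Riemann surface. The curve given by an affine equation $y^2=P(x)$ means the compact Riemann surface (smooth projective model) of that affine curve over $\mathbb{C}$. *)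

theory Defs
  imports
    "HOL-Complex_Analysis.Complex_Analysis"
    "HOL-Algebra.Group_Action"
    "HOL-Algebra.Elementary_Groups"
    "HOL-Library.Numeral_Type"
    "HOL-Combinatorics.Permutations"
begin

section \<open>Riemann surfaces\<close>

text \<open>A chart is a pair of its domain and its coordinate function; the values of the coordinate
  function outside the domain are irrelevant.\<close>

type_synonym 'a chart = "'a set \<times> ('a \<Rightarrow> complex)"

record 'a surface =
  points :: "'a topology"
  atlas :: "'a chart set"

definition is_chart :: "'a topology \<Rightarrow> 'a chart \<Rightarrow> bool" where
  "is_chart T c \<longleftrightarrow> (case c of (U, \<phi>) \<Rightarrow>
     openin T U \<and> open (\<phi> ` U) \<and>
     homeomorphic_map (subtopology T U) (top_of_set (\<phi> ` U)) \<phi>)"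

definition riemann_surface :: "'a surface \<Rightarrow> bool" where
  "riemann_surface X \<longleftrightarrow>
     Hausdorff_space (points X) \<and> connected_space (points X) \<and> topspace (points X) \<noteq> {} \<and>
     (\<forall>c\<in>atlas X. is_chart (points X) c) \<and>
     (\<Union>(U, \<phi>)\<in>atlas X. U) = topspace (points X) \<and>
     (\<forall>(U, \<phi>)\<in>atlas X. \<forall>(W, \<psi>)\<in>atlas X.
        (\<psi> \<circ> inv_into U \<phi>) holomorphic_on \<phi> ` (U \<inter> W))"

definition compact_riemann_surface :: "'a surface \<Rightarrow> bool" where
  "compact_riemann_surface X \<longleftrightarrow> riemann_surface X \<and> compact_space (points X)"

definition holomorphic_map :: "'a surface \<Rightarrow> 'b surface \<Rightarrow> ('a \<Rightarrow> 'b) \<Rightarrow> bool" where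
  "holomorphic_map X Y f \<longleftrightarrow>
     continuous_map (points X) (points Y) f \<and>
     (\<forall>(U, \<phi>)\<in>atlas X. \<forall>(W, \<psi>)\<in>atlas Y.
        (\<psi> \<circ> f \<circ> inv_into U \<phi>) holomorphic_on \<phi> ` {p\<in>U. f p \<in> W})"

definition biholomorphic :: "'a surface \<Rightarrow> 'b surface \<Rightarrow> bool" where
  "biholomorphic X Y \<longleftrightarrow> riemann_surface X \<and> riemann_surface Y \<and>
     (\<exists>f g. holomorphic_map X Y f \<and> holomorphic_map Y X g \<and>
        (\<forall>p\<in>topspace (points X). g (f p) = p) \<and>
        (\<forall>q\<in>topspace (points Y). f (g q) = q))"


section \<open>Quotients\<close>

definition quotient_topology :: "'a topology \<Rightarrow> ('a \<Rightarrow> 'b) \<Rightarrow> 'b topology" where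
  "quotient_topology T q =
     topology (\<lambda>U. U \<subseteq> q ` topspace T \<and> openin T {x\<in>topspace T. q x \<in> U})"

lemma openin_quotient_topology:
  "openin (quotient_topology T q) U \<longleftrightarrow>
     U \<subseteq> q ` topspace T \<and> openin T {x\<in>topspace T. q x \<in> U}"
proof -
  have "istopology (\<lambda>U. U \<subseteq> q ` topspace T \<and> openin T {x\<in>topspace T. q x \<in> U})"
    unfolding istopology_def
  proof (intro conjI allI impI)
    fix A B
    assume "A \<subseteq> q ` topspace T \<and> openin T {x\<in>topspace T. q x \<in> A}"
      and "B \<subseteq> q ` topspace T \<and> openin T {x\<in>topspace T. q x \<in> B}"
    moreover have "{x\<in>topspace T. q x \<in> A \<inter> B} =
        {x\<in>topspace T. q x \<in> A} \<inter> {x\<in>topspace T. q x \<in> B}" by blast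
    ultimately show "A \<inter> B \<subseteq> q ` topspace T" "openin T {x\<in>topspace T. q x \<in> A \<inter> B}"
      by auto
  next
    fix K
    assume K: "\<forall>A\<in>K. A \<subseteq> q ` topspace T \<and> openin T {x\<in>topspace T. q x \<in> A}"
    then show "\<Union>K \<subseteq> q ` topspace T" by blast
    have "{x\<in>topspace T. q x \<in> \<Union>K} = (\<Union>A\<in>K. {x\<in>topspace T. q x \<in> A})" by blast
    then show "openin T {x\<in>topspace T. q x \<in> \<Union>K}" using K by auto
  qed
  then show ?thesis
    by (simp add: quotient_topology_def topology_inverse')
qed

lemma topspace_quotient_topology: "topspace (quotient_topology T q) = q ` topspace T"
proof
  show "topspace (quotient_topology T q) \<subseteq> q ` topspace T"
    by (metis openin_quotient_topology openin_topspace)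
  have "{x\<in>topspace T. q x \<in> q ` topspace T} = topspace T" by blast
  then have "openin (quotient_topology T q) (q ` topspace T)"
    by (simp add: openin_quotient_topology)
  then show "q ` topspace T \<subseteq> topspace (quotient_topology T q)"
    by (rule openin_subset)
qed

lemma quotient_map_quotient_topology: "quotient_map T (quotient_topology T q) q"
  by (auto simp: quotient_map_def topspace_quotient_topology openin_quotient_topology)

text \<open>The orbit space of a finite group acting holomorphically on a Riemann surface.  Its complex
  structure is the one for which a function on an open subset is holomorphic iff its pullback to
  the original surface is; the atlas consists of all charts that are holomorphic in this sense
  (a chart being a homeomorphism onto its image, it is then automatically biholomorphic).\<close>

definition quotient_surface ::
    "'a surface \<Rightarrow> ('g, 'm) monoid_scheme \<Rightarrow> ('g \<Rightarrow> 'a \<Rightarrow> 'a) \<Rightarrow> 'a set surface" where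
  "quotient_surface X G act =
     \<lparr>points = quotient_topology (points X) (orbit G act),
      atlas = {(U, \<phi>). is_chart (quotient_topology (points X) (orbit G act)) (U, \<phi>) \<and>
        (\<forall>(W, \<psi>)\<in>atlas X. (\<phi> \<circ> orbit G act \<circ> inv_into W \<psi>) holomorphic_on
            \<psi> ` {p\<in>W. orbit G act p \<in> U})}\<rparr>"


section \<open>Curves in complex projective space\<close>

text \<open>A point of projective space is represented by the set of all its homogeneous coordinate
  vectors.  With coordinates indexed by \<open>'n\<close>, the dimension of the space is \<open>CARD('n) - 1\<close>.\<close>

definition proj_point :: "complex^'n \<Rightarrow> (complex^'n) set" where
  "proj_point x = {c *s x | c. c \<noteq> 0}"

definition projective_space :: "(complex^'n) set topology" where
  "projective_space = quotient_topology (top_of_set (- {0})) proj_point"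

text \<open>The affine coordinate \<open>x\<^sub>i / x\<^sub>j\<close>, which does not depend on the chosen representative.\<close>

definition affine_coord :: "'n \<Rightarrow> 'n \<Rightarrow> (complex^'n) set \<Rightarrow> complex" where
  "affine_coord j i L = (let x = (SOME x. x \<in> L) in x $ i / x $ j)"

text \<open>The structure of a one-dimensional complex submanifold on a subset \<open>S\<close> of projective space:
  its charts are the charts of the subspace \<open>S\<close> whose inverse is a holomorphic immersion into
  projective space, as expressed in the standard affine charts \<open>x\<^sub>j \<noteq> 0\<close>.  They cover \<open>S\<close> exactly
  when \<open>S\<close> is such a submanifold.\<close>

definition embedded_curve :: "(complex^'n) set set \<Rightarrow> (complex^'n) set surface" where
  "embedded_curve S =
     \<lparr>points = subtopology projective_space S,
      atlas = {(U, \<phi>). is_chart (subtopology projective_space S) (U, \<phi>) \<and>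
        (\<forall>j. let D = \<phi> ` {L\<in>U. \<forall>x\<in>L. x $ j \<noteq> 0} in
           (\<forall>i. (affine_coord j i \<circ> inv_into U \<phi>) holomorphic_on D) \<and>
           (\<forall>z\<in>D. \<exists>i. deriv (affine_coord j i \<circ> inv_into U \<phi>) z \<noteq> 0))}\<rparr>"

text \<open>An affine plane curve is regarded as a curve in the projective plane.\<close>

definition affine_plane_curve :: "(complex \<times> complex) set \<Rightarrow> (complex^3) set surface" where
  "affine_plane_curve \<Gamma> = embedded_curve ((\<lambda>(x, y). proj_point (vector [x, y, 1])) ` \<Gamma>)"

text \<open>The smooth projective model of an irreducible affine plane curve, up to isomorphism: a smooth
  projective curve (a compact connected Riemann surface embedded in projective space) that
  agrees with the affine curve up to finitely many points on either side.  That the embedded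
  curve is algebraic, and the identification birational, follows from compactness by Chow's theorem.\<close>

definition smooth_projective_model ::
    "(complex^'n) set set \<Rightarrow> (complex \<times> complex) set \<Rightarrow> bool" where
  "smooth_projective_model S \<Gamma> \<longleftrightarrow>
     S \<subseteq> topspace projective_space \<and> compact_riemann_surface (embedded_curve S) \<and>
     (\<exists>E F. E \<subseteq> \<Gamma> \<and> finite E \<and> F \<subseteq> S \<and> finite F \<and>
        biholomorphic (embedded_curve (S - F)) (affine_plane_curve (\<Gamma> - E)))"


section \<open>Bring's curve and the action of the alternating group\<close>

definition bring_curve :: "(complex^5) set surface" where
  "bring_curve = embedded_curve {proj_point x | x.
     x \<noteq> 0 \<and> (\<Sum>i\<in>UNIV. x $ i) = 0 \<and> (\<Sum>i\<in>UNIV. (x $ i)^2) = 0 \<and> (\<Sum>i\<in>UNIV. (x $ i)^3) = 0}"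

text \<open>The alternating group on a finite type, with composition as multiplication; coordinates of
  \<^typ>\<open>complex^5\<close> are indexed by the type \<open>5\<close>, whose elements are \<open>1, 2, 3, 4, 5 = 0\<close>.\<close>

definition alternating_group :: "('n::finite \<Rightarrow> 'n) monoid" where
  "alternating_group = \<lparr>carrier = {p. p permutes UNIV \<and> evenperm p}, mult = (\<circ>), one = id\<rparr>"

definition permute_coords :: "('n \<Rightarrow> 'n) \<Rightarrow> (complex^'n) set \<Rightarrow> (complex^'n) set" where
  "permute_coords p L = (\<lambda>x. \<chi> i. x $ (Hilbert_Choice.inv p) i) ` L"

definition klein_four_subgroup :: "'a set \<Rightarrow> ('a, 'm) monoid_scheme \<Rightarrow> bool" where
  "klein_four_subgroup V G \<longleftrightarrow>
     subgroup V G \<and> G\<lparr>carrier := V\<rparr> \<cong> integer_mod_group 2 \<times>\<times> integer_mod_group 2"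

definition bring_quotient :: "(5 \<Rightarrow> 5) set \<Rightarrow> (complex^5) set set surface" where
  "bring_quotient V =
     quotient_surface bring_curve (alternating_group\<lparr>carrier := V\<rparr>) permute_coords"

end

(*
  Let V4 fix the coordinate e0 and act on e1, ..., e4 by double transpositions, and let a = x_e0 and
  u = x_e1 + x_e2 - x_e3 - x_e4, v = x_e1 - x_e2 + x_e3 - x_e4, w = x_e1 - x_e2 - x_e3 + x_e4.
  In these coordinates Bring's curve is u v w = -5 a^3, u^2 + v^2 + w^2 = -5 a^2, and V4 acts by
  changing an even number of the signs of u, v, w.  Hence [u : v : w : a] -> [u^2 : v^2 : w^2 : a^2]
  identifies the quotient with the plane cubic A B C = 25 D^3, A + B + C + 5 D = 0, and setting
  x = A / D, y = A (B - C) / D^2 turns its affine part into y^2 = x^2 (x + 5)^2 - 100 x with x ~= 0.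

  After a permutation of u, v, w every point of Bring's curve has v ~= 0 and u^2 ~= w^2.  Normalised
  by v = 1, the coordinate t = a is a chart there, d = D is a chart at the image, and the quotient
  map is d = t^2.  If H(t^2) is holomorphic in t, then H(d) is holomorphic in d, so the two complex
  structures agree.
*)
theory Submission
  imports Defs
begin

text \<open>The atlas of the quotient consists of all charts whose pullback to Bring's curve is
  holomorphic. That any two of them are compatible is therefore a claim, and it is delicate at the
  images of points with nontrivial stabiliser, where the quotient map has no local inverse. Instead
  of arguing on the orbit space, a homeomorphism onto the cubic transports separation, connectedness
  and compatibility of charts to it.

  The projective closure of the plane quartic is singular at infinity, so the smooth model is the
  cubic itself. The comparison leaves out the three points of the cubic with D = 0 and the point (0,
  0) of the quartic.

  Connectedness enters through the quartic: a double cover of the punctured x-plane with a branch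
  point is connected, and the affine part of the cubic is dense.

  Nonsingularity is settled once, on the cubic: the normalisation B = 1, A different from C, pulls
  back along squaring to v = 1 and distinct squares of u and w, so one ordering of the coordinates
  provides matching charts upstairs and downstairs.\<close>

no_notation fps_nth (infixl \<open>$\<close> 75)

section \<open>Projective space\<close>

lemma self_in_proj_point: "x \<in> proj_point x"
  unfolding proj_point_def by (rule CollectI, rule exI[of _ 1]) simp

lemma some_in_proj_pointE:
  obtains c where "c \<noteq> 0" "(SOME y. y \<in> proj_point x) = c *s x"
proof -
  have "(SOME y. y \<in> proj_point x) \<in> proj_point x" using self_in_proj_point by (rule someI)
  then show thesis using that by (auto simp: proj_point_def)
qed

lemma proj_point_eq_iff: "proj_point x = proj_point y \<longleftrightarrow> (\<exists>c. c \<noteq> 0 \<and> x = c *s y)"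
proof
  assume "proj_point x = proj_point y"
  then have "x \<in> proj_point y" using self_in_proj_point by metis
  then show "\<exists>c. c \<noteq> 0 \<and> x = c *s y" by (auto simp: proj_point_def)
next
  assume "\<exists>c. c \<noteq> 0 \<and> x = c *s y"
  then obtain c where c: "c \<noteq> 0" "x = c *s y" by auto
  show "proj_point x = proj_point y"
    unfolding proj_point_def
  proof (intro Set.set_eqI iffI; clarify)
    fix d :: complex assume "d \<noteq> 0"
    then show "\<exists>c'. d *s x = c' *s y \<and> c' \<noteq> 0" using c by (intro exI[of _ "d * c"]) simp
  next
    fix d :: complex assume "d \<noteq> 0"
    then show "\<exists>c'. d *s y = c' *s x \<and> c' \<noteq> 0" using c by (intro exI[of _ "d / c"]) simp
  qed
qed

lemma proj_point_scale [simp]: "c \<noteq> 0 \<Longrightarrow> proj_point (c *s x) = proj_point x"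
  by (auto simp: proj_point_eq_iff)

lemma topspace_projective_space: "topspace projective_space = proj_point ` (- {0})"
  by (simp add: projective_space_def topspace_quotient_topology)

lemma affine_coord_proj_point [simp]: "affine_coord j i (proj_point x) = x $ i / x $ j"
proof -
  obtain c where "c \<noteq> 0" "(SOME y. y \<in> proj_point x) = c *s x"
    by (rule some_in_proj_pointE)
  then show ?thesis by (simp add: affine_coord_def Let_def)
qed

lemma ball_proj_point_nth [simp]: "(\<forall>y\<in>proj_point x. y $ j \<noteq> 0) \<longleftrightarrow> x $ j \<noteq> 0"
  by (auto simp: proj_point_def intro: exI[of _ 1])

lemma norm_scaling: "norm (c *s z) = cmod c * norm (z :: complex^'n)"
  by (simp add: norm_vec_def norm_mult L2_set_right_distrib)

lemma continuous_on_scaling [continuous_intros]: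
  fixes f :: "'a::topological_space \<Rightarrow> complex" and g :: "'a \<Rightarrow> complex^'n"
  assumes "continuous_on A f" "continuous_on A g"
  shows "continuous_on A (\<lambda>x. f x *s g x)"
  unfolding vector_scalar_mult_def using assms
  by (intro continuous_on_vec_lambda continuous_intros)

text \<open>All topology on a subset of projective space is tested on this preimage, where functions
  of the homogeneous coordinates are ordinary functions on vectors.\<close>

definition affine_cone :: "(complex^'n) set set \<Rightarrow> (complex^'n) set" where
  "affine_cone S = {x. x \<noteq> 0 \<and> proj_point x \<in> S}"

text \<open>The saturation of an open set \<open>U\<close> is the union of its preimages under all
  nonzero scalings, each of which is open.\<close>

lemma open_map_proj_point: "open_map (top_of_set (- {0})) projective_space proj_point"
  unfolding open_map_def
proof (intro allI impI)
  fix U :: "(complex^'n) set"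
  assume "openin (top_of_set (- {0})) U"
  then have U: "open U" "0 \<notin> U" using openin_open_eq[of "- {0::complex^'n}" U] by auto
  have "{x \<in> - {0}. proj_point x \<in> proj_point ` U} = (\<Union>c\<in>-{0}. (\<lambda>x. c *s x) -` U)"
  proof (intro Set.set_eqI iffI)
    fix x assume "x \<in> {x \<in> - {0}. proj_point x \<in> proj_point ` U}"
    then obtain y where "y \<in> U" "proj_point y = proj_point x" by auto
    then show "x \<in> (\<Union>c\<in>-{0}. (\<lambda>x. c *s x) -` U)" by (auto simp: proj_point_eq_iff)
  next
    fix x assume "x \<in> (\<Union>c\<in>-{0}. (\<lambda>x. c *s x) -` U)"
    then obtain c where c: "c \<noteq> 0" "c *s x \<in> U" by auto
    then have "proj_point x \<in> proj_point ` U"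
      by (metis image_eqI proj_point_scale)
    then show "x \<in> {x \<in> - {0}. proj_point x \<in> proj_point ` U}" using c U by auto
  qed
  moreover have "open (\<Union>c\<in>-{0}. (\<lambda>x. c *s x) -` U)"
    by (intro open_UN ballI open_vimage U continuous_intros)
  ultimately show "openin projective_space (proj_point ` U)"
    using U unfolding projective_space_def openin_quotient_topology
    by (auto intro!: open_subset)
qed

text \<open>Quotient maps do not restrict to arbitrary subsets in general; here the restriction is
  again a quotient map because \<open>proj_point\<close> is open and the cone is the full preimage
  of \<open>S\<close>.\<close>

lemma quotient_map_proj_point:
  assumes "S \<subseteq> topspace projective_space"
  shows "quotient_map (top_of_set (affine_cone S)) (subtopology projective_space S) proj_point"
proof -
  have eq: "{x \<in> topspace (top_of_set (- {0})). proj_point x \<in> S} = affine_cone S"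
    by (auto simp: affine_cone_def)
  have "open_map (top_of_set (affine_cone S)) (subtopology projective_space S) proj_point"
    using open_map_restriction[OF open_map_proj_point eq]
    by (simp add: subtopology_subtopology affine_cone_def Int_absorb1 subset_eq)
  moreover have "continuous_map (top_of_set (- {0})) projective_space proj_point"
    unfolding projective_space_def
    by (rule quotient_imp_continuous_map[OF quotient_map_quotient_topology])
  then have "continuous_map (top_of_set (affine_cone S)) (subtopology projective_space S) proj_point"
    unfolding continuous_map_in_subtopology
    by (auto simp: affine_cone_def intro: continuous_map_from_subtopology_mono)
  moreover have "proj_point ` topspace (top_of_set (affine_cone S)) = topspace (subtopology projective_space S)"
    using assms by (auto simp: affine_cone_def topspace_projective_space)
  ultimately show ?thesis by (intro continuous_open_imp_quotient_map)
qed

lemma topspace_subtopology_projective: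
  "S \<subseteq> topspace projective_space \<Longrightarrow> topspace (subtopology projective_space S) = S"
  by auto

lemma proj_pointE:
  assumes "L \<in> topspace projective_space"
  obtains x where "x \<noteq> 0" "L = proj_point x"
  using assms by (auto simp: topspace_projective_space)

lemma continuous_map_from_projective:
  assumes "S \<subseteq> topspace projective_space"
  shows "continuous_map (subtopology projective_space S) T f \<longleftrightarrow>
    continuous_map (top_of_set (affine_cone S)) T (f \<circ> proj_point)"
  using continuous_compose_quotient_map_eq[OF quotient_map_proj_point[OF assms]] by blast

lemma continuous_map_into_projective:
  assumes "continuous_on A f" "\<And>x. x \<in> A \<Longrightarrow> f x \<noteq> 0 \<and> proj_point (f x) \<in> S"
    and "S \<subseteq> topspace projective_space"
  shows "continuous_map (top_of_set A) (subtopology projective_space S) (\<lambda>x. proj_point (f x))"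
proof -
  have "continuous_map (top_of_set A) (top_of_set (affine_cone S)) f"
    using assms by (auto simp: affine_cone_def)
  from continuous_map_compose[OF this quotient_imp_continuous_map[OF quotient_map_proj_point[OF assms(3)]]]
  show ?thesis by (simp add: o_def)
qed

lemma openin_projective:
  assumes "S \<subseteq> topspace projective_space" "U \<subseteq> S"
  shows "openin (subtopology projective_space S) U \<longleftrightarrow>
    openin (top_of_set (affine_cone S)) {x\<in>affine_cone S. proj_point x \<in> U}"
  using quotient_map_proj_point[OF assms(1)] assms
  unfolding quotient_map_def topspace_subtopology_projective[OF assms(1)] by auto

lemma Hausdorff_projective_space: "Hausdorff_space (projective_space :: (complex^'n) set topology)"
  unfolding Hausdorff_space_def
proof (intro allI impI)
  fix L M :: "(complex^'n) set"
  assume *: "L \<in> topspace projective_space \<and> M \<in> topspace projective_space \<and> L \<noteq> M"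
  obtain x where x: "x \<noteq> 0" "L = proj_point x" using * by (auto simp: topspace_projective_space)
  obtain y where y: "y \<noteq> 0" "M = proj_point y" using * by (auto simp: topspace_projective_space)
  \<comment> \<open>The total size of the minors of \<open>z\<close> and \<open>y\<close>, which vanishes exactly on \<open>proj_point y\<close>.\<close>
  define h where "h = (\<lambda>z::complex^'n. (\<Sum>i\<in>UNIV. \<Sum>j\<in>UNIV. cmod (z$i * y$j - z$j * y$i)) / norm z)"
  have h_scale: "h (c *s z) = h z" if "c \<noteq> 0" for c z
  proof -
    have "cmod ((c *s z)$i * y$j - (c *s z)$j * y$i) = cmod c * cmod (z$i * y$j - z$j * y$i)" for i j
      by (simp add: norm_mult[symmetric] algebra_simps)
    then show ?thesis using that
      by (simp add: h_def sum_distrib_left[symmetric] norm_scaling)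
  qed
  have hy: "h y = 0" by (simp add: h_def mult.commute)
  have hx: "h x > 0"
  proof -
    have "h x \<ge> 0" unfolding h_def by (intro divide_nonneg_nonneg sum_nonneg) auto
    moreover have "h x \<noteq> 0"
    proof
      assume "h x = 0"
      then have 0: "x$i * y$j = x$j * y$i" for i j
        using x by (simp add: h_def sum_nonneg sum_nonneg_eq_0_iff)
      obtain j where j: "y $ j \<noteq> 0" using y by (auto simp: vec_eq_iff)
      \<comment> \<open>Where \<open>y $ j\<close> is nonzero, the vanishing minors against column
        \<open>j\<close> give the factor of proportionality.\<close>
      have eq: "x = (x$j / y$j) *s y" using 0[of _ j] j by (auto simp: vec_eq_iff field_simps)
      then have "x $ j \<noteq> 0" using x by auto
      then show False using eq j * x y by (metis divide_eq_0_iff proj_point_scale)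
    qed
    ultimately show ?thesis by simp
  qed
  define e where "e = h x / 2"
  have cont: "continuous_on (- {0}) h" unfolding h_def
    by (intro continuous_intros) auto
  \<comment> \<open>Scale invariance makes \<open>h\<close> independent of the representative, so it
    descends to a continuous function on projective space; its values at \<open>L\<close> and
    \<open>M\<close> lie on different sides of \<open>e\<close>.\<close>
  define k where "k = (\<lambda>N. h (SOME z. z \<in> N))"
  have k: "k (proj_point z) = h z" for z
  proof -
    obtain c where "c \<noteq> 0" "(SOME w. w \<in> proj_point z) = c *s z"
      by (rule some_in_proj_pointE)
    then show ?thesis by (simp add: k_def h_scale)
  qed
  have "continuous_map projective_space euclideanreal k"
    unfolding projective_space_def
    using continuous_compose_quotient_map_eq[OF quotient_map_quotient_topology[of "top_of_set (-{0})" proj_point], of euclideanreal k]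
      cont by (simp add: o_def k)
  then have "openin projective_space {N \<in> topspace projective_space. k N \<in> {..<e}}"
    "openin projective_space {N \<in> topspace projective_space. k N \<in> {e<..}}"
    by (rule openin_continuous_map_preimage; simp)+
  moreover have "k L > e" "k M < e" using hx hy by (auto simp: e_def k x y)
  ultimately show "\<exists>U V. openin projective_space U \<and> openin projective_space V \<and> L \<in> U \<and> M \<in> V \<and> disjnt U V"
    using * by (intro exI[of _ "{N \<in> topspace projective_space. k N \<in> {e<..}}"]
        exI[of _ "{N \<in> topspace projective_space. k N \<in> {..<e}}"]) (auto simp: disjnt_def)
qed

text \<open>Vectors of norm one represent every point of \<open>S\<close>, so a compact part of a
  sphere maps onto it. The cone lacks the origin and need not be closed, hence the auxiliary set
  \<open>K\<close>.\<close>

lemma compact_space_projective_closed: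
  fixes S :: "(complex^'n) set set"
  assumes S: "S \<subseteq> topspace projective_space" and K: "closed K" "affine_cone S = K - {0}"
  shows "compact_space (subtopology projective_space S)"
proof -
  have "compact (sphere 0 1 \<inter> K)" using K by (intro compact_Int_closed) auto
  moreover have "continuous_map (top_of_set (sphere 0 1 \<inter> K)) (subtopology projective_space S) (\<lambda>x. proj_point x)"
    using S K by (intro continuous_map_into_projective) (auto simp: affine_cone_def)
  ultimately have "compactin (subtopology projective_space S) (proj_point ` (sphere 0 1 \<inter> K))"
    by (metis (no_types, lifting) compact_space compact_space_def image_compactin
        compactin_euclidean_iff compactin_subtopology topspace_euclidean_subtopology subset_refl)
  moreover have "S \<subseteq> proj_point ` (sphere 0 1 \<inter> K)"
  proof
    fix L assume L: "L \<in> S"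
    then obtain x where x: "x \<noteq> 0" "L = proj_point x"
      using S by (auto simp: topspace_projective_space)
    define y where "y = complex_of_real (1 / norm x) *s x"
    have "norm y = 1" using x by (simp add: y_def norm_scaling norm_divide)
    moreover have py: "proj_point y = L" using x by (simp add: y_def)
    ultimately have "y \<in> affine_cone S" using L by (auto simp: affine_cone_def)
    then show "L \<in> proj_point ` (sphere 0 1 \<inter> K)" using py \<open>norm y = 1\<close> K by auto
  qed
  moreover have "proj_point ` (sphere 0 1 \<inter> K) \<subseteq> S" using K by (force simp: affine_cone_def)
  ultimately show ?thesis using S
    unfolding compact_space_def topspace_subtopology_projective[OF S] by (metis subset_antisym)
qed

section \<open>Charts and holomorphic maps\<close>

lemma is_chartD:
  assumes "is_chart T (U, \<phi>)"
  shows "openin T U" "U \<subseteq> topspace T" "inj_on \<phi> U" "open (\<phi> ` U)"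
    "continuous_map (subtopology T U) euclidean \<phi>"
    "continuous_map (top_of_set (\<phi> ` U)) (subtopology T U) (inv_into U \<phi>)"
    "\<And>V. openin T V \<Longrightarrow> V \<subseteq> U \<Longrightarrow> open (\<phi> ` V)"
proof -
  have *: "openin T U" "open (\<phi> ` U)" "homeomorphic_map (subtopology T U) (top_of_set (\<phi> ` U)) \<phi>"
    using assms by (auto simp: is_chart_def)
  show "openin T U" "U \<subseteq> topspace T" "open (\<phi> ` U)"
    using * by (auto simp: openin_subset)
  then have ts: "topspace (subtopology T U) = U" by auto
  show inj: "inj_on \<phi> U"
    using homeomorphic_imp_injective_map[OF *(3)] ts by simp
  show "continuous_map (subtopology T U) euclidean \<phi>"
    using homeomorphic_imp_continuous_map[OF *(3)] by (simp add: continuous_map_in_subtopology)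
  obtain g where g: "homeomorphic_maps (subtopology T U) (top_of_set (\<phi> ` U)) \<phi> g"
    using *(3) by (auto simp: homeomorphic_map_maps)
  have "g z = inv_into U \<phi> z" if "z \<in> \<phi> ` U" for z
    using g that inj ts by (auto simp: homeomorphic_maps_def)
  then show "continuous_map (top_of_set (\<phi> ` U)) (subtopology T U) (inv_into U \<phi>)"
    using g by (auto simp: homeomorphic_maps_def intro: continuous_map_eq)
  fix V assume V: "openin T V" "V \<subseteq> U"
  then have "openin (subtopology T U) V" by (auto simp: openin_subtopology)
  then have "openin (top_of_set (\<phi> ` U)) (\<phi> ` V)"
    using homeomorphic_imp_open_map[OF *(3)] by (auto simp: open_map_def)
  then show "open (\<phi> ` V)" using *(2) by (simp add: openin_open_eq)
qed

lemma open_chart_preimage: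
  assumes "is_chart T (U, \<phi>)" "is_chart T' (W, \<psi>)" "continuous_map T T' f"
  shows "open (\<phi> ` {p\<in>U. f p \<in> W})"
proof (rule is_chartD(7)[OF assms(1)])
  have "openin T ({p\<in>topspace T. f p \<in> W} \<inter> U)"
    using openin_continuous_map_preimage[OF assms(3) is_chartD(1)[OF assms(2)]] is_chartD(1)[OF assms(1)]
    by (rule openin_Int)
  moreover have "{p\<in>topspace T. f p \<in> W} \<inter> U = {p\<in>U. f p \<in> W}"
    using is_chartD(2)[OF assms(1)] by auto
  ultimately show "openin T {p\<in>U. f p \<in> W}" by simp
qed auto

text \<open>Holomorphy of a map from a plane domain into projective space, by local lifts to nonzero
  vectors. Lifts are preferred to affine charts because homogeneous polynomial maps act on them
  directly. The condition forces \<open>D\<close> to be open.\<close>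

definition proj_holomorphic :: "complex set \<Rightarrow> (complex \<Rightarrow> (complex^'n) set) \<Rightarrow> bool" where
  "proj_holomorphic D \<gamma> \<longleftrightarrow> (\<forall>z\<in>D. \<exists>N \<sigma>. open N \<and> z \<in> N \<and> N \<subseteq> D \<and>
     (\<forall>i. (\<lambda>w. \<sigma> w $ i) holomorphic_on N) \<and> (\<forall>w\<in>N. \<sigma> w \<noteq> 0 \<and> \<gamma> w = proj_point (\<sigma> w)))"

lemma proj_holomorphicE:
  fixes \<gamma> :: "complex \<Rightarrow> (complex^'n) set"
  assumes "proj_holomorphic D \<gamma>" "z \<in> D"
  obtains N and \<sigma> :: "complex \<Rightarrow> complex^'n" where "open N" "z \<in> N" "N \<subseteq> D" "\<And>i. (\<lambda>w. \<sigma> w $ i) holomorphic_on N"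
    "\<And>w. w \<in> N \<Longrightarrow> \<sigma> w \<noteq> 0" "\<And>w. w \<in> N \<Longrightarrow> \<gamma> w = proj_point (\<sigma> w)"
proof -
  have "\<exists>N \<sigma>. open N \<and> z \<in> N \<and> N \<subseteq> D \<and> (\<forall>i. (\<lambda>w. \<sigma> w $ i) holomorphic_on N) \<and>
      (\<forall>w\<in>N. \<sigma> w \<noteq> 0 \<and> \<gamma> w = proj_point (\<sigma> w))"
    using assms unfolding proj_holomorphic_def by (rule bspec)
  then show thesis by (elim exE conjE) (rule that, auto)
qed

text \<open>The hypothesis \<open>hol\<close> asks that \<open>G\<close> turn componentwise
  holomorphic lifts into such lifts; this takes the place of holomorphy in several
  variables.\<close>

lemma proj_holomorphic_comp:
  fixes G :: "complex^'n \<Rightarrow> complex^'m"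
  assumes \<gamma>: "proj_holomorphic D \<gamma>"
    and G: "\<And>z x. z \<in> D \<Longrightarrow> x \<noteq> 0 \<Longrightarrow> \<gamma> z = proj_point x \<Longrightarrow> G x \<noteq> 0 \<and> \<delta> z = proj_point (G x)"
    and hol: "\<And>N (\<sigma> :: complex \<Rightarrow> complex^'n) i. (\<And>i. (\<lambda>w. \<sigma> w $ i) holomorphic_on N) \<Longrightarrow> (\<lambda>w. G (\<sigma> w) $ i) holomorphic_on N"
  shows "proj_holomorphic D \<delta>"
  unfolding proj_holomorphic_def
proof
  fix z assume "z \<in> D"
  with \<gamma> obtain N \<sigma> where N: "open N" "z \<in> N" "N \<subseteq> D" "\<And>i. (\<lambda>w. \<sigma> w $ i) holomorphic_on N"
    "\<And>w. w \<in> N \<Longrightarrow> \<sigma> w \<noteq> 0" "\<And>w. w \<in> N \<Longrightarrow> \<gamma> w = proj_point (\<sigma> w)"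
    by (rule proj_holomorphicE) blast
  moreover have "(\<lambda>w. G (\<sigma> w) $ i) holomorphic_on N" for i
    by (rule hol) (rule N(4))
  moreover have "G (\<sigma> w) \<noteq> 0 \<and> \<delta> w = proj_point (G (\<sigma> w))" if "w \<in> N" for w
    using G[of w "\<sigma> w"] N that by blast
  ultimately show "\<exists>N \<sigma>. open N \<and> z \<in> N \<and> N \<subseteq> D \<and>
     (\<forall>i. (\<lambda>w. \<sigma> w $ i) holomorphic_on N) \<and> (\<forall>w\<in>N. \<sigma> w \<noteq> 0 \<and> \<delta> w = proj_point (\<sigma> w))"
    by (intro exI[of _ N] exI[of _ "\<lambda>w. G (\<sigma> w)"]) auto
qed

lemma proj_holomorphic_subset:
  assumes "proj_holomorphic D \<gamma>" "open D'" "D' \<subseteq> D"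
  shows "proj_holomorphic D' \<gamma>"
  unfolding proj_holomorphic_def
proof
  fix z assume z: "z \<in> D'"
  obtain N \<sigma> where N: "open N" "z \<in> N" "N \<subseteq> D" "\<And>i. (\<lambda>w. \<sigma> w $ i) holomorphic_on N"
    "\<And>w. w \<in> N \<Longrightarrow> \<sigma> w \<noteq> 0" "\<And>w. w \<in> N \<Longrightarrow> \<gamma> w = proj_point (\<sigma> w)"
    by (rule proj_holomorphicE[OF assms(1) subsetD[OF assms(3) z]]) blast
  then show "\<exists>N \<sigma>. open N \<and> z \<in> N \<and> N \<subseteq> D' \<and>
     (\<forall>i. (\<lambda>w. \<sigma> w $ i) holomorphic_on N) \<and> (\<forall>w\<in>N. \<sigma> w \<noteq> 0 \<and> \<gamma> w = proj_point (\<sigma> w))"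
    using assms z by (intro exI[of _ "N \<inter> D'"] exI[of _ \<sigma>]) (auto intro: holomorphic_on_subset)
qed

lemma continuous_on_vec_holomorphic:
  fixes \<sigma> :: "complex \<Rightarrow> complex^'n"
  assumes "\<And>i. (\<lambda>w. \<sigma> w $ i) holomorphic_on N"
  shows "continuous_on N \<sigma>"
  using continuous_on_vec_lambda[of N "\<lambda>i w. \<sigma> w $ i"] assms
  by (simp add: holomorphic_on_imp_continuous_on)

lemma openin_affine_part:
  assumes S: "S \<subseteq> topspace projective_space" and U: "openin (subtopology projective_space S) U"
  shows "openin (subtopology projective_space S) {L\<in>U. \<forall>x\<in>L. x $ j \<noteq> 0}"
proof -
  have "U \<subseteq> S" using openin_subset[OF U] by auto
  have "openin (top_of_set (affine_cone S)) ({x\<in>affine_cone S. proj_point x \<in> U} \<inter> {x\<in>affine_cone S. x $ j \<noteq> 0})"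
  proof (rule openin_Int)
    show "openin (top_of_set (affine_cone S)) {x\<in>affine_cone S. proj_point x \<in> U}"
      using U openin_projective[OF S \<open>U \<subseteq> S\<close>] by simp
    have "open {x::complex^'a. x $ j \<noteq> 0}" by (intro open_Collect_neq continuous_intros)
    then show "openin (top_of_set (affine_cone S)) {x\<in>affine_cone S. x $ j \<noteq> 0}"
      by (auto simp: openin_open)
  qed
  moreover have "{x\<in>affine_cone S. proj_point x \<in> U} \<inter> {x\<in>affine_cone S. x $ j \<noteq> 0} =
      {x\<in>affine_cone S. proj_point x \<in> {L\<in>U. \<forall>x\<in>L. x $ j \<noteq> 0}}" by auto
  ultimately show ?thesis using \<open>U \<subseteq> S\<close> S by (subst openin_projective) auto
qed

lemma embedded_chartD:
  assumes "(U, \<phi>) \<in> atlas (embedded_curve S)"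
  shows "is_chart (subtopology projective_space S) (U, \<phi>)"
    "(affine_coord j i \<circ> inv_into U \<phi>) holomorphic_on \<phi> ` {L\<in>U. \<forall>x\<in>L. x $ j \<noteq> 0}"
    "z \<in> \<phi> ` {L\<in>U. \<forall>x\<in>L. x $ j \<noteq> 0} \<Longrightarrow> \<exists>i. deriv (affine_coord j i \<circ> inv_into U \<phi>) z \<noteq> 0"
  using assms by (auto simp: embedded_curve_def Let_def)

lemma points_embedded_curve [simp]: "points (embedded_curve S) = subtopology projective_space S"
  by (simp add: embedded_curve_def)

text \<open>Near a point with nonvanishing coordinate \<open>j\<close>, the vector of all affine
  coordinates relative to \<open>j\<close> is a lift, and its entries are holomorphic by definition
  of the atlas.\<close>

lemma proj_holomorphic_chart_inv:
  assumes S: "S \<subseteq> topspace projective_space" and c: "(U, \<phi>) \<in> atlas (embedded_curve S)"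
  shows "proj_holomorphic (\<phi> ` U) (inv_into U \<phi>)"
  unfolding proj_holomorphic_def
proof
  fix z assume z: "z \<in> \<phi> ` U"
  note ch = is_chartD[OF embedded_chartD(1)[OF c]]
  have "U \<subseteq> S" using ch(2) by auto
  let ?L = "inv_into U \<phi>"
  have "?L z \<in> U" using z by (rule inv_into_into)
  then obtain x where x: "x \<noteq> 0" "?L z = proj_point x"
    using \<open>U \<subseteq> S\<close> S by (meson proj_pointE subsetD)
  obtain j where j: "x $ j \<noteq> 0" using x by (auto simp: vec_eq_iff)
  let ?D = "\<phi> ` {L\<in>U. \<forall>x\<in>L. x $ j \<noteq> 0}"
  define \<sigma> where "\<sigma> = (\<lambda>w. \<chi> i. affine_coord j i (?L w))"
  have "\<phi> (?L z) = z" using z by (rule f_inv_into_f)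
  moreover have "?L z \<in> {L\<in>U. \<forall>x\<in>L. x $ j \<noteq> 0}" using \<open>?L z \<in> U\<close> x j by simp
  ultimately have "z \<in> ?D" by (metis (no_types) image_eqI)
  moreover have "open ?D" using ch(7) openin_affine_part[OF S ch(1)] by auto
  moreover have "?D \<subseteq> \<phi> ` U" by auto
  moreover have "(\<lambda>w. \<sigma> w $ i) holomorphic_on ?D" for i
    using embedded_chartD(2)[OF c, of j i] by (simp add: \<sigma>_def o_def)
  moreover have "\<sigma> w \<noteq> 0 \<and> ?L w = proj_point (\<sigma> w)" if "w \<in> ?D" for w
  proof -
    obtain L where L: "L \<in> U" "\<forall>x\<in>L. x $ j \<noteq> 0" "w = \<phi> L" using \<open>w \<in> ?D\<close> by auto
    then have "?L w = L" using ch(3) by simp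
    obtain y where y: "y \<noteq> 0" "L = proj_point y" using L \<open>U \<subseteq> S\<close> S by (meson proj_pointE subsetD)
    have "y $ j \<noteq> 0" using y L by (metis ball_proj_point_nth)
    then have "\<sigma> w = (1 / y $ j) *s y" using \<open>?L w = L\<close> y by (auto simp: \<sigma>_def vec_eq_iff)
    then show ?thesis using \<open>?L w = L\<close> y \<open>y $ j \<noteq> 0\<close> by simp
  qed
  ultimately show "\<exists>N \<sigma>. open N \<and> z \<in> N \<and> N \<subseteq> \<phi> ` U \<and>
     (\<forall>i. (\<lambda>w. \<sigma> w $ i) holomorphic_on N) \<and> (\<forall>w\<in>N. \<sigma> w \<noteq> 0 \<and> ?L w = proj_point (\<sigma> w))"
    by (intro exI[of _ ?D] exI[of _ \<sigma>]) auto
qed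

text \<open>Around a point some affine coordinate is a holomorphic immersion in the chart \<open>\<psi>\<close>, so \<open>\<psi>\<close> is
  locally a holomorphic function of that coordinate.\<close>

lemma chart_comp_proj_holomorphic:
  fixes S :: "(complex^'n) set set"
  assumes S: "S \<subseteq> topspace projective_space" and c: "(W, \<psi>) \<in> atlas (embedded_curve S)"
    and \<gamma>: "proj_holomorphic D \<gamma>" "\<And>z. z \<in> D \<Longrightarrow> \<gamma> z \<in> W"
  shows "(\<psi> \<circ> \<gamma>) holomorphic_on D"
  unfolding holomorphic_on_def
proof
  fix z assume z: "z \<in> D"
  note ch = is_chartD[OF embedded_chartD(1)[OF c]]
  have "W \<subseteq> S" using ch(2) by auto
  obtain N \<sigma> where N: "open N" "z \<in> N" "N \<subseteq> D" "\<And>i. (\<lambda>w. \<sigma> w $ i) holomorphic_on N"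
    "\<And>w. w \<in> N \<Longrightarrow> \<sigma> w \<noteq> 0" "\<And>w. w \<in> N \<Longrightarrow> \<gamma> w = proj_point (\<sigma> w)"
    by (rule proj_holomorphicE[OF \<gamma>(1) z]) blast
  \<comment> \<open>Continuity has to come first: it makes the set \<open>N'\<close> open, on which
    the local inverse of an affine coordinate can be applied.\<close>
  have "continuous_map (top_of_set N) (subtopology projective_space W) (\<lambda>w. proj_point (\<sigma> w))"
  proof (rule continuous_map_into_projective)
    show "continuous_on N \<sigma>" using N(4) by (rule continuous_on_vec_holomorphic)
    show "\<sigma> w \<noteq> 0 \<and> proj_point (\<sigma> w) \<in> W" if "w \<in> N" for w
      using N(3) N(5)[OF that] N(6)[OF that] \<gamma>(2)[of w] that by auto
    show "W \<subseteq> topspace projective_space" using S \<open>W \<subseteq> S\<close> by auto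
  qed
  moreover have "continuous_map (subtopology projective_space W) euclidean \<psi>"
    using ch(5) \<open>W \<subseteq> S\<close> by (simp add: subtopology_subtopology Int_absorb1)
  ultimately have "continuous_map (top_of_set N) euclidean (\<psi> \<circ> (\<lambda>w. proj_point (\<sigma> w)))"
    by (rule continuous_map_compose)
  then have cont: "continuous_on N (\<psi> \<circ> \<gamma>)"
    using N(6) by (simp cong: continuous_on_cong)
  obtain j where j: "\<sigma> z $ j \<noteq> 0" using N(5)[OF N(2)] by (auto simp: vec_eq_iff)
  let ?D = "\<psi> ` {L\<in>W. \<forall>x\<in>L. x $ j \<noteq> 0}"
  have "open ?D" using ch(7) openin_affine_part[OF S ch(1)] by auto
  have "\<forall>x\<in>\<gamma> z. x $ j \<noteq> 0" using j N(2,6) by simp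
  then have zD: "\<psi> (\<gamma> z) \<in> ?D" using \<gamma>(2)[OF z] by blast
  then obtain i where i: "deriv (affine_coord j i \<circ> inv_into W \<psi>) (\<psi> (\<gamma> z)) \<noteq> 0"
    using embedded_chartD(3)[OF c] by blast
  define g where "g = affine_coord j i \<circ> inv_into W \<psi>"
  have g: "g holomorphic_on ?D" using embedded_chartD(2)[OF c] by (simp add: g_def)
  obtain r where r: "r > 0" "ball (\<psi> (\<gamma> z)) r \<subseteq> ?D" "inj_on g (ball (\<psi> (\<gamma> z)) r)"
    using has_complex_derivative_locally_injective[OF g zD \<open>open ?D\<close>] i by (auto simp: g_def)
  obtain h where h: "h holomorphic_on g ` ball (\<psi> (\<gamma> z)) r"
      "\<And>w. w \<in> ball (\<psi> (\<gamma> z)) r \<Longrightarrow> h (g w) = w"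
    using holomorphic_has_inverse[OF holomorphic_on_subset[OF g r(2)] open_ball r(3)] by metis
  \<comment> \<open>On \<open>N'\<close> the chart is recovered from the lift: \<open>h\<close>
    applied to the quotient of the coordinates \<open>i\<close> and \<open>j\<close> of
    \<open>\<sigma>\<close> is \<open>\<psi> \<circ> \<gamma>\<close>.\<close>
  define N' where "N' = {w\<in>N. (\<psi> \<circ> \<gamma>) w \<in> ball (\<psi> (\<gamma> z)) r}"
  have "N' = N \<inter> (\<psi> \<circ> \<gamma>) -` ball (\<psi> (\<gamma> z)) r" by (auto simp: N'_def)
  then have "open N'" using continuous_open_preimage[OF cont N(1) open_ball] by simp
  have "z \<in> N'" using N r by (simp add: N'_def)
  have gN: "g (\<psi> (\<gamma> w)) = \<sigma> w $ i / \<sigma> w $ j" "\<sigma> w $ j \<noteq> 0" if "w \<in> N'" for w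
  proof -
    have w: "w \<in> N" "\<psi> (\<gamma> w) \<in> ?D" using that r by (auto simp: N'_def)
    then have "\<gamma> w \<in> W" using \<gamma>(2) N(3) by auto
    show "g (\<psi> (\<gamma> w)) = \<sigma> w $ i / \<sigma> w $ j"
      using \<open>\<gamma> w \<in> W\<close> ch(3) N(6)[OF w(1)] by (simp add: g_def)
    obtain L where "L \<in> W" "\<forall>x\<in>L. x $ j \<noteq> 0" "\<psi> (\<gamma> w) = \<psi> L" using w by auto
    then have "L = \<gamma> w" using ch(3) \<open>\<gamma> w \<in> W\<close> by (auto dest: inj_onD)
    then show "\<sigma> w $ j \<noteq> 0" using \<open>\<forall>x\<in>L. x $ j \<noteq> 0\<close> N(6)[OF w(1)] by simp
  qed
  have "(\<lambda>w. \<sigma> w $ i / \<sigma> w $ j) holomorphic_on N'"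
    using gN by (intro holomorphic_intros holomorphic_on_subset[OF N(4)]) (auto simp: N'_def)
  moreover have "(\<lambda>w. \<sigma> w $ i / \<sigma> w $ j) ` N' \<subseteq> g ` ball (\<psi> (\<gamma> z)) r"
    using gN(1) by (force simp: N'_def)
  ultimately have "(h \<circ> (\<lambda>w. \<sigma> w $ i / \<sigma> w $ j)) holomorphic_on N'"
    using h(1) by (blast intro: holomorphic_on_compose_gen)
  moreover have "(h \<circ> (\<lambda>w. \<sigma> w $ i / \<sigma> w $ j)) w = (\<psi> \<circ> \<gamma>) w" if "w \<in> N'" for w
    using gN(1)[OF that] h(2)[of "\<psi> (\<gamma> w)"] that by (auto simp: N'_def)
  ultimately have "(\<psi> \<circ> \<gamma>) holomorphic_on N'" by (rule holomorphic_transform)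
  then show "(\<psi> \<circ> \<gamma>) field_differentiable at z within D"
    using \<open>open N'\<close> \<open>z \<in> N'\<close> by (metis field_differentiable_at_within holomorphic_on_imp_differentiable_at)
qed

text \<open>A transition map is a chart after an inverse chart; the latter is holomorphic into
  projective space, and charts turn such maps into holomorphic functions. What remains for a
  concrete curve is connectedness and enough charts.\<close>

lemma riemann_surface_embedded_curve:
  assumes S: "S \<subseteq> topspace projective_space"
    and conn: "connected_space (subtopology projective_space S)" and ne: "S \<noteq> {}"
    and cov: "\<And>L. L \<in> S \<Longrightarrow> \<exists>U \<phi>. (U, \<phi>) \<in> atlas (embedded_curve S) \<and> L \<in> U"
  shows "riemann_surface (embedded_curve S)"
proof -
  have ts: "topspace (subtopology projective_space S) = S" using S by auto
  have "(\<psi> \<circ> inv_into U \<phi>) holomorphic_on \<phi> ` (U \<inter> W)"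
    if U: "(U, \<phi>) \<in> atlas (embedded_curve S)" and W: "(W, \<psi>) \<in> atlas (embedded_curve S)" for U \<phi> W \<psi>
  proof (rule chart_comp_proj_holomorphic[OF S W])
    note ch = is_chartD[OF embedded_chartD(1)[OF U]]
    have "open (\<phi> ` (U \<inter> W))" using ch is_chartD(1)[OF embedded_chartD(1)[OF W]] by auto
    then show "proj_holomorphic (\<phi> ` (U \<inter> W)) (inv_into U \<phi>)"
      by (intro proj_holomorphic_subset[OF proj_holomorphic_chart_inv[OF S U]]) auto
    show "inv_into U \<phi> z \<in> W" if "z \<in> \<phi> ` (U \<inter> W)" for z
      using that ch(3) by auto
  qed
  moreover have "(\<Union>(U, \<phi>)\<in>atlas (embedded_curve S). U) = S"
  proof (intro subset_antisym subsetI)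
    fix L assume "L \<in> (\<Union>(U, \<phi>)\<in>atlas (embedded_curve S). U)"
    then obtain U \<phi> where "(U, \<phi>) \<in> atlas (embedded_curve S)" "L \<in> U" by auto
    then show "L \<in> S" using is_chartD(2)[OF embedded_chartD(1)] ts by blast
  next
    fix L assume "L \<in> S"
    then show "L \<in> (\<Union>(U, \<phi>)\<in>atlas (embedded_curve S). U)" using cov by fast
  qed
  moreover have "\<forall>c\<in>atlas (embedded_curve S). is_chart (subtopology projective_space S) c"
    using embedded_chartD(1) by auto
  ultimately show ?thesis
    unfolding riemann_surface_def points_embedded_curve ts
    using conn ne Hausdorff_space_subtopology[OF Hausdorff_projective_space] by blast
qed

section \<open>Charts given by quotients of linear forms\<close>

definition lin_form :: "complex^'n \<Rightarrow> complex^'n \<Rightarrow> complex" where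
  "lin_form c x = (\<Sum>i\<in>UNIV. c $ i * x $ i)"

definition lin_coord :: "complex^'n \<Rightarrow> complex^'n \<Rightarrow> (complex^'n) set \<Rightarrow> complex" where
  "lin_coord l m L = (let x = (SOME x. x \<in> L) in lin_form m x / lin_form l x)"

lemma lin_form_scaling [simp]: "lin_form c (k *s x) = k * lin_form c x"
  by (simp add: lin_form_def sum_distrib_left algebra_simps)

lemma lin_form_axis [simp]: "lin_form (axis i 1) x = x $ i"
  by (simp add: lin_form_def axis_def if_distrib if_distribR cong: if_cong)

lemma continuous_on_lin_form [continuous_intros]:
  fixes f :: "'a::topological_space \<Rightarrow> complex^'n"
  shows "continuous_on A f \<Longrightarrow> continuous_on A (\<lambda>x. lin_form c (f x))"
  unfolding lin_form_def by (intro continuous_intros)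

lemma lin_coord_proj_point [simp]: "lin_coord l m (proj_point x) = lin_form m x / lin_form l x"
proof -
  obtain c where "c \<noteq> 0" "(SOME y. y \<in> proj_point x) = c *s x"
    by (rule some_in_proj_pointE)
  then show ?thesis by (simp add: lin_coord_def Let_def)
qed

text \<open>On the hyperplane \<open>l = 1\<close>, the part of \<open>S\<close> in \<open>A\<close> is the graph \<open>\<sigma>\<close> over the linear form \<open>m\<close>.  Since
  \<open>l \<circ> \<sigma> = 1\<close> and \<open>m \<circ> \<sigma> = id\<close>, the derivative of \<open>\<sigma>\<close> is not proportional to \<open>\<sigma>\<close>, which makes \<open>\<sigma>\<close> an immersion
  into projective space.\<close>

lemma embedded_chartI:
  fixes \<sigma> :: "complex \<Rightarrow> complex^'n"
  assumes S: "S \<subseteq> topspace projective_space" and D: "open D" and A: "open A"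
    and hol: "\<And>i. (\<lambda>z. \<sigma> z $ i) holomorphic_on D"
    and p1: "\<And>z. z \<in> D \<Longrightarrow> \<sigma> z \<in> A \<and> lin_form l (\<sigma> z) = 1 \<and> lin_form m (\<sigma> z) = z \<and> proj_point (\<sigma> z) \<in> S"
    and p2: "\<And>x. x \<in> A \<Longrightarrow> lin_form l x = 1 \<Longrightarrow> proj_point x \<in> S \<Longrightarrow>
      lin_form m x \<in> D \<and> \<sigma> (lin_form m x) = x"
  defines "U \<equiv> (\<lambda>z. proj_point (\<sigma> z)) ` D"
  shows "(U, lin_coord l m) \<in> atlas (embedded_curve S)"
    and "lin_coord l m ` U = D"
    and "\<And>z. z \<in> D \<Longrightarrow> inv_into U (lin_coord l m) z = proj_point (\<sigma> z)"
proof -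
  let ?\<phi> = "lin_coord l m"
  have nz: "\<sigma> z \<noteq> 0" if "z \<in> D" for z
    using p1[OF that] by (auto simp: lin_form_def)
  have US: "U \<subseteq> S" using p1 by (auto simp: U_def)
  with S have UP: "U \<subseteq> topspace projective_space" by simp
  have \<phi>: "?\<phi> (proj_point (\<sigma> z)) = z" if "z \<in> D" for z using p1[OF that] by simp
  show im: "?\<phi> ` U = D" using \<phi> by (force simp: U_def)
  have inj: "inj_on ?\<phi> U" using \<phi> by (auto simp: U_def inj_on_def)
  show inv: "inv_into U ?\<phi> z = proj_point (\<sigma> z)" if "z \<in> D" for z
    using inv_into_f_f[OF inj, of "proj_point (\<sigma> z)"] \<phi>[OF that] that by (auto simp: U_def)
  \<comment> \<open>Rescaling to \<open>l = 1\<close> brings the cone over \<open>U\<close> into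
    \<open>A\<close>; this describes it by an open condition and so shows that \<open>U\<close> is
    open in \<open>S\<close>.\<close>
  have coneU: "{x \<in> affine_cone S. proj_point x \<in> U} = affine_cone S \<inter> {x. lin_form l x \<noteq> 0 \<and> (1 / lin_form l x) *s x \<in> A}"
  proof (intro Set.set_eqI iffI)
    fix x assume x: "x \<in> {x \<in> affine_cone S. proj_point x \<in> U}"
    then obtain z c where z: "z \<in> D" "c \<noteq> 0" "x = c *s \<sigma> z"
      by (auto simp: U_def proj_point_eq_iff)
    then have "lin_form l x = c" using p1 by simp
    then show "x \<in> affine_cone S \<inter> {x. lin_form l x \<noteq> 0 \<and> (1 / lin_form l x) *s x \<in> A}"
      using x z p1 by auto
  next
    fix x assume x: "x \<in> affine_cone S \<inter> {x. lin_form l x \<noteq> 0 \<and> (1 / lin_form l x) *s x \<in> A}"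
    define y where "y = (1 / lin_form l x) *s x"
    have py: "proj_point y = proj_point x" using x by (simp add: y_def)
    have "lin_form l y = 1" using x by (simp add: y_def)
    then have "lin_form m y \<in> D" "\<sigma> (lin_form m y) = y"
      using p2[of y] x py by (auto simp: y_def[symmetric] affine_cone_def)
    then have "proj_point y \<in> U" unfolding U_def by (metis image_eqI)
    then show "x \<in> {x \<in> affine_cone S. proj_point x \<in> U}" using x py by simp
  qed
  have "open {x. lin_form l x \<noteq> 0}" by (intro open_Collect_neq continuous_intros)
  moreover have "continuous_on {x. lin_form l x \<noteq> 0} (\<lambda>x. (1 / lin_form l x) *s x)"
    by (intro continuous_intros) auto
  ultimately have "open ({x. lin_form l x \<noteq> 0} \<inter> (\<lambda>x. (1 / lin_form l x) *s x) -` A)"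
    by (intro continuous_open_preimage A)
  then have "open {x. lin_form l x \<noteq> 0 \<and> (1 / lin_form l x) *s x \<in> A}"
    by (simp add: vimage_def Collect_conj_eq)
  then have opU: "openin (subtopology projective_space S) U"
    unfolding openin_projective[OF S US] coneU by (auto simp: openin_open)
  have "continuous_map (subtopology projective_space U) (top_of_set D) ?\<phi>"
  proof -
    have "lin_form l x \<noteq> 0" if "x \<in> affine_cone U" for x
      using that coneU US by (auto simp: affine_cone_def)
    then have "continuous_on (affine_cone U) (\<lambda>x. lin_form m x / lin_form l x)"
      by (intro continuous_intros) auto
    then have "continuous_map (subtopology projective_space U) euclidean ?\<phi>"
      unfolding continuous_map_from_projective[OF UP] by (simp add: o_def)
    then show ?thesis using im UP by (auto simp: continuous_map_in_subtopology)
  qed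
  moreover have "continuous_map (top_of_set D) (subtopology projective_space U) (\<lambda>z. proj_point (\<sigma> z))"
    using hol nz UP by (intro continuous_map_into_projective continuous_on_vec_holomorphic) (auto simp: U_def)
  ultimately have "homeomorphic_maps (subtopology projective_space U) (top_of_set D) ?\<phi> (\<lambda>z. proj_point (\<sigma> z))"
    using \<phi> unfolding homeomorphic_maps_def by (auto simp: U_def)
  then have "homeomorphic_map (subtopology projective_space U) (top_of_set D) ?\<phi>"
    by (rule homeomorphic_maps_imp_map)
  then have chart: "is_chart (subtopology projective_space S) (U, ?\<phi>)"
    using opU D im US by (simp add: is_chart_def subtopology_subtopology Int_absorb1)
  have Dj: "?\<phi> ` {L\<in>U. \<forall>x\<in>L. x $ j \<noteq> 0} = {z\<in>D. \<sigma> z $ j \<noteq> 0}" (is "_ = ?D j") for j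
  proof -
    have "{L\<in>U. \<forall>x\<in>L. x $ j \<noteq> 0} = (\<lambda>z. proj_point (\<sigma> z)) ` ?D j"
      using ball_proj_point_nth by (auto simp: U_def simp del: ball_proj_point_nth)
    then show ?thesis using \<phi> by (force simp: image_image)
  qed
  have coord: "(affine_coord j i \<circ> inv_into U ?\<phi>) z = \<sigma> z $ i / \<sigma> z $ j" if "z \<in> D" for i j z
    using inv[OF that] by simp
  have h: "(\<lambda>z. \<sigma> z $ i / \<sigma> z $ j) holomorphic_on ?D j" for i j
    by (intro holomorphic_intros holomorphic_on_subset[OF hol]) auto
  have 1: "(affine_coord j i \<circ> inv_into U ?\<phi>) holomorphic_on ?D j" for i j
    using h by (rule holomorphic_transform) (use coord in auto)
  have 2: "\<exists>i. deriv (affine_coord j i \<circ> inv_into U ?\<phi>) z \<noteq> 0" if z: "z \<in> ?D j" for j z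
  proof (rule ccontr)
    assume neg: "\<not> ?thesis"
    define s where "s i = deriv (\<lambda>w. \<sigma> w $ i) z" for i
    have s: "((\<lambda>w. \<sigma> w $ i) has_field_derivative s i) (at z)" for i
      using hol[of i] z D by (auto simp: s_def intro: holomorphic_derivI)
    have lin: "((\<lambda>w. lin_form c (\<sigma> w)) has_field_derivative lin_form c (\<chi> i. s i)) (at z)" for c
      unfolding lin_form_def by (auto intro!: derivative_eq_intros s sum.cong)
    have "((\<lambda>w. 1) has_field_derivative lin_form l (\<chi> i. s i)) (at z)"
      by (rule has_field_derivative_transform_within_open[OF lin D]) (use p1 z in auto)
    then have l: "lin_form l (\<chi> i. s i) = 0" using DERIV_const DERIV_unique by blast
    have "((\<lambda>w. w) has_field_derivative lin_form m (\<chi> i. s i)) (at z)"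
      by (rule has_field_derivative_transform_within_open[OF lin D]) (use p1 z in auto)
    then have m: "lin_form m (\<chi> i. s i) = 1" using DERIV_ident DERIV_unique by blast
    \<comment> \<open>If the derivatives of all affine coordinates vanish, the quotient rule makes
      the derivative of the lift proportional to the lift.\<close>
    have par: "s i * \<sigma> z $ j = \<sigma> z $ i * s j" for i
    proof -
      have "((\<lambda>w. \<sigma> w $ i / \<sigma> w $ j) has_field_derivative
          (s i * \<sigma> z $ j - \<sigma> z $ i * s j) / (\<sigma> z $ j * \<sigma> z $ j)) (at z)"
        using z by (intro DERIV_divide s) auto
      then have "((affine_coord j i \<circ> inv_into U ?\<phi>) has_field_derivative
          (s i * \<sigma> z $ j - \<sigma> z $ i * s j) / (\<sigma> z $ j * \<sigma> z $ j)) (at z)"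
        by (rule has_field_derivative_transform_within_open[OF _ D]) (use coord z in auto)
      then have "(s i * \<sigma> z $ j - \<sigma> z $ i * s j) / (\<sigma> z $ j * \<sigma> z $ j) = 0"
        using neg DERIV_imp_deriv by metis
      then show ?thesis using z by simp
    qed
    \<comment> \<open>Applied to \<open>l\<close>, proportionality gives \<open>s j = 0\<close>;
      applied to \<open>m\<close>, it then gives \<open>\<sigma> z $ j = 0\<close>, which is
      excluded.\<close>
    have "lin_form c (\<chi> i. s i) * \<sigma> z $ j = lin_form c (\<sigma> z) * s j" for c
      unfolding lin_form_def sum_distrib_right by (rule sum.cong) (auto simp: mult.assoc par)
    from this[of l] this[of m] show False using l m p1[of z] z by auto
  qed
  show "(U, ?\<phi>) \<in> atlas (embedded_curve S)"
    using chart 1 2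
    unfolding embedded_curve_def Let_def Dj surface.select_convs mem_Collect_eq prod.case by blast
qed

section \<open>Transport of a complex structure along a homeomorphism\<close>

lemma riemann_surfaceD:
  assumes "riemann_surface X"
  shows "Hausdorff_space (points X)" "connected_space (points X)" "topspace (points X) \<noteq> {}"
    "\<And>U \<phi>. (U, \<phi>) \<in> atlas X \<Longrightarrow> is_chart (points X) (U, \<phi>)"
    "\<And>p. p \<in> topspace (points X) \<Longrightarrow> \<exists>U \<phi>. (U, \<phi>) \<in> atlas X \<and> p \<in> U"
    "\<And>U \<phi> W \<psi>. (U, \<phi>) \<in> atlas X \<Longrightarrow> (W, \<psi>) \<in> atlas X \<Longrightarrow>
        (\<psi> \<circ> inv_into U \<phi>) holomorphic_on \<phi> ` (U \<inter> W)"
proof -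
  show "\<exists>U \<phi>. (U, \<phi>) \<in> atlas X \<and> p \<in> U" if "p \<in> topspace (points X)" for p
  proof -
    have "p \<in> (\<Union>(U, \<phi>)\<in>atlas X. U)" using assms that by (simp add: riemann_surface_def)
    then show ?thesis by auto
  qed
qed (use assms in \<open>auto simp: riemann_surface_def\<close>)

text \<open>It suffices to test each chart of \<open>X\<close> against one chart of \<open>Y\<close> near each point, and in one direction
  only, since injective holomorphic functions have holomorphic inverses.\<close>

locale surface_transfer =
  fixes X :: "'a surface" and Y :: "'b surface" and F :: "'a \<Rightarrow> 'b"
  assumes Y: "riemann_surface Y"
    and F: "homeomorphic_map (points X) (points Y) F"
    and ch: "\<And>U \<phi>. (U, \<phi>) \<in> atlas X \<Longrightarrow> is_chart (points X) (U, \<phi>)"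
    and cov: "\<And>p. p \<in> topspace (points X) \<Longrightarrow> \<exists>U \<phi>. (U, \<phi>) \<in> atlas X \<and> p \<in> U"
    and hol: "\<And>U \<phi> p. (U, \<phi>) \<in> atlas X \<Longrightarrow> p \<in> U \<Longrightarrow>
      \<exists>W \<psi> N. (W, \<psi>) \<in> atlas Y \<and> F p \<in> W \<and> open N \<and> \<psi> (F p) \<in> N \<and>
        (\<phi> \<circ> inv_into (topspace (points X)) F \<circ> inv_into W \<psi>) holomorphic_on (N \<inter> \<psi> ` (W \<inter> F ` U))"
begin

abbreviation "G \<equiv> inv_into (topspace (points X)) F"

lemma GF: "p \<in> topspace (points X) \<Longrightarrow> G (F p) = p"
  using homeomorphic_imp_injective_map[OF F] by (rule inv_into_f_f)

lemma F_image: "F ` topspace (points X) = topspace (points Y)"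
  using homeomorphic_imp_surjective_map[OF F] .

lemma FG: "q \<in> topspace (points Y) \<Longrightarrow> F (G q) = q"
  using F_image by (metis f_inv_into_f)

lemma continuous_F: "continuous_map (points X) (points Y) F"
  using homeomorphic_imp_continuous_map[OF F] .

lemma continuous_G: "continuous_map (points Y) (points X) G"
proof -
  obtain g where g: "homeomorphic_maps (points X) (points Y) F g"
    using F by (auto simp: homeomorphic_map_maps)
  have "g q = G q" if "q \<in> topspace (points Y)" for q
  proof -
    have "g q \<in> topspace (points X)" "F (g q) = q"
      using g that by (auto simp: homeomorphic_maps_def continuous_map_def Pi_iff)
    then show ?thesis using GF by metis
  qed
  then show ?thesis using g by (auto simp: homeomorphic_maps_def intro: continuous_map_eq)
qed

lemma chart_subset: "(U, \<phi>) \<in> atlas X \<Longrightarrow> U \<subseteq> topspace (points X)"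
  using is_chartD(2)[OF ch] .

lemma open_image:
  assumes U: "(U, \<phi>) \<in> atlas X" and W: "(W, \<psi>) \<in> atlas Y"
  shows "open (\<psi> ` (W \<inter> F ` U))"
proof -
  have "openin (points Y) (F ` U)"
    using homeomorphic_imp_open_map[OF F] is_chartD(1)[OF ch[OF U]] by (simp add: open_map_def)
  then show ?thesis
    using is_chartD(1,7)[OF riemann_surfaceD(4)[OF Y W]] by auto
qed

text \<open>The locale provides one suitable chart of \<open>Y\<close> near each point; a transition
  map of \<open>Y\<close> carries the statement to every other chart.\<close>

lemma chart_G_holomorphic:
  assumes U: "(U, \<phi>) \<in> atlas X" and W: "(W, \<psi>) \<in> atlas Y"
  shows "(\<phi> \<circ> G \<circ> inv_into W \<psi>) holomorphic_on \<psi> ` (W \<inter> F ` U)"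
  unfolding holomorphic_on_def
proof
  fix z assume "z \<in> \<psi> ` (W \<inter> F ` U)"
  then obtain p where p: "p \<in> U" "F p \<in> W" "z = \<psi> (F p)" by auto
  obtain W' \<psi>' N where W': "(W', \<psi>') \<in> atlas Y" "F p \<in> W'" "open N" "\<psi>' (F p) \<in> N"
    and h: "(\<phi> \<circ> G \<circ> inv_into W' \<psi>') holomorphic_on (N \<inter> \<psi>' ` (W' \<inter> F ` U))"
    using hol[OF U p(1)] by blast
  note cW = is_chartD[OF riemann_surfaceD(4)[OF Y W]]
  note cW' = is_chartD[OF riemann_surfaceD(4)[OF Y W'(1)]]
  define t where "t = \<psi>' \<circ> inv_into W \<psi>"
  have t: "t holomorphic_on \<psi> ` (W \<inter> W')"
    using riemann_surfaceD(6)[OF Y W W'(1)] by (simp add: t_def)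
  have t\<psi>: "t (\<psi> q) = \<psi>' q" if "q \<in> W" for q using that cW(3) by (simp add: t_def)
  define A where "A = W \<inter> W' \<inter> F ` U"
  have "openin (points Y) (F ` U)"
    using homeomorphic_imp_open_map[OF F] is_chartD(1)[OF ch[OF U]] by (simp add: open_map_def)
  then have "open (\<psi> ` A)" unfolding A_def using cW(1) cW'(1) by (intro cW(7)) auto
  moreover have tA: "t holomorphic_on \<psi> ` A" using t by (rule holomorphic_on_subset) (auto simp: A_def)
  ultimately have M: "open (\<psi> ` A \<inter> t -` N)"
    using W'(3) by (intro continuous_open_preimage holomorphic_on_imp_continuous_on)
  have "((\<phi> \<circ> G \<circ> inv_into W' \<psi>') \<circ> t) holomorphic_on \<psi> ` A \<inter> t -` N"
  proof (rule holomorphic_on_compose_gen[OF _ h])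
    show "t holomorphic_on \<psi> ` A \<inter> t -` N" using tA by (rule holomorphic_on_subset) auto
    show "t ` (\<psi> ` A \<inter> t -` N) \<subseteq> N \<inter> \<psi>' ` (W' \<inter> F ` U)" by (auto simp: A_def t\<psi>)
  qed
  moreover have "((\<phi> \<circ> G \<circ> inv_into W' \<psi>') \<circ> t) w = (\<phi> \<circ> G \<circ> inv_into W \<psi>) w"
    if "w \<in> \<psi> ` A \<inter> t -` N" for w
    using that cW(3) cW'(3) by (auto simp: A_def t\<psi>)
  ultimately have "(\<phi> \<circ> G \<circ> inv_into W \<psi>) holomorphic_on \<psi> ` A \<inter> t -` N"
    by (rule holomorphic_transform)
  moreover have "z \<in> \<psi> ` A \<inter> t -` N" using p W' by (auto simp: A_def t\<psi>)
  ultimately show "(\<phi> \<circ> G \<circ> inv_into W \<psi>) field_differentiable at z within \<psi> ` (W \<inter> F ` U)"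
    using M by (metis field_differentiable_at_within holomorphic_on_imp_differentiable_at)
qed

lemma chart_F_holomorphic:
  assumes U: "(U, \<phi>) \<in> atlas X" and W: "(W, \<psi>) \<in> atlas Y"
  shows "(\<psi> \<circ> F \<circ> inv_into U \<phi>) holomorphic_on \<phi> ` {p\<in>U. F p \<in> W}"
proof -
  let ?H = "\<phi> \<circ> G \<circ> inv_into W \<psi>" and ?Q = "\<psi> ` (W \<inter> F ` U)"
  note cW = is_chartD[OF riemann_surfaceD(4)[OF Y W]]
  note cU = is_chartD[OF ch[OF U]]
  have H: "?H (\<psi> (F p)) = \<phi> p" if "p \<in> U" "F p \<in> W" for p
    using that cW(3) GF cU(2) by auto
  have "inj_on ?H ?Q"
  proof (rule inj_onI)
    fix z z' assume "z \<in> ?Q" "z' \<in> ?Q" and eq: "?H z = ?H z'"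
    then obtain p p' where p: "p \<in> U" "F p \<in> W" "z = \<psi> (F p)" "p' \<in> U" "F p' \<in> W" "z' = \<psi> (F p')"
      by auto
    then have "\<phi> p = \<phi> p'" using eq H by metis
    then show "z = z'" using p cU(3) by (auto dest: inj_onD)
  qed
  then obtain g where g: "g holomorphic_on ?H ` ?Q" "\<And>z. z \<in> ?Q \<Longrightarrow> g (?H z) = z"
    using holomorphic_has_inverse[OF chart_G_holomorphic[OF U W] open_image[OF U W]] by metis
  have eq: "(\<psi> \<circ> F \<circ> inv_into U \<phi>) z = g z" "z \<in> ?H ` ?Q" if z: "z \<in> \<phi> ` {p\<in>U. F p \<in> W}" for z
  proof -
    obtain p where p: "p \<in> U" "F p \<in> W" "z = \<phi> p" using z by auto
    then have Q: "\<psi> (F p) \<in> ?Q" by auto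
    show "(\<psi> \<circ> F \<circ> inv_into U \<phi>) z = g z" using g(2)[OF Q] H[OF p(1,2)] p cU(3) by simp
    show "z \<in> ?H ` ?Q" using Q H[OF p(1,2)] p(3) by (metis imageI)
  qed
  show ?thesis
  proof (rule holomorphic_transform)
    show "g holomorphic_on \<phi> ` {p\<in>U. F p \<in> W}"
      by (rule holomorphic_on_subset[OF g(1)]) (use eq(2) in blast)
  qed (rule eq(1)[symmetric])
qed

text \<open>Locally a transition map of \<open>X\<close> factors through a chart of
  \<open>Y\<close>, by \<open>F\<close> into \<open>Y\<close> and by \<open>G\<close> back.
  Compatibility of the atlas of \<open>X\<close> is thus a conclusion.\<close>

lemma transition_holomorphic:
  assumes U: "(U, \<phi>) \<in> atlas X" and V: "(V, \<theta>) \<in> atlas X"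
  shows "(\<theta> \<circ> inv_into U \<phi>) holomorphic_on \<phi> ` (U \<inter> V)"
  unfolding holomorphic_on_def
proof
  fix z assume "z \<in> \<phi> ` (U \<inter> V)"
  then obtain p where p: "p \<in> U" "p \<in> V" "z = \<phi> p" by auto
  note cU = is_chartD[OF ch[OF U]]
  note cV = is_chartD[OF ch[OF V]]
  have "F p \<in> topspace (points Y)" using p cU(2) F_image by auto
  then obtain W \<psi> where W: "(W, \<psi>) \<in> atlas Y" "F p \<in> W" using riemann_surfaceD(5)[OF Y] by blast
  note cW = is_chartD[OF riemann_surfaceD(4)[OF Y W(1)]]
  define A where "A = {p\<in>U \<inter> V. F p \<in> W}"
  have "openin (points X) {p \<in> topspace (points X). F p \<in> W}"
    using continuous_F cW(1) by (rule openin_continuous_map_preimage)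
  then have "openin (points X) ({p \<in> topspace (points X). F p \<in> W} \<inter> (U \<inter> V))"
    using cU(1) cV(1) by blast
  moreover have "{p \<in> topspace (points X). F p \<in> W} \<inter> (U \<inter> V) = A" using cU(2) by (auto simp: A_def)
  ultimately have "open (\<phi> ` A)" using cU(7) by (auto simp: A_def)
  have "((\<theta> \<circ> G \<circ> inv_into W \<psi>) \<circ> (\<psi> \<circ> F \<circ> inv_into U \<phi>)) holomorphic_on \<phi> ` A"
  proof (rule holomorphic_on_compose_gen[OF _ chart_G_holomorphic[OF V W(1)]])
    show "(\<psi> \<circ> F \<circ> inv_into U \<phi>) holomorphic_on \<phi> ` A"
      by (rule holomorphic_on_subset[OF chart_F_holomorphic[OF U W(1)]]) (auto simp: A_def)
    show "(\<psi> \<circ> F \<circ> inv_into U \<phi>) ` \<phi> ` A \<subseteq> \<psi> ` (W \<inter> F ` V)"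
      using cU(3) by (auto simp: A_def)
  qed
  moreover have "((\<theta> \<circ> G \<circ> inv_into W \<psi>) \<circ> (\<psi> \<circ> F \<circ> inv_into U \<phi>)) w = (\<theta> \<circ> inv_into U \<phi>) w"
    if "w \<in> \<phi> ` A" for w
    using that cU(2,3) cW(3) GF by (auto simp: A_def)
  ultimately have "(\<theta> \<circ> inv_into U \<phi>) holomorphic_on \<phi> ` A"
    by (rule holomorphic_transform)
  moreover have "z \<in> \<phi> ` A" using p W by (auto simp: A_def)
  ultimately show "(\<theta> \<circ> inv_into U \<phi>) field_differentiable at z within \<phi> ` (U \<inter> V)"
    using \<open>open (\<phi> ` A)\<close> by (metis field_differentiable_at_within holomorphic_on_imp_differentiable_at)
qed

lemma riemann_surface: "riemann_surface X"
proof -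
  have hs: "points X homeomorphic_space points Y"
    using F by (rule homeomorphic_map_imp_homeomorphic_space)
  have "Hausdorff_space (points X)" "connected_space (points X)"
    using riemann_surfaceD(1,2)[OF Y] homeomorphic_Hausdorff_space[OF hs] homeomorphic_connected_space[OF hs] by auto
  moreover have "topspace (points X) \<noteq> {}" using riemann_surfaceD(3)[OF Y] F_image by (metis image_is_empty)
  moreover have "(\<Union>(U, \<phi>)\<in>atlas X. U) = topspace (points X)"
  proof (intro subset_antisym subsetI)
    fix p assume "p \<in> (\<Union>(U, \<phi>)\<in>atlas X. U)"
    then show "p \<in> topspace (points X)" using chart_subset by auto
  next
    fix p assume "p \<in> topspace (points X)"
    then show "p \<in> (\<Union>(U, \<phi>)\<in>atlas X. U)" using cov by fast
  qed
  moreover have "\<forall>c\<in>atlas X. is_chart (points X) c" using ch by auto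
  moreover have "\<forall>(U, \<phi>)\<in>atlas X. \<forall>(W, \<psi>)\<in>atlas X. (\<psi> \<circ> inv_into U \<phi>) holomorphic_on \<phi> ` (U \<inter> W)"
    using transition_holomorphic by blast
  ultimately show ?thesis
    unfolding riemann_surface_def by blast
qed

lemma biholomorphic: "biholomorphic X Y"
proof -
  have "holomorphic_map X Y F"
    unfolding holomorphic_map_def using continuous_F chart_F_holomorphic by blast
  moreover have "holomorphic_map Y X G"
  proof -
    have "(\<phi> \<circ> G \<circ> inv_into W \<psi>) holomorphic_on \<psi> ` {q\<in>W. G q \<in> U}"
      if U: "(U, \<phi>) \<in> atlas X" and W: "(W, \<psi>) \<in> atlas Y" for U \<phi> W \<psi>
    proof -
      have "{q\<in>W. G q \<in> U} \<subseteq> W \<inter> F ` U"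
        using is_chartD(2)[OF riemann_surfaceD(4)[OF Y W]] FG by force
      then show ?thesis
        using holomorphic_on_subset[OF chart_G_holomorphic[OF U W]] by (meson image_mono)
    qed
    then show ?thesis unfolding holomorphic_map_def using continuous_G by blast
  qed
  ultimately show ?thesis
    unfolding biholomorphic_def using riemann_surface Y GF FG by blast
qed

end

lemma biholomorphic_sym: "biholomorphic X Y \<Longrightarrow> biholomorphic Y X"
  unfolding biholomorphic_def by blast

section \<open>The squaring map, double covers and branches of the square root\<close>

lemma open_image_square:
  assumes "open (B :: complex set)"
  shows "open ((\<lambda>z. z\<^sup>2) ` B)"
proof (rule open_mapping_thm[of _ UNIV])
  show "\<not> (\<lambda>z::complex. z\<^sup>2) constant_on UNIV"
    unfolding constant_on_def by (metis UNIV_I one_power2 zero_neq_one zero_power2)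
qed (use assms in \<open>auto intro!: holomorphic_intros\<close>)

text \<open>Away from 0 squaring has local holomorphic inverses. Since squaring is open,
  \<open>H\<close> is continuous at 0 as well, so the singularity there is removable. This is what
  handles the branch points of the quotient map.\<close>

lemma holomorphic_on_square_image:
  assumes N: "open N" and hol: "(\<lambda>z. H (z\<^sup>2)) holomorphic_on N"
  shows "H holomorphic_on (\<lambda>z. z\<^sup>2) ` N"
proof (rule no_isolated_singularity[OF _ _ open_image_square[OF N], of _ "{0}"])
  show "continuous_on ((\<lambda>z. z\<^sup>2) ` N) H"
    unfolding continuous_on_open_vimage[OF open_image_square[OF N]]
  proof (intro allI impI)
    fix B :: "complex set" assume "open B"
    then have "open (N \<inter> (\<lambda>z. H (z\<^sup>2)) -` B)"
      by (rule continuous_open_preimage[OF holomorphic_on_imp_continuous_on[OF hol] N])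
    moreover have "H -` B \<inter> (\<lambda>z. z\<^sup>2) ` N = (\<lambda>z. z\<^sup>2) ` (N \<inter> (\<lambda>z. H (z\<^sup>2)) -` B)" by auto
    ultimately show "open (H -` B \<inter> (\<lambda>z. z\<^sup>2) ` N)" by (simp add: open_image_square)
  qed
  show "H holomorphic_on (\<lambda>z. z\<^sup>2) ` N - {0}"
    unfolding holomorphic_on_def
  proof
    fix w assume "w \<in> (\<lambda>z. z\<^sup>2) ` N - {0}"
    then obtain t where t: "t \<in> N" "t \<noteq> 0" "w = t\<^sup>2" by auto
    have sq: "(\<lambda>z::complex. z\<^sup>2) holomorphic_on A" for A by (intro holomorphic_intros)
    have "((\<lambda>z::complex. z\<^sup>2) has_field_derivative 2 * t) (at t)"
      by (auto intro!: derivative_eq_intros)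
    then have "deriv (\<lambda>z::complex. z\<^sup>2) t \<noteq> 0" using t by (simp add: DERIV_imp_deriv)
    then obtain r where r: "r > 0" "ball t r \<subseteq> N" "inj_on (\<lambda>z. z\<^sup>2) (ball t r)"
      using has_complex_derivative_locally_injective[OF sq t(1) N] by metis
    obtain g where g: "g holomorphic_on (\<lambda>z. z\<^sup>2) ` ball t r" "\<And>z. z \<in> ball t r \<Longrightarrow> g (z\<^sup>2) = z"
      using holomorphic_has_inverse[OF sq open_ball r(3)] by metis
    have "((\<lambda>z. H (z\<^sup>2)) \<circ> g) holomorphic_on (\<lambda>z. z\<^sup>2) ` ball t r"
      using g r(2) by (intro holomorphic_on_compose_gen[OF g(1) hol]) auto
    then have "H holomorphic_on (\<lambda>z. z\<^sup>2) ` ball t r"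
      by (rule holomorphic_transform) (use g in auto)
    moreover have "w \<in> (\<lambda>z. z\<^sup>2) ` ball t r" using t r by auto
    ultimately show "H field_differentiable at w within ((\<lambda>z. z\<^sup>2) ` N - {0})"
      using open_image_square[OF open_ball]
      by (metis field_differentiable_at_within holomorphic_on_imp_differentiable_at)
  qed
qed simp

text \<open>The projection to \<open>x\<close> is open.  If the curve split into two open parts, then, \<open>D\<close> being connected,
  \<open>(x, y)\<close> and \<open>(x, - y)\<close> would lie in different parts for every \<open>x\<close> or in the same part for every \<open>x\<close>.  The
  first is impossible at the branch point \<open>a\<close>, and the second would split \<open>D\<close>.\<close>

lemma connected_square_root_curve:
  fixes P :: "complex \<Rightarrow> complex"
  assumes D: "open D" "connected D" and P: "continuous_on D P" and a: "a \<in> D" "P a = 0"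
  shows "connected {(x, y). x \<in> D \<and> y\<^sup>2 = P x}"
proof -
  let ?C = "{(x, y). x \<in> D \<and> y\<^sup>2 = P x}"
  have op: "open (fst ` (?C \<inter> T))" if T: "open T" for T
    unfolding open_subopen[of "fst ` (?C \<inter> T)"]
  proof
    fix x assume "x \<in> fst ` (?C \<inter> T)"
    then obtain y where y: "x \<in> D" "y\<^sup>2 = P x" "(x, y) \<in> T" by auto
    then obtain A B where AB: "open A" "open B" "x \<in> A" "y \<in> B" "A \<times> B \<subseteq> T"
      using open_prod_elim[OF T y(3)] by (metis mem_Sigma_iff)
    \<comment> \<open>Openness of squaring enters here: for \<open>x'\<close> near \<open>x\<close>,
      the value \<open>P x'\<close> still has a square root in \<open>B\<close>.\<close>
    let ?A = "A \<inter> (D \<inter> P -` ((\<lambda>z. z\<^sup>2) ` B))"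
    have "open ?A"
      using AB D P by (intro open_Int continuous_open_preimage open_image_square)
    moreover have "x \<in> ?A" using y AB by (auto intro!: image_eqI[of _ _ y])
    moreover have "?A \<subseteq> fst ` (?C \<inter> T)"
    proof
      fix x' assume "x' \<in> ?A"
      then obtain y' where "x' \<in> A" "x' \<in> D" "y' \<in> B" "y'\<^sup>2 = P x'" by auto
      then have "(x', y') \<in> ?C \<inter> T" using AB(5) by auto
      then show "x' \<in> fst ` (?C \<inter> T)" by force
    qed
    ultimately show "\<exists>A. open A \<and> x \<in> A \<and> A \<subseteq> fst ` (?C \<inter> T)" by blast
  qed
  define \<tau> where "\<tau> = (\<lambda>p::complex \<times> complex. (fst p, - snd p))"
  have cont\<tau>: "open (\<tau> -` T)" if "open T" for T
    unfolding \<tau>_def using that by (intro open_vimage continuous_intros)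
  show ?thesis
    unfolding connected_openin
  proof (rule notI, elim exE conjE)
    fix V1 V2
    assume V: "openin (top_of_set ?C) V1" "openin (top_of_set ?C) V2" "?C \<subseteq> V1 \<union> V2"
      "V1 \<inter> V2 = {}" "V1 \<noteq> {}" "V2 \<noteq> {}"
    obtain T1 T2 where T: "open T1" "open T2" "V1 = ?C \<inter> T1" "V2 = ?C \<inter> T2"
      using V(1,2) by (auto simp: openin_open)
    \<comment> \<open>\<open>Q S T\<close> consists of those \<open>x\<close> over which one of the
      two points lies in \<open>S\<close> and the opposite one in \<open>T\<close>.\<close>
    define Q where "Q S T = fst ` (?C \<inter> (S \<inter> \<tau> -` T))" for S T
    have Qop: "open (Q S T)" if "open S" "open T" for S T
      unfolding Q_def using that cont\<tau> by (intro op open_Int)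
    have Q: "x \<in> Q S T \<longleftrightarrow> (\<exists>y. x \<in> D \<and> y\<^sup>2 = P x \<and> (x, y) \<in> S \<and> (x, - y) \<in> T)" for x S T
      by (force simp: Q_def \<tau>_def)
    have neg: "(x, y) \<in> T2 \<longleftrightarrow> (x, y) \<notin> T1" if "x \<in> D" "y\<^sup>2 = P x" for x y
      using that V(3,4) T by auto
    have Qy: "x \<in> Q S T \<longleftrightarrow> (x, y) \<in> S \<and> (x, - y) \<in> T \<or> (x, - y) \<in> S \<and> (x, y) \<in> T"
      if xy: "x \<in> D" "y\<^sup>2 = P x" for x y S T
    proof
      assume "x \<in> Q S T"
      then obtain y' where y': "y'\<^sup>2 = P x" "(x, y') \<in> S" "(x, - y') \<in> T" using Q by auto
      then have "y' = y \<or> y' = - y" using xy by (metis power2_eq_iff)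
      then show "(x, y) \<in> S \<and> (x, - y) \<in> T \<or> (x, - y) \<in> S \<and> (x, y) \<in> T" using y' by auto
    next
      assume "(x, y) \<in> S \<and> (x, - y) \<in> T \<or> (x, - y) \<in> S \<and> (x, y) \<in> T"
      then show "x \<in> Q S T"
      proof
        assume "(x, y) \<in> S \<and> (x, - y) \<in> T"
        then show ?thesis using xy Q by blast
      next
        assume "(x, - y) \<in> S \<and> (x, y) \<in> T"
        then show ?thesis using xy unfolding Q by (intro exI[of _ "- y"]) auto
      qed
    qed
    \<comment> \<open>Over each \<open>x\<close> exactly one of three things happens: both points in
      \<open>T1\<close>, both in \<open>T2\<close>, or one in each.\<close>
    have tri: "(x \<in> Q T1 T2 \<longleftrightarrow> x \<notin> Q T1 T1 \<and> x \<notin> Q T2 T2) \<and> \<not> (x \<in> Q T1 T1 \<and> x \<in> Q T2 T2)"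
      if x: "x \<in> D" for x
    proof -
      have y: "(csqrt (P x))\<^sup>2 = P x" "(- csqrt (P x))\<^sup>2 = P x" by auto
      show ?thesis
        unfolding Qy[OF x y(1)] using neg[OF x y(1)] neg[OF x y(2)] by blast
    qed
    have "Q T1 T2 \<inter> D = {} \<or> (Q T1 T1 \<union> Q T2 T2) \<inter> D = {}"
      by (rule connectedD[OF D(2)]) (use Qop T tri in auto)
    \<comment> \<open>Over the branch point the two points coincide, so they cannot lie in different
      parts.\<close>
    moreover have "a \<in> Q T1 T1 \<union> Q T2 T2"
      using neg[of a 0] Qy[of a 0] a by auto
    ultimately have disj: "Q T1 T2 \<inter> D = {}" using a by auto
    have "Q T1 T1 \<inter> D = {} \<or> Q T2 T2 \<inter> D = {}"
      by (rule connectedD[OF D(2)]) (use Qop T tri disj in auto)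
    moreover have "x \<in> Q T T" if xy: "x \<in> D" "y\<^sup>2 = P x" "(x, y) \<in> T" "T = T1 \<or> T = T2" for x y T
    proof -
      have 1: "(- y)\<^sup>2 = P x" using xy by simp
      have "x \<notin> Q T1 T2" using disj xy by auto
      then show ?thesis
        using xy(3,4) neg[OF xy(1,2)] neg[OF xy(1) 1] unfolding Qy[OF xy(1,2)] by blast
    qed
    note in_Q = this
    obtain x1 y1 where "(x1, y1) \<in> V1" using V(5) by auto
    then have "x1 \<in> Q T1 T1 \<inter> D" using in_Q[of x1 y1 T1] T(3) by auto
    moreover obtain x2 y2 where "(x2, y2) \<in> V2" using V(6) by auto
    then have "x2 \<in> Q T2 T2 \<inter> D" using in_Q[of x2 y2 T2] T(4) by auto
    ultimately show False by blast
  qed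
qed

lemma is_chart_pullback:
  assumes F: "homeomorphic_map X Y F" and c: "is_chart Y (W, \<psi>)"
  shows "is_chart X ({p\<in>topspace X. F p \<in> W}, \<psi> \<circ> F)"
proof -
  let ?U = "{p\<in>topspace X. F p \<in> W}"
  note ch = is_chartD[OF c]
  have Fs: "F ` topspace X = topspace Y" using F by (rule homeomorphic_imp_surjective_map)
  have "F ` ?U = W" using Fs ch(2) by auto
  then have im: "(\<psi> \<circ> F) ` ?U = \<psi> ` W" by (metis image_comp)
  have "homeomorphic_map (subtopology X ?U) (subtopology Y W) F"
    by (rule homeomorphic_map_subtopologies_alt[OF F]) auto
  moreover have "homeomorphic_map (subtopology Y W) (top_of_set (\<psi> ` W)) \<psi>"
    using c by (simp add: is_chart_def)
  ultimately have "homeomorphic_map (subtopology X ?U) (top_of_set (\<psi> ` W)) (\<psi> \<circ> F)"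
    by (rule homeomorphic_map_compose)
  moreover have "openin X ?U"
    using homeomorphic_imp_continuous_map[OF F] ch(1) by (rule openin_continuous_map_preimage)
  ultimately show ?thesis
    unfolding is_chart_def prod.case im using ch(4) by blast
qed

text \<open>The branch of the square root that takes values near \<open>r\<close> at arguments near \<open>r\<^sup>2\<close>; its values are those
  square roots \<open>y\<close> for which \<open>y / r\<close> has positive real part.\<close>

definition sqrt_near :: "complex \<Rightarrow> complex \<Rightarrow> complex" where
  "sqrt_near r w = r * csqrt (w / r\<^sup>2)"

definition sqrt_domain :: "complex \<Rightarrow> complex set" where
  "sqrt_domain r = {w. w / r\<^sup>2 \<notin> \<real>\<^sub>\<le>\<^sub>0}"

lemma sqrt_near_square: "r \<noteq> 0 \<Longrightarrow> (sqrt_near r w)\<^sup>2 = w"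
  unfolding sqrt_near_def power_mult_distrib power2_csqrt by simp

lemma open_sqrt_domain: "r \<noteq> 0 \<Longrightarrow> open (sqrt_domain r)"
proof -
  assume "r \<noteq> 0"
  then have "open ((\<lambda>w. w / r\<^sup>2) -` (- \<real>\<^sub>\<le>\<^sub>0))"
    by (intro open_vimage continuous_intros) auto
  then show ?thesis by (simp add: sqrt_domain_def vimage_def)
qed

lemma square_nonpos_Reals: "w\<^sup>2 \<in> \<real>\<^sub>\<le>\<^sub>0 \<Longrightarrow> Re w = 0"
proof -
  assume "w\<^sup>2 \<in> \<real>\<^sub>\<le>\<^sub>0"
  then have *: "Re w * Re w - Im w * Im w \<le> 0" "Re w * Im w + Im w * Re w = 0"
    unfolding complex_nonpos_Reals_iff power2_eq_square times_complex.simps by auto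
  show "Re w = 0"
  proof (rule ccontr)
    assume 0: "Re w \<noteq> 0"
    then have "Im w = 0" using *(2) by (simp add: mult.commute)
    then show False using *(1) 0 by (auto simp: mult_le_0_iff)
  qed
qed

lemma sqrt_near_unique:
  assumes "Re (y / r) > 0"
  shows "y\<^sup>2 \<in> sqrt_domain r" "sqrt_near r (y\<^sup>2) = y"
proof -
  have r: "r \<noteq> 0" using assms by auto
  have "y\<^sup>2 / r\<^sup>2 = (y / r)\<^sup>2" by (simp add: power_divide)
  then show "y\<^sup>2 \<in> sqrt_domain r" "sqrt_near r (y\<^sup>2) = y"
    using assms square_nonpos_Reals[of "y / r"] csqrt_square[of "y / r"] r
    by (auto simp: sqrt_domain_def sqrt_near_def)
qed

text \<open>The principal root has nonnegative real part, and real part 0 would make its square a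
  nonpositive real, which \<open>sqrt_domain\<close> excludes.\<close>

lemma Re_sqrt_near:
  assumes "w \<in> sqrt_domain r" "r \<noteq> 0"
  shows "Re (sqrt_near r w / r) > 0"
proof -
  have "Re (csqrt (w / r\<^sup>2)) \<noteq> 0"
  proof
    assume 0: "Re (csqrt (w / r\<^sup>2)) = 0"
    have "w / r\<^sup>2 = (csqrt (w / r\<^sup>2))\<^sup>2" by simp
    also have "\<dots> = - of_real ((Im (csqrt (w / r\<^sup>2)))\<^sup>2)"
      using 0 by (simp add: complex_eq_iff power2_eq_square)
    finally show False using assms(1)
      by (metis (no_types, lifting) mem_Collect_eq nonpos_Reals_of_real_iff neg_le_0_iff_le of_real_minus sqrt_domain_def zero_le_power2)
  qed
  then show ?thesis using Re_csqrt[of "w / r\<^sup>2"] assms by (simp add: sqrt_near_def)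
qed

lemma holomorphic_on_sqrt_near [holomorphic_intros]:
  "f holomorphic_on A \<Longrightarrow> (\<And>z. z \<in> A \<Longrightarrow> f z \<in> sqrt_domain r) \<Longrightarrow>
     (\<lambda>z. sqrt_near r (f z)) holomorphic_on A"
  unfolding sqrt_near_def sqrt_domain_def
  \<comment> \<open>For \<open>r = 0\<close> the factor \<open>r\<close> makes the function zero;
    otherwise the argument of \<open>csqrt\<close> avoids the cut.\<close>
  by (cases "r = 0") (auto intro!: holomorphic_intros)

section \<open>Quadratic maps of projective spaces\<close>

lemma cone_homogeneous:
  assumes "\<And>c x. c \<noteq> 0 \<Longrightarrow> Q x \<Longrightarrow> Q (c *s x)"
  shows "affine_cone {proj_point x | x. x \<noteq> 0 \<and> Q x} = {x. x \<noteq> 0 \<and> Q x}"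
proof (intro subset_antisym subsetI)
  fix x assume "x \<in> {x. x \<noteq> 0 \<and> Q x}"
  then show "x \<in> affine_cone {proj_point x | x. x \<noteq> 0 \<and> Q x}" by (auto simp: affine_cone_def)
qed (use assms in \<open>auto simp: affine_cone_def proj_point_eq_iff\<close>)

definition proj_map :: "(complex^'n \<Rightarrow> complex^'m) \<Rightarrow> (complex^'n) set \<Rightarrow> (complex^'m) set" where
  "proj_map G L = proj_point (G (SOME x. x \<in> L))"

text \<open>Degree two covers all polynomial maps that occur: the quotient map and the maps between
  the quartic and the cubic. Homogeneity is what makes \<open>proj_map\<close> independent of the
  chosen representative.\<close>

definition quadratic :: "(complex^'n \<Rightarrow> complex^'m) \<Rightarrow> bool" where
  "quadratic G \<longleftrightarrow> (\<forall>c x. G (c *s x) = c\<^sup>2 *s G x)"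

lemma proj_map_proj_point:
  assumes "quadratic G"
  shows "proj_map G (proj_point x) = proj_point (G x)"
proof -
  obtain c where c: "c \<noteq> 0" "(SOME y. y \<in> proj_point x) = c *s x"
    by (rule some_in_proj_pointE)
  have "proj_point (G (c *s x)) = proj_point (G x)"
    using assms c(1) unfolding quadratic_def by (metis power_eq_0_iff proj_point_scale)
  then show ?thesis using c by (simp add: proj_map_def)
qed

lemma continuous_proj_map:
  assumes "S \<subseteq> topspace projective_space" "T \<subseteq> topspace projective_space" "quadratic G"
    and "continuous_on UNIV G" "\<And>x. x \<in> affine_cone S \<Longrightarrow> G x \<noteq> 0 \<and> proj_point (G x) \<in> T"
  shows "continuous_map (subtopology projective_space S) (subtopology projective_space T) (proj_map G)"
proof -
  have "continuous_map (top_of_set (affine_cone S)) (subtopology projective_space T) (\<lambda>x. proj_point (G x))"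
    using assms by (intro continuous_map_into_projective continuous_on_subset[OF assms(4)]) auto
  then show ?thesis
    unfolding continuous_map_from_projective[OF assms(1)]
    by (simp add: o_def proj_map_proj_point[OF assms(3)])
qed

lemma proj_holomorphic_proj_map:
  fixes G :: "complex^'n \<Rightarrow> complex^'m"
  assumes \<gamma>: "proj_holomorphic D \<gamma>" and S: "\<And>z. z \<in> D \<Longrightarrow> \<gamma> z \<in> S" and G: "quadratic G"
    and nz: "\<And>x. x \<in> affine_cone S \<Longrightarrow> G x \<noteq> 0"
    and hol: "\<And>N (\<sigma> :: complex \<Rightarrow> complex^'n) i.
      (\<And>i. (\<lambda>w. \<sigma> w $ i) holomorphic_on N) \<Longrightarrow> (\<lambda>w. G (\<sigma> w) $ i) holomorphic_on N"
  shows "proj_holomorphic D (proj_map G \<circ> \<gamma>)"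
proof (rule proj_holomorphic_comp[OF \<gamma> _ hol])
  show "G x \<noteq> 0 \<and> (proj_map G \<circ> \<gamma>) z = proj_point (G x)"
    if "z \<in> D" "x \<noteq> 0" "\<gamma> z = proj_point x" for z x
    using that S[of z] nz[of x] by (simp add: proj_map_proj_point[OF G] affine_cone_def)
qed

section \<open>The cubic\<close>

text \<open>The coordinates \<open>1, 2, 3\<close> of \<^typ>\<open>complex^4\<close> play symmetric roles, so statements are made for an arbitrary
  ordering of them; coordinate \<open>4\<close> is the remaining one.\<close>

definition perms :: "(4 \<times> 4 \<times> 4) set" where
  "perms = {(1, 2, 3), (1, 3, 2), (2, 1, 3), (2, 3, 1), (3, 1, 2), (3, 2, 1)}"

lemma permsD:
  assumes "(i, j, k) \<in> perms"
  shows "i \<noteq> j" "i \<noteq> k" "j \<noteq> k" "i \<noteq> 4" "j \<noteq> 4" "k \<noteq> 4"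
    and "\<And>n. n = i \<or> n = j \<or> n = k \<or> n = 4"
    and "x $ 1 * x $ 2 * x $ 3 = x $ i * x $ j * (x $ k :: complex)"
    and "x $ 1 + x $ 2 + x $ 3 = x $ i + x $ j + (x $ k :: complex)"
    and "(x $ 1)\<^sup>2 + (x $ 2)\<^sup>2 + (x $ 3)\<^sup>2 = (x $ i)\<^sup>2 + (x $ j)\<^sup>2 + (x $ k)\<^sup>2"
  using assms exhaust_4 by (auto simp: perms_def)

definition vec_of :: "4 \<Rightarrow> 4 \<Rightarrow> 4 \<Rightarrow> complex \<Rightarrow> complex \<Rightarrow> complex \<Rightarrow> complex \<Rightarrow> complex^4" where
  "vec_of i j k p q r s = (\<chi> n. if n = i then p else if n = j then q else if n = k then r else s)"

lemma vec_of_nth: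
  assumes "(i, j, k) \<in> perms"
  shows "vec_of i j k p q r s $ i = p" "vec_of i j k p q r s $ j = q"
    "vec_of i j k p q r s $ k = r" "vec_of i j k p q r s $ 4 = s"
  using permsD(1-6)[OF assms] by (auto simp: vec_of_def)

lemma vec_eq_perms:
  assumes "(i, j, k) \<in> perms"
  shows "x = y \<longleftrightarrow> x $ i = y $ i \<and> x $ j = y $ j \<and> x $ k = y $ k \<and> x $ 4 = (y $ 4 :: 'a)"
proof
  assume *: "x $ i = y $ i \<and> x $ j = y $ j \<and> x $ k = y $ k \<and> x $ 4 = y $ 4"
  have "x $ n = y $ n" for n using permsD(7)[OF assms, of n] * by (elim disjE) simp_all
  then show "x = y" by (simp add: vec_eq_iff)
qed simp

lemma perms_123: "(1, 2, 3) \<in> perms" by (simp add: perms_def)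

definition cubic_eq :: "complex^4 \<Rightarrow> bool" where
  "cubic_eq x \<longleftrightarrow> x $ 1 * x $ 2 * x $ 3 = 25 * (x $ 4) ^ 3 \<and> x $ 1 + x $ 2 + x $ 3 + 5 * x $ 4 = 0"

definition cubic :: "(complex^4) set set" where
  "cubic = {proj_point x | x. x \<noteq> 0 \<and> cubic_eq x}"

lemma cubic_eq_scale: "cubic_eq x \<Longrightarrow> cubic_eq (c *s x)"
proof -
  assume *: "cubic_eq x"
  have "(c *s x) $ 1 * (c *s x) $ 2 * (c *s x) $ 3 = c ^ 3 * (x $ 1 * x $ 2 * x $ 3)"
    by (simp add: power3_eq_cube)
  also have "\<dots> = 25 * ((c *s x) $ 4) ^ 3"
    using * by (simp add: cubic_eq_def power_mult_distrib)
  finally have 1: "(c *s x) $ 1 * (c *s x) $ 2 * (c *s x) $ 3 = 25 * ((c *s x) $ 4) ^ 3" .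
  have "(c *s x) $ 1 + (c *s x) $ 2 + (c *s x) $ 3 + 5 * (c *s x) $ 4 = c * (x $ 1 + x $ 2 + x $ 3 + 5 * x $ 4)"
    by (simp add: algebra_simps)
  with 1 * show ?thesis unfolding cubic_eq_def by simp
qed

lemma cone_cubic: "affine_cone cubic = {x. x \<noteq> 0 \<and> cubic_eq x}"
  unfolding cubic_def by (intro cone_homogeneous cubic_eq_scale)

lemma cubic_subset: "cubic \<subseteq> topspace projective_space"
  by (auto simp: cubic_def topspace_projective_space)

lemma proj_point_in_cubic: "x \<noteq> 0 \<Longrightarrow> proj_point x \<in> cubic \<longleftrightarrow> cubic_eq x"
  using cone_cubic by (auto simp: affine_cone_def)

text \<open>With the \<open>j\<close>-th coordinate equal to 1, the other two satisfy \<open>A + C = - 1 - 5 d\<close> and \<open>A C = 25 d\<^sup>3\<close>, hence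
  \<open>(A - C)\<^sup>2 = (1 + 5 d)\<^sup>2 - 100 d\<^sup>3\<close>.\<close>

definition cubic_param :: "4 \<Rightarrow> 4 \<Rightarrow> 4 \<Rightarrow> complex \<Rightarrow> complex \<Rightarrow> complex^4" where
  "cubic_param i j k r d = (let s = sqrt_near r ((1 + 5 * d)\<^sup>2 - 100 * d ^ 3) in
     vec_of i j k ((- 1 - 5 * d + s) / 2) 1 ((- 1 - 5 * d - s) / 2) d)"

definition cubic_domain :: "complex \<Rightarrow> complex set" where
  "cubic_domain r = {d. (1 + 5 * d)\<^sup>2 - 100 * d ^ 3 \<in> sqrt_domain r}"

text \<open>Selects the sheet on which \<open>x $ i - x $ k\<close> is the branch
  \<open>sqrt_near r\<close> of its square; it plays the role of \<open>A\<close> in the chart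
  criterion.\<close>

definition cubic_part :: "4 \<Rightarrow> 4 \<Rightarrow> complex \<Rightarrow> (complex^4) set" where
  "cubic_part i k r = {x. Re ((x $ i - x $ k) / r) > 0}"

lemma open_cubic_domain: "r \<noteq> 0 \<Longrightarrow> open (cubic_domain r)"
proof -
  assume "r \<noteq> 0"
  then have "open ((\<lambda>d. (1 + 5 * d)\<^sup>2 - 100 * d ^ 3) -` sqrt_domain r)"
    by (intro open_vimage open_sqrt_domain continuous_intros)
  then show ?thesis by (simp add: cubic_domain_def vimage_def)
qed

lemma open_Re_divide_pos:
  fixes f :: "'a::topological_space \<Rightarrow> complex"
  assumes "continuous_on UNIV f"
  shows "open {x. Re (f x / r) > 0}"
  using assms by (cases "r = 0") (auto intro!: open_Collect_less continuous_intros)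

lemma open_cubic_part: "open (cubic_part i k r)"
  unfolding cubic_part_def by (intro open_Re_divide_pos continuous_intros)

lemma cubic_param_holomorphic: "(\<lambda>d. cubic_param i j k r d $ n) holomorphic_on cubic_domain r"
  unfolding cubic_param_def vec_of_def cubic_domain_def Let_def
  by (cases "n = i"; cases "n = j"; cases "n = k") (auto intro!: holomorphic_intros)

lemma half_sum_difference:
  fixes a s :: complex
  shows "(a + s) / 2 - (a - s) / 2 = s" "(a + s) / 2 + (a - s) / 2 = a"
    "(a + s) / 2 * ((a - s) / 2) = (a\<^sup>2 - s\<^sup>2) / 4"
  by (simp_all add: field_simps power2_eq_square)

lemma cubic_param:
  assumes ijk: "(i, j, k) \<in> perms" and r: "r \<noteq> 0" and d: "d \<in> cubic_domain r"
  shows "cubic_param i j k r d \<in> cubic_part i k r" "cubic_param i j k r d $ j = 1"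
    "cubic_param i j k r d $ 4 = d" "proj_point (cubic_param i j k r d) \<in> cubic"
proof -
  define s where "s = sqrt_near r ((1 + 5 * d)\<^sup>2 - 100 * d ^ 3)"
  have s2: "s\<^sup>2 = (1 + 5 * d)\<^sup>2 - 100 * d ^ 3" using r by (simp add: s_def sqrt_near_square)
  have \<sigma>: "cubic_param i j k r d = vec_of i j k ((- 1 - 5 * d + s) / 2) 1 ((- 1 - 5 * d - s) / 2) d"
    by (simp add: cubic_param_def s_def Let_def)
  note nth = vec_of_nth[OF ijk]
  have "Re (s / r) > 0" unfolding s_def
    by (rule Re_sqrt_near[OF _ r]) (use d in \<open>simp add: cubic_domain_def\<close>)
  then show "cubic_param i j k r d \<in> cubic_part i k r"
    unfolding cubic_part_def \<sigma> mem_Collect_eq nth half_sum_difference .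
  show 1: "cubic_param i j k r d $ j = 1" and "cubic_param i j k r d $ 4 = d"
    by (simp_all add: \<sigma> nth)
  have "(- 1 - 5 * d + s) / 2 * ((- 1 - 5 * d - s) / 2) = 25 * d ^ 3"
    unfolding half_sum_difference s2 by (simp add: power2_eq_square algebra_simps)
  moreover have "(- 1 - 5 * d + s) / 2 + 1 + (- 1 - 5 * d - s) / 2 = - 5 * d"
  proof -
    have "(- 1 - 5 * d + s) / 2 + 1 + (- 1 - 5 * d - s) / 2 =
        ((- 1 - 5 * d + s) / 2 + (- 1 - 5 * d - s) / 2) + 1" by (simp only: add_ac)
    then show ?thesis unfolding half_sum_difference by simp
  qed
  ultimately have "cubic_eq (cubic_param i j k r d)"
    unfolding cubic_eq_def permsD(8)[OF ijk] permsD(9)[OF ijk] \<sigma> nth by simp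
  moreover have "cubic_param i j k r d \<noteq> 0" using 1 by auto
  ultimately show "proj_point (cubic_param i j k r d) \<in> cubic" by (simp add: proj_point_in_cubic)
qed

lemma cubic_param_unique:
  assumes ijk: "(i, j, k) \<in> perms" and x: "x \<in> cubic_part i k r" "x $ j = 1" "proj_point x \<in> cubic"
  shows "x $ 4 \<in> cubic_domain r" "cubic_param i j k r (x $ 4) = x"
proof -
  have "x \<noteq> 0" using x by auto
  then have "cubic_eq x" using x by (simp add: proj_point_in_cubic)
  then have *: "x $ i * x $ k = 25 * (x $ 4) ^ 3" "x $ i + 1 + x $ k + 5 * x $ 4 = 0"
    unfolding cubic_eq_def permsD(8)[OF ijk] permsD(9)[OF ijk] using x(2) by auto
  have sum: "x $ i + x $ k = - 1 - 5 * x $ 4" using *(2) by (simp add: algebra_simps eq_neg_iff_add_eq_0)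
  have "(x $ i - x $ k)\<^sup>2 = (x $ i + x $ k)\<^sup>2 - 4 * (x $ i * x $ k)"
    by (simp add: power2_eq_square algebra_simps)
  also have "\<dots> = (1 + 5 * x $ 4)\<^sup>2 - 100 * (x $ 4) ^ 3"
    unfolding *(1) sum by (simp add: power2_eq_square algebra_simps)
  finally have sq: "(x $ i - x $ k)\<^sup>2 = (1 + 5 * x $ 4)\<^sup>2 - 100 * (x $ 4) ^ 3" .
  have u: "(1 + 5 * x $ 4)\<^sup>2 - 100 * (x $ 4) ^ 3 \<in> sqrt_domain r"
    "sqrt_near r ((1 + 5 * x $ 4)\<^sup>2 - 100 * (x $ 4) ^ 3) = x $ i - x $ k"
    using sqrt_near_unique[of "x $ i - x $ k" r] x(1) unfolding cubic_part_def sq by auto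
  then show "x $ 4 \<in> cubic_domain r" by (simp add: cubic_domain_def)
  have "- 1 - 5 * x $ 4 = x $ i + x $ k" using sum by simp
  then show "cubic_param i j k r (x $ 4) = x"
    unfolding cubic_param_def Let_def u(2) vec_eq_perms[OF ijk] vec_of_nth[OF ijk] using x(2) by simp
qed

text \<open>Nonsingularity of the cubic: with \<open>x $ j = 1\<close>, the fourth coordinate is a
  local parameter where the roots \<open>x $ i\<close> and \<open>x $ k\<close> differ. If no
  ordering worked, a nonzero coordinate among the first three would force the other two to be equal.
  For D = 0 this makes all coordinates vanish, and for nonzero D it makes A = B = C, which
  contradicts the equations.\<close>

lemma cubic_normal_form:
  assumes "L \<in> cubic"
  obtains i j k x where "(i, j, k) \<in> perms" "L = proj_point x" "x $ j = 1" "x $ i \<noteq> x $ k" "cubic_eq x"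
proof -
  obtain x where x: "x \<noteq> 0" "L = proj_point x" "cubic_eq x" using assms by (auto simp: cubic_def)
  have "\<exists>i j k. (i, j, k) \<in> perms \<and> x $ j \<noteq> 0 \<and> x $ i \<noteq> x $ k"
  proof (rule ccontr)
    assume "\<not> ?thesis"
    then have *: "x $ j = 0 \<or> x $ i = x $ k" if "(i, j, k) \<in> perms" for i j k using that by blast
    have **: "x $ 1 = 0 \<or> x $ 2 = x $ 3" "x $ 2 = 0 \<or> x $ 1 = x $ 3" "x $ 3 = 0 \<or> x $ 1 = x $ 2"
      by (rule *; simp add: perms_def)+
    have e: "x $ 1 * x $ 2 * x $ 3 = 25 * (x $ 4) ^ 3" "x $ 1 + x $ 2 + x $ 3 + 5 * x $ 4 = 0"
      using x(3) by (auto simp: cubic_eq_def)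
    show False
    proof (cases "x $ 4 = 0")
      case True
      then have "x $ 1 = 0 \<and> x $ 2 = 0 \<and> x $ 3 = 0"
        using ** e by (auto simp: mult_2[symmetric])
      then show False using x(1) True by (simp add: vec_eq_perms[OF perms_123])
    next
      case False
      then have "x $ 1 = x $ 2" "x $ 3 = x $ 2" using ** e(1) by auto
      \<comment> \<open>The linear equation now makes the cube of \<open>3 * x $ 2\<close> equal to
        -125 D^3, while the cubic equation makes it 27 times 25 D^3, that is 675 D^3.\<close>
      then have "3 * x $ 2 + 5 * x $ 4 = 0" using e(2) by simp
      then have a: "3 * x $ 2 = - 5 * x $ 4" by (simp add: add_eq_0_iff)
      have "x $ 2 ^ 3 = 25 * (x $ 4) ^ 3"
        using e(1) unfolding \<open>x $ 1 = x $ 2\<close> \<open>x $ 3 = x $ 2\<close> by (simp add: power3_eq_cube)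
      then have "(3 * x $ 2) ^ 3 = 27 * (25 * (x $ 4) ^ 3)" by (simp add: power_mult_distrib)
      then have "- 125 * (x $ 4) ^ 3 = 675 * (x $ 4) ^ 3"
        unfolding a by (simp add: power_mult_distrib)
      then show False using False by simp
    qed
  qed
  then obtain i j k where p: "(i, j, k) \<in> perms" "x $ j \<noteq> 0" "x $ i \<noteq> x $ k" by blast
  show thesis
  proof (rule that[OF p(1)])
    show "L = proj_point ((1 / x $ j) *s x)" using p(2) x(2) by simp
    show "cubic_eq ((1 / x $ j) *s x)" using x(3) by (rule cubic_eq_scale)
    show "((1 / x $ j) *s x) $ j = 1" "((1 / x $ j) *s x) $ i \<noteq> ((1 / x $ j) *s x) $ k"
      using p(2,3) by simp_all
  qed
qed

lemma cubic_chart: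
  assumes "(i, j, k) \<in> perms" "r \<noteq> 0"
  shows "((\<lambda>d. proj_point (cubic_param i j k r d)) ` cubic_domain r, lin_coord (axis j 1) (axis 4 1))
    \<in> atlas (embedded_curve cubic)"
proof (rule embedded_chartI(1)[OF cubic_subset open_cubic_domain[OF assms(2)] open_cubic_part
      cubic_param_holomorphic, where l = "axis j 1" and m = "axis 4 1", unfolded lin_form_axis])
  show "cubic_param i j k r d \<in> cubic_part i k r \<and> cubic_param i j k r d $ j = 1 \<and>
      cubic_param i j k r d $ 4 = d \<and> proj_point (cubic_param i j k r d) \<in> cubic"
    if "d \<in> cubic_domain r" for d
    using cubic_param[OF assms that] by blast
  show "x $ 4 \<in> cubic_domain r \<and> cubic_param i j k r (x $ 4) = x"
    if "x \<in> cubic_part i k r" "x $ j = 1" "proj_point x \<in> cubic" for x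
    using cubic_param_unique[OF assms(1) that] by blast
qed

lemma cubic_chart_ex:
  assumes "L \<in> cubic"
  shows "\<exists>U \<phi>. (U, \<phi>) \<in> atlas (embedded_curve cubic) \<and> L \<in> U"
proof -
  obtain i j k x where x: "(i, j, k) \<in> perms" "L = proj_point x" "x $ j = 1" "x $ i \<noteq> x $ k" "cubic_eq x"
    using cubic_normal_form[OF assms] .
  let ?r = "x $ i - x $ k"
  have "x \<in> cubic_part i k ?r" using x by (simp add: cubic_part_def)
  note u = cubic_param_unique[OF x(1) this x(3) assms[unfolded x(2)]]
  have "L \<in> (\<lambda>d. proj_point (cubic_param i j k ?r d)) ` cubic_domain ?r"
    using u(1) by (rule image_eqI[rotated]) (simp only: u(2) x(2))
  then show ?thesis using cubic_chart[OF x(1), of ?r] x(4) by auto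
qed

section \<open>The affine part of the cubic and its points at infinity\<close>

definition cubic_affine :: "(complex^4) set set" where
  "cubic_affine = {L\<in>cubic. \<forall>x\<in>L. x $ 4 \<noteq> 0}"

lemma cubic_affine_subset: "cubic_affine \<subseteq> topspace projective_space"
  using cubic_subset by (auto simp: cubic_affine_def)

lemma cubic_affine_chart_ex:
  assumes "L \<in> cubic_affine"
  shows "\<exists>U \<phi>. (U, \<phi>) \<in> atlas (embedded_curve cubic_affine) \<and> L \<in> U"
proof -
  have L: "L \<in> cubic" using assms by (simp add: cubic_affine_def)
  obtain i j k x where x: "(i, j, k) \<in> perms" "L = proj_point x" "x $ j = 1" "x $ i \<noteq> x $ k" "cubic_eq x"
    using cubic_normal_form[OF L] .
  then have x4: "x $ 4 \<noteq> 0" using assms by (simp add: cubic_affine_def)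
  let ?r = "x $ i - x $ k"
  have r: "?r \<noteq> 0" using x by simp
  have "x \<in> cubic_part i k ?r" using x by (simp add: cubic_part_def)
  note u = cubic_param_unique[OF x(1) this x(3) L[unfolded x(2)]]
  \<comment> \<open>The chart of the full cubic with the parameter value \<open>d = 0\<close>
    removed.\<close>
  have "((\<lambda>d. proj_point (cubic_param i j k ?r d)) ` (cubic_domain ?r - {0}), lin_coord (axis j 1) (axis 4 1))
    \<in> atlas (embedded_curve cubic_affine)"
  proof (rule embedded_chartI(1)[OF cubic_affine_subset, where A = "cubic_part i k ?r \<inter> {x. x $ 4 \<noteq> 0}"
        and l = "axis j 1" and m = "axis 4 1", unfolded lin_form_axis])
    show "open (cubic_domain ?r - {0})" using open_cubic_domain[OF r] by auto
    show "open (cubic_part i k ?r \<inter> {x. x $ 4 \<noteq> 0})"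
      by (intro open_Int open_cubic_part open_Collect_neq continuous_intros)
    show "(\<lambda>d. cubic_param i j k ?r d $ n) holomorphic_on cubic_domain ?r - {0}" for n
      using cubic_param_holomorphic by (rule holomorphic_on_subset) auto
    show "cubic_param i j k ?r d \<in> cubic_part i k ?r \<inter> {x. x $ 4 \<noteq> 0} \<and> cubic_param i j k ?r d $ j = 1 \<and>
      cubic_param i j k ?r d $ 4 = d \<and> proj_point (cubic_param i j k ?r d) \<in> cubic_affine"
      if d: "d \<in> cubic_domain ?r - {0}" for d
      using d cubic_param[OF x(1) r, of d] by (simp add: cubic_affine_def)
    show "y $ 4 \<in> cubic_domain ?r - {0} \<and> cubic_param i j k ?r (y $ 4) = y"
      if y: "y \<in> cubic_part i k ?r \<inter> {x. x $ 4 \<noteq> 0}" "y $ j = 1" "proj_point y \<in> cubic_affine" for y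
      using y cubic_param_unique[OF x(1), of y ?r] by (simp add: cubic_affine_def)
  qed
  moreover have "L \<in> (\<lambda>d. proj_point (cubic_param i j k ?r d)) ` (cubic_domain ?r - {0})"
    by (rule image_eqI[of _ _ "x $ 4"]) (use u x(2) x4 in simp_all)
  ultimately show ?thesis by blast
qed

text \<open>With D = 0 the equations become A B C = 0 and A + B + C = 0, which leaves one point for
  each vanishing coordinate.\<close>

lemma finite_cubic_infinity: "finite (cubic - cubic_affine)"
proof (rule finite_subset)
  show "cubic - cubic_affine \<subseteq> {proj_point (vec_of 1 2 3 0 1 (- 1) 0),
      proj_point (vec_of 1 2 3 1 0 (- 1) 0), proj_point (vec_of 1 2 3 1 (- 1) 0 0)}"
  proof
    fix L assume L: "L \<in> cubic - cubic_affine"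
    then obtain x where x: "x \<noteq> 0" "L = proj_point x" "cubic_eq x" by (auto simp: cubic_def)
    then have x4: "x $ 4 = 0" using L by (auto simp: cubic_affine_def)
    then have e: "x $ 1 = 0 \<or> x $ 2 = 0 \<or> x $ 3 = 0" "x $ 1 + x $ 2 + x $ 3 = 0"
      using x(3) by (auto simp: cubic_eq_def)
    note nth = vec_of_nth[OF perms_123]
    note eq = vec_eq_perms[OF perms_123]
    from e(1) show "L \<in> {proj_point (vec_of 1 2 3 0 1 (- 1) 0),
      proj_point (vec_of 1 2 3 1 0 (- 1) 0), proj_point (vec_of 1 2 3 1 (- 1) 0 0)}"
    proof (elim disjE)
      assume 0: "x $ 1 = 0"
      have "x $ 2 + x $ 3 = 0" using e(2) 0 by simp
      then have 1: "x $ 3 = - x $ 2" by (simp add: eq_neg_iff_add_eq_0 add.commute)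
      then have "x = x $ 2 *s vec_of 1 2 3 0 1 (- 1) 0" "x $ 2 \<noteq> 0"
        using 0 1 x(1) x4 unfolding eq vector_smult_component nth by auto
      then have "proj_point x = proj_point (vec_of 1 2 3 0 1 (- 1) 0)" unfolding proj_point_eq_iff by blast
      then show ?thesis unfolding x(2) by blast
    next
      assume 0: "x $ 2 = 0"
      have "x $ 1 + x $ 3 = 0" using e(2) 0 by simp
      then have 1: "x $ 3 = - x $ 1" by (simp add: eq_neg_iff_add_eq_0 add.commute)
      then have "x = x $ 1 *s vec_of 1 2 3 1 0 (- 1) 0" "x $ 1 \<noteq> 0"
        using 0 1 x(1) x4 unfolding eq vector_smult_component nth by auto
      then have "proj_point x = proj_point (vec_of 1 2 3 1 0 (- 1) 0)" unfolding proj_point_eq_iff by blast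
      then show ?thesis unfolding x(2) by blast
    next
      assume 0: "x $ 3 = 0"
      have "x $ 1 + x $ 2 = 0" using e(2) 0 by simp
      then have 1: "x $ 2 = - x $ 1" by (simp add: eq_neg_iff_add_eq_0 add.commute)
      then have "x = x $ 1 *s vec_of 1 2 3 1 (- 1) 0 0" "x $ 1 \<noteq> 0"
        using 0 1 x(1) x4 unfolding eq vector_smult_component nth by auto
      then have "proj_point x = proj_point (vec_of 1 2 3 1 (- 1) 0 0)" unfolding proj_point_eq_iff by blast
      then show ?thesis unfolding x(2) by blast
    qed
  qed
qed simp

section \<open>The quartic model\<close>

definition quartic :: "complex \<Rightarrow> complex" where
  "quartic x = x ^ 4 + 10 * x ^ 3 + 25 * x ^ 2 - 100 * x"

lemma quartic_eq: "quartic x = x * (x * (x + 5)\<^sup>2 - 100)"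
  by (simp add: quartic_def power4_eq_xxxx power3_eq_cube power2_eq_square algebra_simps)

text \<open>A branch point of the projection to x that survives the removal of x = 0; it serves for
  connectedness and for nonemptiness.\<close>

lemma quartic_root: obtains a where "a \<noteq> 0" "quartic a = 0"
proof -
  \<comment> \<open>The values at 2 and 3 are -2 and 92.\<close>
  have "\<exists>x\<ge>2. x \<le> 3 \<and> x * (x + 5)\<^sup>2 - 100 = (0::real)"
    by (rule IVT') (auto intro!: continuous_intros)
  then obtain x :: real where x: "x \<ge> 2" "x * (x + 5)\<^sup>2 - 100 = 0" by auto
  have "complex_of_real x * (complex_of_real x + 5)\<^sup>2 - 100 = complex_of_real (x * (x + 5)\<^sup>2 - 100)" by simp
  then have "quartic (of_real x) = 0" unfolding quartic_eq x(2) by simp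
  moreover have "complex_of_real x \<noteq> 0" using x by auto
  ultimately show thesis using that by blast
qed

lemma quartic_deriv: "(quartic has_field_derivative 4 * x ^ 3 + 30 * x\<^sup>2 + 50 * x - 100) (at x)"
  unfolding quartic_def [abs_def] by (auto intro!: derivative_eq_intros)

lemma quartic_holomorphic: "quartic holomorphic_on A"
  unfolding quartic_def [abs_def] by (intro holomorphic_intros)

text \<open>At a nonzero root the derivative equals x (x + 5) (3 x + 5), and neither -5 nor -5/3
  satisfies x (x + 5)^2 = 100.\<close>

lemma quartic_simple_root:
  assumes "x \<noteq> 0" "quartic x = 0"
  shows "deriv quartic x \<noteq> 0"
proof
  assume "deriv quartic x = 0"
  then have d: "4 * x ^ 3 + 30 * x\<^sup>2 + 50 * x - 100 = 0"
    using DERIV_imp_deriv[OF quartic_deriv] by simp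
  have q: "x * (x + 5)\<^sup>2 = 100" using assms by (simp add: quartic_eq)
  have "4 * x ^ 3 + 30 * x\<^sup>2 + 50 * x - 100 = (x * (x + 5)\<^sup>2 - 100) + x * ((x + 5) * (3 * x + 5))"
    by (simp add: power3_eq_cube power2_eq_square algebra_simps)
  then have "x + 5 = 0 \<or> 3 * x + 5 = 0" using d q assms by simp
  then show False
  proof
    assume "x + 5 = 0" then show False using q by simp
  next
    assume "3 * x + 5 = 0"
    then have x: "x = - 5 / 3" by (simp add: field_simps eq_neg_iff_add_eq_0)
    show False using arg_cong[OF q, of Re] unfolding x by (simp add: power2_eq_square)
  qed
qed

text \<open>The plane without 0 is still connected and still contains a branch point.\<close>

lemma connected_punctured_curve: "connected {(x, y). x \<in> - {0} \<and> y\<^sup>2 = quartic x}"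
proof -
  obtain a where "a \<noteq> 0" "quartic a = 0" by (rule quartic_root)
  moreover have "connected (- {0::complex})"
    by (rule connected_punctured_universe) simp
  ultimately show ?thesis
    by (intro connected_square_root_curve[of _ _ a] holomorphic_on_imp_continuous_on quartic_holomorphic) auto
qed

section \<open>Polynomial maps between the affine quartic and the affine cubic\<close>

lemma continuous_on_if_const:
  "(P \<Longrightarrow> continuous_on A f) \<Longrightarrow> (\<not> P \<Longrightarrow> continuous_on A g) \<Longrightarrow>
    continuous_on A (\<lambda>x. if P then f x else g x)"
  by (cases P) auto

lemma holomorphic_on_if_const:
  "(P \<Longrightarrow> f holomorphic_on A) \<Longrightarrow> (\<not> P \<Longrightarrow> g holomorphic_on A) \<Longrightarrow>
    (\<lambda>x. if P then f x else g x) holomorphic_on A"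
  by (cases P) auto

text \<open>Homogeneous forms of \<open>(x, y) \<mapsto> (x, (- 5 - x + y / x) / 2, (- 5 - x - y / x) / 2)\<close> and of its inverse
  \<open>(A, B, C) \<mapsto> (A, A (B - C))\<close>.\<close>

definition curve_to_cubic :: "complex^3 \<Rightarrow> complex^4" where
  "curve_to_cubic x = vec_of 1 2 3 (2 * (x $ 1)\<^sup>2) (- 5 * (x $ 1 * x $ 3) - (x $ 1)\<^sup>2 + x $ 2 * x $ 3)
     (- 5 * (x $ 1 * x $ 3) - (x $ 1)\<^sup>2 - x $ 2 * x $ 3) (2 * (x $ 1 * x $ 3))"

definition cubic_to_curve :: "complex^4 \<Rightarrow> complex^3" where
  "cubic_to_curve x = vector [x $ 1 * x $ 4, x $ 1 * (x $ 2 - x $ 3), (x $ 4)\<^sup>2]"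

lemma vec_eq_4:
  fixes x y :: "complex^4"
  shows "x = y \<longleftrightarrow> x $ 1 = y $ 1 \<and> x $ 2 = y $ 2 \<and> x $ 3 = y $ 3 \<and> x $ 4 = y $ 4"
  by (rule vec_eq_perms[OF perms_123])

lemma vec_eq_3:
  fixes x y :: "complex^3"
  shows "x = y \<longleftrightarrow> x $ 1 = y $ 1 \<and> x $ 2 = y $ 2 \<and> x $ 3 = y $ 3"
  by (simp add: vec_eq_iff forall_3)

lemmas vec_of_123 = vec_of_nth[OF perms_123]

lemma quadratic_curve_to_cubic: "quadratic curve_to_cubic"
  unfolding quadratic_def curve_to_cubic_def vec_eq_4
  by (simp add: vec_of_123 power2_eq_square algebra_simps)

lemma quadratic_cubic_to_curve: "quadratic cubic_to_curve"
  unfolding quadratic_def cubic_to_curve_def vec_eq_3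
  by (simp add: power2_eq_square algebra_simps)

lemma continuous_on_curve_to_cubic: "continuous_on A curve_to_cubic"
  unfolding curve_to_cubic_def [abs_def] vec_of_def
  by (intro continuous_on_vec_lambda continuous_on_if_const continuous_intros)

lemma cubic_to_curve_lambda:
  "cubic_to_curve x = (\<chi> i. if i = 1 then x $ 1 * x $ 4 else if i = 2 then x $ 1 * (x $ 2 - x $ 3) else (x $ 4)\<^sup>2)"
  by (simp add: cubic_to_curve_def vec_eq_3)

lemma continuous_on_cubic_to_curve: "continuous_on A cubic_to_curve"
  unfolding cubic_to_curve_lambda [abs_def]
  by (intro continuous_on_vec_lambda continuous_on_if_const continuous_intros)

lemma holomorphic_cubic_to_curve:
  assumes "\<And>i. (\<lambda>w. \<sigma> w $ i) holomorphic_on N"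
  shows "(\<lambda>w. cubic_to_curve (\<sigma> w) $ i) holomorphic_on N"
  unfolding cubic_to_curve_lambda vec_lambda_beta
  by (intro holomorphic_on_if_const holomorphic_intros assms)

text \<open>The omitted point is the only one with x = 0; its counterpart on the cubic is the point
  [0 : 1 : -1 : 0] at infinity.\<close>

definition curve :: "(complex^3) set set" where
  "curve = (\<lambda>(x, y). proj_point (vector [x, y, 1])) ` ({(x, y). y\<^sup>2 = quartic x} - {(0, 0)})"

lemma vector_3_nonzero: "vector [x, y, 1 :: complex] \<noteq> (0 :: complex^3)"
  by (simp add: vec_eq_3)

lemma curve_subset: "curve \<subseteq> topspace projective_space"
  using vector_3_nonzero by (auto simp: curve_def topspace_projective_space)

lemma cone_curve: "affine_cone curve = {x. x $ 1 \<noteq> 0 \<and> x $ 3 \<noteq> 0 \<and> (x $ 2 / x $ 3)\<^sup>2 = quartic (x $ 1 / x $ 3)}"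
proof (intro Set.set_eqI iffI)
  fix x assume "x \<in> affine_cone curve"
  then obtain a b where ab: "b\<^sup>2 = quartic a" "(a, b) \<noteq> (0, 0)" "proj_point x = proj_point (vector [a, b, 1])"
    by (auto simp: affine_cone_def curve_def)
  then obtain c where c: "c \<noteq> 0" "x = c *s vector [a, b, 1]" by (auto simp: proj_point_eq_iff)
  have "a \<noteq> 0" using ab by (auto simp: quartic_def)
  then show "x \<in> {x. x $ 1 \<noteq> 0 \<and> x $ 3 \<noteq> 0 \<and> (x $ 2 / x $ 3)\<^sup>2 = quartic (x $ 1 / x $ 3)}"
    using c ab by simp
next
  fix x :: "complex^3"
  assume x: "x \<in> {x. x $ 1 \<noteq> 0 \<and> x $ 3 \<noteq> 0 \<and> (x $ 2 / x $ 3)\<^sup>2 = quartic (x $ 1 / x $ 3)}"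
  then have "x = x $ 3 *s vector [x $ 1 / x $ 3, x $ 2 / x $ 3, 1]" by (simp add: vec_eq_3)
  then have "proj_point x = proj_point (vector [x $ 1 / x $ 3, x $ 2 / x $ 3, 1])"
    unfolding proj_point_eq_iff using x by blast
  moreover have "proj_point (vector [x $ 1 / x $ 3, x $ 2 / x $ 3, 1]) \<in> curve"
    unfolding curve_def using x
    by (intro image_eqI[of _ _ "(x $ 1 / x $ 3, x $ 2 / x $ 3)"]) auto
  ultimately show "x \<in> affine_cone curve" using x by (auto simp: affine_cone_def)
qed

lemma proj_point_in_curve:
  assumes "x $ 3 = 1"
  shows "proj_point x \<in> curve \<longleftrightarrow> x $ 1 \<noteq> 0 \<and> (x $ 2)\<^sup>2 = quartic (x $ 1)"
proof -
  have "x \<noteq> 0" using assms by auto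
  then have "proj_point x \<in> curve \<longleftrightarrow> x \<in> affine_cone curve" by (simp add: affine_cone_def)
  then show ?thesis unfolding cone_curve using assms by simp
qed

lemma curveE:
  assumes "L \<in> curve"
  obtains x y where "L = proj_point (vector [x, y, 1])" "x \<noteq> 0" "y\<^sup>2 = quartic x"
proof -
  obtain x y where xy: "L = proj_point (vector [x, y, 1])" "y\<^sup>2 = quartic x" "(x, y) \<noteq> (0, 0)"
    using assms by (auto simp: curve_def)
  moreover have "x \<noteq> 0"
  proof
    assume "x = 0"
    then show False using xy(2,3) by (simp add: quartic_def)
  qed
  ultimately show thesis using that by blast
qed

lemma cubic_eq_affine:
  assumes "x $ 4 \<noteq> 0" "cubic_eq x"
  shows "x $ 1 \<noteq> 0" "x $ 2 \<noteq> 0" "x $ 3 \<noteq> 0"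
  using assms by (auto simp: cubic_eq_def)

lemma cone_cubic_affine: "affine_cone cubic_affine = {x. x $ 4 \<noteq> 0 \<and> cubic_eq x}"
proof -
  have "x \<in> affine_cone cubic_affine \<longleftrightarrow> x $ 4 \<noteq> 0 \<and> cubic_eq x" for x
  proof (cases "x = 0")
    case False
    then show ?thesis unfolding affine_cone_def cubic_affine_def
      using proj_point_in_cubic[OF False] by auto
  qed (simp add: affine_cone_def)
  then show ?thesis by blast
qed

text \<open>The second and third coordinates multiply to a difference of squares. In homogeneous
  form the quartic equation reads (b z)^2 = a (a (a + 5 z)^2 - 100 z^3), so the difference collapses
  to 100 a z^3.\<close>

lemma curve_to_cubic_in_cone:
  assumes "x \<in> affine_cone curve"
  shows "curve_to_cubic x \<in> affine_cone cubic_affine"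
proof -
  have x: "x $ 1 \<noteq> 0" "x $ 3 \<noteq> 0" "(x $ 2 / x $ 3)\<^sup>2 = quartic (x $ 1 / x $ 3)"
    using assms by (auto simp: cone_curve)
  define a b z where "a = x $ 1" and "b = x $ 2" and "z = x $ 3"
  have "b\<^sup>2 = z\<^sup>2 * quartic (a / z)" using x by (simp add: a_def b_def z_def field_simps)
  then have "b\<^sup>2 * z\<^sup>2 = z ^ 4 * quartic (a / z)" by (simp add: power2_eq_square power4_eq_xxxx)
  also have "\<dots> = a * (a * (a + 5 * z)\<^sup>2 - 100 * z ^ 3)"
    using x(2) unfolding quartic_eq z_def[symmetric]
    by (simp add: field_simps power2_eq_square power3_eq_cube power4_eq_xxxx)
  finally have bz: "(b * z)\<^sup>2 = a * (a * (a + 5 * z)\<^sup>2 - 100 * z ^ 3)" by (simp add: power_mult_distrib)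
  have "2 * a\<^sup>2 * (- 5 * (a * z) - a\<^sup>2 + b * z) * (- 5 * (a * z) - a\<^sup>2 - b * z) =
      2 * a\<^sup>2 * ((5 * a * z + a\<^sup>2)\<^sup>2 - (b * z)\<^sup>2)"
    by (simp add: power2_eq_square algebra_simps)
  also have "\<dots> = 25 * (2 * (a * z)) ^ 3"
    unfolding bz by (simp add: power2_eq_square power3_eq_cube algebra_simps)
  finally have "cubic_eq (curve_to_cubic x)"
    unfolding cubic_eq_def curve_to_cubic_def vec_of_123 a_def b_def z_def
    by (simp add: algebra_simps)
  moreover have "curve_to_cubic x $ 4 \<noteq> 0" using x by (simp add: curve_to_cubic_def vec_of_123)
  ultimately show ?thesis by (simp add: cone_cubic_affine)
qed

text \<open>The quartic is a discriminant: (B - C)^2 = (B + C)^2 - 4 B C, where the linear equation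
  gives B + C and the cubic one gives A B C.\<close>

lemma cubic_to_curve_in_cone:
  assumes "x \<in> affine_cone cubic_affine"
  shows "cubic_to_curve x \<in> affine_cone curve"
proof -
  have x: "x $ 4 \<noteq> 0" "cubic_eq x" using assms by (auto simp: cone_cubic_affine)
  define a b c d where "a = x $ 1" and "b = x $ 2" and "c = x $ 3" and "d = x $ 4"
  have e: "a * b * c = 25 * d ^ 3" "a + b + c + 5 * d = 0" "a \<noteq> 0" "d \<noteq> 0"
    using x cubic_eq_affine[OF x] by (auto simp: cubic_eq_def a_def b_def c_def d_def)
  have "(b + c) + (a + 5 * d) = 0" using e(2) by (simp add: add_ac)
  then have bc: "b + c = - (a + 5 * d)" by (simp only: eq_neg_iff_add_eq_0)
  have "a\<^sup>2 * (b - c)\<^sup>2 = a * (a * (b + c)\<^sup>2 - 4 * (a * b * c))"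
    by (simp add: power2_eq_square algebra_simps)
  also have "\<dots> = a * (a * (a + 5 * d)\<^sup>2 - 100 * d ^ 3)" unfolding e(1) bc power2_minus by simp
  finally have 1: "(a * (b - c))\<^sup>2 = a * (a * (a + 5 * d)\<^sup>2 - 100 * d ^ 3)" by (simp add: power_mult_distrib)
  have "d ^ 4 * quartic (a / d) = a * (a * (a + 5 * d)\<^sup>2 - 100 * d ^ 3)"
    using e(4) unfolding quartic_eq
    by (simp add: field_simps power2_eq_square power3_eq_cube power4_eq_xxxx)
  then have 2: "(a * (b - c))\<^sup>2 = d ^ 4 * quartic (a / d)" using 1 by (simp only:)
  have "(a * (b - c) / d\<^sup>2)\<^sup>2 = (a * (b - c))\<^sup>2 / d ^ 4"
    unfolding power_divide by (simp flip: power_mult)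
  then have "(a * (b - c) / d\<^sup>2)\<^sup>2 = quartic (a / d)" unfolding 2 using e(4) by simp
  moreover have "a * d / d\<^sup>2 = a / d" using e(4) by (simp add: power2_eq_square)
  ultimately show ?thesis using e
    by (simp add: cone_curve cubic_to_curve_def a_def[symmetric] b_def[symmetric] c_def[symmetric] d_def[symmetric])
qed

text \<open>The composite has degree four and is the identity times a form of degree three, which
  has no zeros on the cone.\<close>

lemma curve_to_cubic_to_curve:
  assumes "x \<in> affine_cone curve"
  shows "proj_point (cubic_to_curve (curve_to_cubic x)) = proj_point x"
proof -
  have "cubic_to_curve (curve_to_cubic x) = (4 * (x $ 1)\<^sup>2 * x $ 3) *s x"
    unfolding cubic_to_curve_def curve_to_cubic_def vec_of_123 vec_eq_3
    by (simp add: power2_eq_square algebra_simps)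
  then show ?thesis using assms unfolding proj_point_eq_iff
    by (intro exI[of _ "4 * (x $ 1)\<^sup>2 * x $ 3"]) (auto simp: cone_curve)
qed

text \<open>In this direction the common factor \<open>2 * a * d\<^sup>2\<close> appears only after
  the linear equation has eliminated \<open>5 * d\<close>.\<close>

lemma cubic_to_curve_to_cubic:
  assumes "x \<in> affine_cone cubic_affine"
  shows "proj_point (curve_to_cubic (cubic_to_curve x)) = proj_point x"
proof -
  have x: "x $ 4 \<noteq> 0" "cubic_eq x" using assms by (auto simp: cone_cubic_affine)
  define a b c d where "a = x $ 1" and "b = x $ 2" and "c = x $ 3" and "d = x $ 4"
  have e: "a + b + c + 5 * d = 0" using x by (auto simp: cubic_eq_def a_def b_def c_def d_def)
  have "5 * d + (a + b + c) = 0" using e by (simp add: add_ac)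
  then have d: "5 * d = - (a + b + c)" by (simp only: eq_neg_iff_add_eq_0)
  have "- 5 * (a * d * d\<^sup>2) - (a * d)\<^sup>2 + a * (b - c) * d\<^sup>2 = a * d\<^sup>2 * (- (5 * d) - a + b - c)"
    by (simp add: power2_eq_square algebra_simps)
  also have "\<dots> = 2 * a * d\<^sup>2 * b" unfolding d by (simp add: algebra_simps)
  finally have 1: "- 5 * (a * d * d\<^sup>2) - (a * d)\<^sup>2 + a * (b - c) * d\<^sup>2 = 2 * a * d\<^sup>2 * b" .
  have "- 5 * (a * d * d\<^sup>2) - (a * d)\<^sup>2 - a * (b - c) * d\<^sup>2 = a * d\<^sup>2 * (- (5 * d) - a - b + c)"
    by (simp add: power2_eq_square algebra_simps)
  also have "\<dots> = 2 * a * d\<^sup>2 * c" unfolding d by (simp add: algebra_simps)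
  finally have 2: "- 5 * (a * d * d\<^sup>2) - (a * d)\<^sup>2 - a * (b - c) * d\<^sup>2 = 2 * a * d\<^sup>2 * c" .
  have "curve_to_cubic (cubic_to_curve x) = (2 * a * d\<^sup>2) *s x"
    using 1 2 unfolding cubic_to_curve_def curve_to_cubic_def vec_of_123 vec_eq_4 vector_3
      vector_smult_component a_def[symmetric] b_def[symmetric] c_def[symmetric] d_def[symmetric]
    by (simp add: power2_eq_square mult_ac)
  then show ?thesis using cubic_eq_affine[OF x] x unfolding proj_point_eq_iff
    by (intro exI[of _ "2 * a * d\<^sup>2"]) (auto simp: a_def d_def)
qed

section \<open>Connectedness and compactness of the cubic\<close>

lemma in_coneE:
  assumes "L \<in> S" "S \<subseteq> topspace projective_space"
  obtains x where "x \<in> affine_cone S" "L = proj_point x"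
proof -
  obtain x where "x \<noteq> 0" "L = proj_point x" using assms by (blast elim: proj_pointE)
  then show thesis using assms(1) that[of x] by (simp add: affine_cone_def)
qed

text \<open>A continuous image of the punctured quartic, whose connectedness is known from the
  double cover.\<close>

lemma connected_cubic_affine: "connected_space (subtopology projective_space cubic_affine)"
proof -
  let ?C = "{(x, y). x \<in> - {0} \<and> y\<^sup>2 = quartic x}"
  define v where "v = (\<lambda>p :: complex \<times> complex.
    (\<chi> n. if n = 1 then fst p else if n = 2 then 1 * snd p else 1) :: complex^3)"
  have v3: "v (x, y) = vector [x, y, 1]" for x y by (simp add: v_def vec_eq_3)
  have v: "v p \<in> affine_cone curve" if "p \<in> ?C" for p
    using that vector_3_nonzero by (cases p) (auto simp: v3 affine_cone_def proj_point_in_curve)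
  have "continuous_on ?C v" unfolding v_def
    by (intro continuous_on_vec_lambda continuous_on_if_const continuous_intros)
  then have "continuous_on ?C (\<lambda>p. curve_to_cubic (v p))"
    by (rule continuous_on_compose2[OF continuous_on_curve_to_cubic[of UNIV]]) simp
  then have "continuous_map (top_of_set ?C) (subtopology projective_space cubic_affine)
      (\<lambda>p. proj_point (curve_to_cubic (v p)))"
    using curve_to_cubic_in_cone[OF v] cubic_affine_subset
    by (intro continuous_map_into_projective) (auto simp: affine_cone_def)
  moreover have "connectedin (top_of_set ?C) ?C"
    using connected_punctured_curve by (simp add: connectedin_subtopology)
  ultimately have "connectedin (subtopology projective_space cubic_affine)
      ((\<lambda>p. proj_point (curve_to_cubic (v p))) ` ?C)"
    by (rule connectedin_continuous_map_image)
  moreover have "(\<lambda>p. proj_point (curve_to_cubic (v p))) ` ?C = cubic_affine"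
  proof (intro subset_antisym subsetI)
    fix L assume "L \<in> cubic_affine"
    then obtain x where x: "x \<in> affine_cone cubic_affine" "L = proj_point x"
      using cubic_affine_subset by (rule in_coneE)
    have c: "cubic_to_curve x \<in> affine_cone curve" using x(1) by (rule cubic_to_curve_in_cone)
    then have "proj_point (cubic_to_curve x) \<in> curve" by (simp add: affine_cone_def)
    then obtain a b where ab: "proj_point (cubic_to_curve x) = proj_point (vector [a, b, 1])" "a \<noteq> 0" "b\<^sup>2 = quartic a"
      by (rule curveE)
    have "L = proj_point (curve_to_cubic (cubic_to_curve x))" using cubic_to_curve_to_cubic[OF x(1)] x(2) by simp
    also have "\<dots> = proj_point (curve_to_cubic (v (a, b)))"
      using arg_cong[OF ab(1), of "proj_map curve_to_cubic"]
      by (simp add: proj_map_proj_point[OF quadratic_curve_to_cubic] v3)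
    finally show "L \<in> (\<lambda>p. proj_point (curve_to_cubic (v p))) ` ?C" using ab by auto
  next
    fix L assume "L \<in> (\<lambda>p. proj_point (curve_to_cubic (v p))) ` ?C"
    then show "L \<in> cubic_affine" using curve_to_cubic_in_cone[OF v] by (auto simp: affine_cone_def)
  qed
  ultimately show ?thesis
    using cubic_affine_subset by (simp add: connectedin_def subtopology_subtopology)
qed

lemma cubic_affine_nonempty: "cubic_affine \<noteq> {}"
proof -
  obtain a where "a \<noteq> 0" "quartic a = 0" by (rule quartic_root)
  then have "vector [a, 0, 1] \<in> affine_cone curve" using vector_3_nonzero by (simp add: affine_cone_def proj_point_in_curve)
  from curve_to_cubic_in_cone[OF this] show ?thesis by (auto simp: affine_cone_def)
qed

lemma riemann_surface_cubic_affine: "riemann_surface (embedded_curve cubic_affine)"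
  using cubic_affine_subset connected_cubic_affine cubic_affine_nonempty cubic_affine_chart_ex
  by (rule riemann_surface_embedded_curve)

text \<open>The affine part is dense: by a chart, a nonempty open set contains a copy of a nonempty
  open subset of the plane, so it is infinite and cannot consist of points at infinity. A set
  between a connected set and its closure is connected.\<close>

lemma connected_cubic: "connected_space (subtopology projective_space cubic)"
proof -
  let ?T = "subtopology projective_space cubic"
  have ts: "topspace ?T = cubic" using cubic_subset by auto
  have sub: "cubic_affine \<subseteq> cubic" by (auto simp: cubic_affine_def)
  have "connectedin ?T cubic_affine"
    using connected_cubic_affine sub cubic_affine_subset
    by (simp add: connectedin_def ts subtopology_subtopology Int_absorb1)
  moreover have "topspace ?T \<subseteq> ?T closure_of cubic_affine"
  proof
    fix L assume L: "L \<in> topspace ?T"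
    have "\<exists>M. M \<in> cubic_affine \<and> M \<in> V" if V: "L \<in> V" "openin ?T V" for V
    proof (rule ccontr)
      assume neg: "\<not> ?thesis"
      obtain U \<phi> where U: "(U, \<phi>) \<in> atlas (embedded_curve cubic)" "L \<in> U"
        using cubic_chart_ex L ts by blast
      note ch = is_chartD[OF embedded_chartD(1)[OF U(1)]]
      have "open (\<phi> ` (U \<inter> V))" using ch(1) V(2) by (intro ch(7)) auto
      moreover have "U \<inter> V \<subseteq> cubic - cubic_affine" using neg ch(2) ts by blast
      then have "finite (\<phi> ` (U \<inter> V))" using finite_cubic_infinity finite_subset by blast
      ultimately have "\<phi> ` (U \<inter> V) = {}" using finite_imp_not_open by blast
      then show False using U(2) V(1) by blast
    qed
    then show "L \<in> ?T closure_of cubic_affine" using L by (auto simp: in_closure_of)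
  qed
  moreover have "cubic_affine \<subseteq> topspace ?T" unfolding ts by (rule sub)
  ultimately have "connectedin ?T (topspace ?T)"
    by (blast intro: connectedin_intermediate_closure_of)
  then show ?thesis unfolding connectedin_topspace .
qed

lemma riemann_surface_cubic: "riemann_surface (embedded_curve cubic)"
proof (rule riemann_surface_embedded_curve[OF cubic_subset connected_cubic _ cubic_chart_ex])
  show "cubic \<noteq> {}" using cubic_affine_nonempty by (auto simp: cubic_affine_def)
qed

lemma compact_riemann_surface_cubic: "compact_riemann_surface (embedded_curve cubic)"
proof -
  have "closed {x. cubic_eq x}"
    unfolding cubic_eq_def by (intro closed_Collect_conj closed_Collect_eq continuous_intros)
  then have "compact_space (subtopology projective_space cubic)"
    by (rule compact_space_projective_closed[OF cubic_subset]) (auto simp: cone_cubic)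
  then show ?thesis using riemann_surface_cubic by (simp add: compact_riemann_surface_def)
qed

text \<open>The implicit function theorem by hand. Where y is nonzero, x is the parameter and y a
  branch of the root; where y = 0, the root of the quartic is simple, so y is the parameter and x is
  a local inverse of \<open>quartic\<close> at \<open>y\<^sup>2\<close>.\<close>

lemma curve_chart_ex:
  assumes "L \<in> curve"
  shows "\<exists>U \<phi>. (U, \<phi>) \<in> atlas (embedded_curve curve) \<and> L \<in> U"
proof -
  obtain a b where L: "L = proj_point (vector [a, b, 1])" "a \<noteq> 0" "b\<^sup>2 = quartic a"
    using assms by (rule curveE)
  have vec: "(\<lambda>z. vector [f z, g z, 1 :: complex] $ i) holomorphic_on D"
    if "f holomorphic_on D" "g holomorphic_on D" for f g D and i :: 3
    using that exhaust_3[of i] by auto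
  show ?thesis
  proof (cases "b = 0")
    case False
    let ?D = "- {0} \<inter> quartic -` sqrt_domain b" and ?\<sigma> = "\<lambda>z. vector [z, sqrt_near b (quartic z), 1] :: complex^3"
    let ?A = "{x :: complex^3. x $ 1 \<noteq> 0} \<inter> {x. Re (x $ 2 / b) > 0}"
    have "((\<lambda>z. proj_point (?\<sigma> z)) ` ?D, lin_coord (axis 3 1) (axis 1 1)) \<in> atlas (embedded_curve curve)"
    proof (rule embedded_chartI(1)[OF curve_subset, where A = ?A and l = "axis 3 1" and m = "axis 1 1",
          unfolded lin_form_axis])
      show "open ?D"
        by (intro continuous_open_preimage holomorphic_on_imp_continuous_on quartic_holomorphic
            open_sqrt_domain False) auto
      show "open ?A"
        by (intro open_Int open_Re_divide_pos open_Collect_neq continuous_intros)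
      show "(\<lambda>z. ?\<sigma> z $ i) holomorphic_on ?D" for i
        by (rule vec[where f = "\<lambda>z. z" and g = "\<lambda>z. sqrt_near b (quartic z)"])
          (auto intro!: holomorphic_intros quartic_holomorphic)
      show "?\<sigma> z \<in> ?A \<and> ?\<sigma> z $ 3 = 1 \<and> ?\<sigma> z $ 1 = z \<and> proj_point (?\<sigma> z) \<in> curve" if "z \<in> ?D" for z
        using that False Re_sqrt_near[of "quartic z" b] sqrt_near_square[of b "quartic z"]
        by (simp add: proj_point_in_curve)
      show "x $ 1 \<in> ?D \<and> ?\<sigma> (x $ 1) = x" if x: "x \<in> ?A" "x $ 3 = 1" "proj_point x \<in> curve" for x
      proof -
        have "(x $ 2)\<^sup>2 = quartic (x $ 1)" using x by (simp add: proj_point_in_curve)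
        then show ?thesis using sqrt_near_unique[of "x $ 2" b] x by (simp add: vec_eq_3)
      qed
    qed
    moreover have "L \<in> (\<lambda>z. proj_point (?\<sigma> z)) ` ?D"
      using sqrt_near_unique[of b b] False L by (intro image_eqI[of _ _ a]) auto
    ultimately show ?thesis by blast
  next
    case True
    then have qa: "quartic a = 0" using L(3) by simp
    obtain r where r: "r > 0" "ball a r \<subseteq> - {0}" "open (quartic ` ball a r)" "inj_on quartic (ball a r)"
      using has_complex_derivative_locally_invertible[OF quartic_holomorphic, of a "- {0}"]
        quartic_simple_root[OF L(2) qa] L(2) by auto
    obtain h where h: "h holomorphic_on quartic ` ball a r" "\<And>z. z \<in> ball a r \<Longrightarrow> h (quartic z) = z"
      using holomorphic_has_inverse[OF quartic_holomorphic open_ball r(4)] by metis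
    let ?D = "(\<lambda>y. y\<^sup>2) -` (quartic ` ball a r)" and ?\<sigma> = "\<lambda>y. vector [h (y\<^sup>2), y, 1] :: complex^3"
    let ?A = "(\<lambda>x :: complex^3. x $ 1) -` ball a r"
    have "((\<lambda>z. proj_point (?\<sigma> z)) ` ?D, lin_coord (axis 3 1) (axis 2 1)) \<in> atlas (embedded_curve curve)"
    proof (rule embedded_chartI(1)[OF curve_subset, where A = ?A and l = "axis 3 1" and m = "axis 2 1",
          unfolded lin_form_axis])
      show "open ?D" by (intro open_vimage r(3) continuous_intros)
      show "open ?A" by (intro open_vimage continuous_intros) auto
      have "(h \<circ> (\<lambda>y. y\<^sup>2)) holomorphic_on ?D"
        by (rule holomorphic_on_compose_gen[OF _ h(1)]) (auto intro!: holomorphic_intros)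
      then show "(\<lambda>y. ?\<sigma> y $ i) holomorphic_on ?D" for i
        unfolding o_def
        by (rule vec[where f = "\<lambda>y. h (y\<^sup>2)" and g = "\<lambda>y. y"]) (auto intro!: holomorphic_intros)
      show "?\<sigma> y \<in> ?A \<and> ?\<sigma> y $ 3 = 1 \<and> ?\<sigma> y $ 2 = y \<and> proj_point (?\<sigma> y) \<in> curve" if y: "y \<in> ?D" for y
      proof -
        obtain z where z: "z \<in> ball a r" "y\<^sup>2 = quartic z" using y by auto
        then have "h (y\<^sup>2) = z" using h(2) by simp
        moreover have "z \<noteq> 0" using z(1) r(2) by blast
        ultimately show ?thesis using z by (simp add: proj_point_in_curve)
      qed
      show "x $ 2 \<in> ?D \<and> ?\<sigma> (x $ 2) = x" if x: "x \<in> ?A" "x $ 3 = 1" "proj_point x \<in> curve" for x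
      proof -
        have "(x $ 2)\<^sup>2 = quartic (x $ 1)" using x by (simp add: proj_point_in_curve)
        then show ?thesis using x h(2)[of "x $ 1"] by (simp add: vec_eq_3)
      qed
    qed
    moreover have "L \<in> (\<lambda>y. proj_point (?\<sigma> y)) ` ?D"
    proof (rule image_eqI)
      have a: "a \<in> ball a r" using r(1) by simp
      have "h (b\<^sup>2) = a" unfolding L(3) by (rule h(2)[OF a])
      then show "L = proj_point (?\<sigma> b)" using L(1) by simp
      show "b \<in> ?D" using a L(3) by auto
    qed
    ultimately show ?thesis by blast
  qed
qed

text \<open>With the affine cubic as target, holomorphy has to be checked only for the map from the
  cubic back to the curve, which is polynomial on lifts. No shrinking is necessary, so the whole
  plane serves as \<open>N\<close>.\<close>

lemma curve_transfer:
  "surface_transfer (embedded_curve curve) (embedded_curve cubic_affine) (proj_map curve_to_cubic)"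
proof
  let ?f = "proj_map curve_to_cubic" and ?g = "proj_map cubic_to_curve"
  note f = proj_map_proj_point[OF quadratic_curve_to_cubic]
  note g = proj_map_proj_point[OF quadratic_cubic_to_curve]
  have ts: "topspace (subtopology projective_space curve) = curve"
    "topspace (subtopology projective_space cubic_affine) = cubic_affine"
    using curve_subset cubic_affine_subset by auto
  have cf: "continuous_map (subtopology projective_space curve) (subtopology projective_space cubic_affine) ?f"
    using curve_to_cubic_in_cone
    by (intro continuous_proj_map curve_subset cubic_affine_subset quadratic_curve_to_cubic
        continuous_on_curve_to_cubic) (auto simp: affine_cone_def)
  have cg: "continuous_map (subtopology projective_space cubic_affine) (subtopology projective_space curve) ?g"
    using cubic_to_curve_in_cone
    by (intro continuous_proj_map curve_subset cubic_affine_subset quadratic_cubic_to_curve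
        continuous_on_cubic_to_curve) (auto simp: affine_cone_def)
  have gf: "?g (?f L) = L" if L: "L \<in> curve" for L
  proof -
    obtain x where x: "x \<in> affine_cone curve" "L = proj_point x" using L curve_subset by (rule in_coneE)
    then show ?thesis using curve_to_cubic_to_curve x(2) by (simp add: f g)
  qed
  have fg: "?f (?g L) = L" if L: "L \<in> cubic_affine" for L
  proof -
    obtain x where x: "x \<in> affine_cone cubic_affine" "L = proj_point x" using L cubic_affine_subset by (rule in_coneE)
    then show ?thesis using cubic_to_curve_to_cubic x(2) by (simp add: f g)
  qed
  show "riemann_surface (embedded_curve cubic_affine)" by (rule riemann_surface_cubic_affine)
  have "homeomorphic_maps (subtopology projective_space curve) (subtopology projective_space cubic_affine) ?f ?g"
    using cf cg gf fg unfolding homeomorphic_maps_def ts by blast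
  then show hom: "homeomorphic_map (points (embedded_curve curve)) (points (embedded_curve cubic_affine)) ?f"
    by (simp add: homeomorphic_maps_imp_map)
  show "is_chart (points (embedded_curve curve)) (U, \<phi>)" if "(U, \<phi>) \<in> atlas (embedded_curve curve)" for U \<phi>
    using embedded_chartD(1)[OF that] by simp
  show "\<exists>U \<phi>. (U, \<phi>) \<in> atlas (embedded_curve curve) \<and> L \<in> U" if "L \<in> topspace (points (embedded_curve curve))" for L
    using curve_chart_ex that ts by simp
  fix U \<phi> L
  assume U: "(U, \<phi>) \<in> atlas (embedded_curve curve)" and L: "L \<in> U"
  note chU = is_chartD[OF embedded_chartD(1)[OF U]]
  have Us: "U \<subseteq> curve" using chU(2) ts by simp
  have "?f ` curve \<subseteq> cubic_affine" using continuous_map_image_subset_topspace[OF cf] unfolding ts .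
  then have "?f L \<in> cubic_affine" using L Us by blast
  then obtain W \<psi> where W: "(W, \<psi>) \<in> atlas (embedded_curve cubic_affine)" "?f L \<in> W"
    using cubic_affine_chart_ex by blast
  note chW = is_chartD[OF embedded_chartD(1)[OF W(1)]]
  have Ws: "W \<subseteq> cubic_affine" using chW(2) ts by simp
  let ?Q = "\<psi> ` (W \<inter> ?f ` U)"
  have "openin (subtopology projective_space cubic_affine) (?f ` U)"
    using homeomorphic_imp_open_map[OF hom] chU(1) by (simp add: open_map_def)
  then have "open ?Q" using chW(1) by (intro chW(7)) auto
  then have \<gamma>: "proj_holomorphic ?Q (inv_into W \<psi>)"
    by (intro proj_holomorphic_subset[OF proj_holomorphic_chart_inv[OF cubic_affine_subset W(1)]]) auto
  have inv: "inv_into W \<psi> z \<in> W \<inter> ?f ` U" if "z \<in> ?Q" for z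
    using that chW(3) by auto
  have "proj_holomorphic ?Q (?g \<circ> inv_into W \<psi>)"
  proof (rule proj_holomorphic_proj_map[OF \<gamma> _ quadratic_cubic_to_curve _ holomorphic_cubic_to_curve])
    show "inv_into W \<psi> z \<in> cubic_affine" if "z \<in> ?Q" for z using inv[OF that] Ws by blast
    show "cubic_to_curve x \<noteq> 0" if "x \<in> affine_cone cubic_affine" for x
      using cubic_to_curve_in_cone[OF that] by (simp add: affine_cone_def)
  qed
  moreover have "(?g \<circ> inv_into W \<psi>) z \<in> U" if "z \<in> ?Q" for z
    using inv[OF that] gf Us by auto
  ultimately have "(\<phi> \<circ> (?g \<circ> inv_into W \<psi>)) holomorphic_on ?Q"
    by (rule chart_comp_proj_holomorphic[OF curve_subset U])
  moreover have "(\<phi> \<circ> (?g \<circ> inv_into W \<psi>)) z = (\<phi> \<circ> inv_into (topspace (points (embedded_curve curve))) ?f \<circ> inv_into W \<psi>) z"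
    if z: "z \<in> ?Q" for z
  proof -
    obtain M where M: "M \<in> U" "inv_into W \<psi> z = ?f M" using inv[OF z] by auto
    have "inv_into curve ?f (?f M) = M"
      using homeomorphic_imp_injective_map[OF hom] M(1) Us ts by (intro inv_into_f_f) auto
    then show ?thesis using M gf[of M] Us unfolding comp_def points_embedded_curve ts by auto
  qed
  ultimately have "(\<phi> \<circ> inv_into (topspace (points (embedded_curve curve))) ?f \<circ> inv_into W \<psi>) holomorphic_on ?Q"
    by (rule holomorphic_transform)
  then show "\<exists>W \<psi> N. (W, \<psi>) \<in> atlas (embedded_curve cubic_affine) \<and> ?f L \<in> W \<and> open N \<and> \<psi> (?f L) \<in> N \<and>
      (\<phi> \<circ> inv_into (topspace (points (embedded_curve curve))) ?f \<circ> inv_into W \<psi>) holomorphic_on (N \<inter> \<psi> ` (W \<inter> ?f ` U))"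
    using W by (intro exI[of _ W] exI[of _ \<psi>] exI[of _ UNIV]) auto
qed

lemma smooth_projective_model_cubic:
  "smooth_projective_model cubic {(x, y). y\<^sup>2 = quartic x}"
  unfolding smooth_projective_model_def
proof (intro conjI exI)
  show "cubic \<subseteq> topspace projective_space" by (rule cubic_subset)
  show "compact_riemann_surface (embedded_curve cubic)" by (rule compact_riemann_surface_cubic)
  show "{(0, 0)} \<subseteq> {(x, y). y\<^sup>2 = quartic x}" by (simp add: quartic_def)
  show "finite {(0 :: complex, 0 :: complex)}" by simp
  show "cubic - cubic_affine \<subseteq> cubic" by blast
  show "finite (cubic - cubic_affine)" by (rule finite_cubic_infinity)
  have "cubic - (cubic - cubic_affine) = cubic_affine" by (auto simp: cubic_affine_def)
  moreover have "affine_plane_curve ({(x, y). y\<^sup>2 = quartic x} - {(0, 0)}) = embedded_curve curve"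
    by (simp add: affine_plane_curve_def curve_def)
  ultimately show "biholomorphic (embedded_curve (cubic - (cubic - cubic_affine)))
      (affine_plane_curve ({(x, y). y\<^sup>2 = quartic x} - {(0, 0)}))"
    using biholomorphic_sym[OF surface_transfer.biholomorphic[OF curve_transfer]] by simp
qed

section \<open>Bring's curve\<close>

definition bring_eq :: "complex^4 \<Rightarrow> bool" where
  "bring_eq y \<longleftrightarrow> y $ 1 * y $ 2 * y $ 3 = - 5 * (y $ 4) ^ 3 \<and>
     (y $ 1)\<^sup>2 + (y $ 2)\<^sup>2 + (y $ 3)\<^sup>2 + 5 * (y $ 4)\<^sup>2 = 0"

definition bring :: "(complex^5) set set" where
  "bring = {proj_point x | x.
     x \<noteq> 0 \<and> (\<Sum>i\<in>UNIV. x $ i) = 0 \<and> (\<Sum>i\<in>UNIV. (x $ i)^2) = 0 \<and> (\<Sum>i\<in>UNIV. (x $ i)^3) = 0}"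

lemma bring_curve_eq: "bring_curve = embedded_curve bring"
  by (simp add: bring_curve_def bring_def)

lemma bring_subset: "bring \<subseteq> topspace projective_space"
  by (auto simp: bring_def topspace_projective_space)

lemma cone_bring: "affine_cone bring =
    {x. x \<noteq> 0 \<and> (\<Sum>i\<in>UNIV. x $ i) = 0 \<and> (\<Sum>i\<in>UNIV. (x $ i)^2) = 0 \<and> (\<Sum>i\<in>UNIV. (x $ i)^3) = 0}"
  unfolding bring_def
  by (intro cone_homogeneous) (simp add: power_mult_distrib flip: sum_distrib_left)

lemma closed_bring: "closed {x :: complex^5. (\<Sum>i\<in>UNIV. x $ i) = 0 \<and> (\<Sum>i\<in>UNIV. (x $ i)^2) = 0 \<and> (\<Sum>i\<in>UNIV. (x $ i)^3) = 0}"
  by (intro closed_Collect_conj closed_Collect_eq continuous_intros)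

lemma compact_space_bring: "compact_space (subtopology projective_space bring)"
  by (rule compact_space_projective_closed[OF bring_subset closed_bring]) (auto simp: cone_bring)

definition squares :: "complex^4 \<Rightarrow> complex^4" where
  "squares y = (\<chi> n. (y $ n)\<^sup>2)"

text \<open>The coordinates are named relative to the given four-group, which takes the place of
  conjugating the group to a standard one.\<close>

locale labelling =
  fixes e0 e1 e2 e3 e4 :: 5
  assumes distinct: "distinct [e0, e1, e2, e3, e4]"
begin

lemma UNIV_labels: "UNIV = {e0, e1, e2, e3, e4}"
proof -
  have "card {e0, e1, e2, e3, e4} = 5" using distinct by simp
  then show ?thesis by (intro card_subset_eq[symmetric]) auto
qed

lemma neq [simp]:
  "e0 \<noteq> e1" "e0 \<noteq> e2" "e0 \<noteq> e3" "e0 \<noteq> e4" "e1 \<noteq> e2" "e1 \<noteq> e3" "e1 \<noteq> e4" "e2 \<noteq> e3" "e2 \<noteq> e4" "e3 \<noteq> e4"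
  "e1 \<noteq> e0" "e2 \<noteq> e0" "e3 \<noteq> e0" "e4 \<noteq> e0" "e2 \<noteq> e1" "e3 \<noteq> e1" "e4 \<noteq> e1" "e3 \<noteq> e2" "e4 \<noteq> e2" "e4 \<noteq> e3"
  using distinct by auto

lemma sum_labels: "(\<Sum>i\<in>UNIV. f i) = f e0 + f e1 + f e2 + f e3 + (f e4 :: complex)"
  unfolding UNIV_labels by (simp add: add_ac)

lemma vec_eq_labels:
  fixes x y :: "complex^5"
  shows "x = y \<longleftrightarrow> x $ e0 = y $ e0 \<and> x $ e1 = y $ e1 \<and> x $ e2 = y $ e2 \<and> x $ e3 = y $ e3 \<and> x $ e4 = y $ e4"
proof
  assume *: "x $ e0 = y $ e0 \<and> x $ e1 = y $ e1 \<and> x $ e2 = y $ e2 \<and> x $ e3 = y $ e3 \<and> x $ e4 = y $ e4"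
  have "x $ n = y $ n" for n
  proof -
    have "n \<in> {e0, e1, e2, e3, e4}" using UNIV_labels by blast
    then show ?thesis using * by auto
  qed
  then show "x = y" by (simp add: vec_eq_iff)
qed simp

text \<open>The first three entries are sums against the nontrivial characters of the four-group,
  which permutes e1, ..., e4 simply transitively. The sum against the trivial character is
  \<open>- x $ e0\<close> on the hyperplane of coordinate sum 0.\<close>

definition chars :: "complex^5 \<Rightarrow> complex^4" where
  "chars x = vec_of 1 2 3 (x $ e1 + x $ e2 - x $ e3 - x $ e4) (x $ e1 - x $ e2 + x $ e3 - x $ e4)
     (x $ e1 - x $ e2 - x $ e3 + x $ e4) (x $ e0)"

text \<open>The inverse transform: the 4 by 4 character table is its own inverse up to the factor 4,
  and \<open>- y $ 4\<close> stands for the trivial character.\<close>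

definition unchars :: "complex^4 \<Rightarrow> complex^5" where
  "unchars y = (\<chi> n. if n = e0 then y $ 4
     else if n = e1 then (- y $ 4 + y $ 1 + y $ 2 + y $ 3) / 4
     else if n = e2 then (- y $ 4 + y $ 1 - y $ 2 - y $ 3) / 4
     else if n = e3 then (- y $ 4 - y $ 1 + y $ 2 - y $ 3) / 4
     else (- y $ 4 - y $ 1 - y $ 2 + y $ 3) / 4)"

lemma chars_nth:
  "chars x $ 1 = x $ e1 + x $ e2 - x $ e3 - x $ e4" "chars x $ 2 = x $ e1 - x $ e2 + x $ e3 - x $ e4"
  "chars x $ 3 = x $ e1 - x $ e2 - x $ e3 + x $ e4" "chars x $ 4 = x $ e0"
  by (simp_all add: chars_def vec_of_123)

lemma unchars_nth:
  "unchars y $ e0 = y $ 4" "unchars y $ e1 = (- y $ 4 + y $ 1 + y $ 2 + y $ 3) / 4"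
  "unchars y $ e2 = (- y $ 4 + y $ 1 - y $ 2 - y $ 3) / 4" "unchars y $ e3 = (- y $ 4 - y $ 1 + y $ 2 - y $ 3) / 4"
  "unchars y $ e4 = (- y $ 4 - y $ 1 - y $ 2 + y $ 3) / 4"
  by (simp_all add: unchars_def)

lemma chars_unchars [simp]: "chars (unchars y) = y"
  unfolding vec_eq_4 chars_nth unchars_nth
  by (simp add: add_divide_distrib diff_divide_distrib)

lemma sum_unchars: "(\<Sum>i\<in>UNIV. unchars y $ i) = 0"
  unfolding sum_labels unchars_nth by (simp add: add_divide_distrib diff_divide_distrib)

lemma unchars_chars:
  assumes "(\<Sum>i\<in>UNIV. x $ i) = 0"
  shows "unchars (chars x) = x"
proof -
  have "x $ e0 + (x $ e1 + x $ e2 + x $ e3 + x $ e4) = 0" using assms unfolding sum_labels by (simp add: add_ac)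
  then have "x $ e0 = - (x $ e1 + x $ e2 + x $ e3 + x $ e4)" by (simp only: eq_neg_iff_add_eq_0)
  then show ?thesis unfolding vec_eq_labels unchars_nth chars_nth
    by (simp add: add_divide_distrib diff_divide_distrib)
qed

lemma chars_scale: "chars (c *s x) = c *s chars x"
  unfolding vec_eq_4 vector_smult_component chars_nth by (simp add: algebra_simps)

text \<open>Orthogonality of characters: in the sum over e1, ..., e4 a monomial survives only if its
  characters multiply to the trivial one. In degree two these are the squares; in degree three, with
  t = -a for the trivial character, they are t^3, t u^2, t v^2, t w^2 and u v w.\<close>

lemma power_sums:
  assumes "(\<Sum>i\<in>UNIV. x $ i) = 0"
  shows "4 * (\<Sum>i\<in>UNIV. (x $ i)\<^sup>2) = (chars x $ 1)\<^sup>2 + (chars x $ 2)\<^sup>2 + (chars x $ 3)\<^sup>2 + 5 * (chars x $ 4)\<^sup>2"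
    and "16 * (\<Sum>i\<in>UNIV. (x $ i) ^ 3) = 6 * (chars x $ 1 * chars x $ 2 * chars x $ 3) + 15 * (chars x $ 4) ^ 3
      - 3 * chars x $ 4 * ((chars x $ 1)\<^sup>2 + (chars x $ 2)\<^sup>2 + (chars x $ 3)\<^sup>2)"
proof -
  have "x $ e0 + (x $ e1 + x $ e2 + x $ e3 + x $ e4) = 0" using assms unfolding sum_labels by (simp add: add_ac)
  then have x0: "x $ e0 = - (x $ e1 + x $ e2 + x $ e3 + x $ e4)" by (simp only: eq_neg_iff_add_eq_0)
  show "4 * (\<Sum>i\<in>UNIV. (x $ i)\<^sup>2) = (chars x $ 1)\<^sup>2 + (chars x $ 2)\<^sup>2 + (chars x $ 3)\<^sup>2 + 5 * (chars x $ 4)\<^sup>2"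
    unfolding sum_labels chars_nth x0 by (simp add: power2_eq_square algebra_simps)
  show "16 * (\<Sum>i\<in>UNIV. (x $ i) ^ 3) = 6 * (chars x $ 1 * chars x $ 2 * chars x $ 3) + 15 * (chars x $ 4) ^ 3
      - 3 * chars x $ 4 * ((chars x $ 1)\<^sup>2 + (chars x $ 2)\<^sup>2 + (chars x $ 3)\<^sup>2)"
    unfolding sum_labels chars_nth x0 by (simp add: power2_eq_square power3_eq_cube algebra_simps)
qed

text \<open>The cubic equation takes its short form only modulo the quadratic one: replacing u^2 +
  v^2 + w^2 by -5 a^2 turns 16 times the sum of cubes into 6 (u v w + 5 a^3).\<close>

lemma cone_bring_chars:
  "x \<in> affine_cone bring \<longleftrightarrow> x \<noteq> 0 \<and> (\<Sum>i\<in>UNIV. x $ i) = 0 \<and> bring_eq (chars x)"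
proof (cases "(\<Sum>i\<in>UNIV. x $ i) = 0")
  case True
  note ps = power_sums[OF True]
  let ?y = "chars x"
  have "(\<Sum>i\<in>UNIV. (x $ i)\<^sup>2) = 0 \<longleftrightarrow> (?y $ 1)\<^sup>2 + (?y $ 2)\<^sup>2 + (?y $ 3)\<^sup>2 + 5 * (?y $ 4)\<^sup>2 = 0"
    unfolding ps(1)[symmetric] by simp
  moreover have "(\<Sum>i\<in>UNIV. (x $ i) ^ 3) = 0 \<longleftrightarrow> ?y $ 1 * ?y $ 2 * ?y $ 3 = - 5 * (?y $ 4) ^ 3"
    if 0: "(?y $ 1)\<^sup>2 + (?y $ 2)\<^sup>2 + (?y $ 3)\<^sup>2 + 5 * (?y $ 4)\<^sup>2 = 0"
  proof -
    have s: "(?y $ 1)\<^sup>2 + (?y $ 2)\<^sup>2 + (?y $ 3)\<^sup>2 = - (5 * (?y $ 4)\<^sup>2)" using 0 by (simp only: eq_neg_iff_add_eq_0)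
    have "16 * (\<Sum>i\<in>UNIV. (x $ i) ^ 3) = 6 * (?y $ 1 * ?y $ 2 * ?y $ 3 - (- 5 * (?y $ 4) ^ 3))"
      unfolding ps(2) s by (simp add: power2_eq_square power3_eq_cube algebra_simps)
    then have "(\<Sum>i\<in>UNIV. (x $ i) ^ 3) = 0 \<longleftrightarrow> ?y $ 1 * ?y $ 2 * ?y $ 3 - (- 5 * (?y $ 4) ^ 3) = 0"
      by (metis mult_eq_0_iff zero_neq_numeral)
    then show ?thesis by (simp only: right_minus_eq)
  qed
  ultimately show ?thesis using True unfolding cone_bring bring_eq_def by blast
qed (simp add: cone_bring)

lemma chars_nonzero: "x \<in> affine_cone bring \<Longrightarrow> chars x \<noteq> 0"
proof
  assume x: "x \<in> affine_cone bring" "chars x = 0"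
  then have "unchars (chars x) = x" by (intro unchars_chars) (simp add: cone_bring)
  moreover have "unchars 0 = 0" by (simp add: unchars_def vec_eq_iff)
  ultimately show False using x by (simp add: affine_cone_def)
qed

lemma unchars_in_cone:
  assumes "y \<noteq> 0" "bring_eq y"
  shows "unchars y \<in> affine_cone bring"
proof -
  have "chars 0 = 0" unfolding vec_eq_4 chars_nth by simp
  then have "unchars y \<noteq> 0" using assms(1) by (metis chars_unchars)
  then show ?thesis using assms sum_unchars by (simp add: cone_bring_chars)
qed

text \<open>The coefficient vector of a character coordinate; through it the chart criterion,
  continuity and holomorphy for linear forms apply to \<open>chars\<close>.\<close>

definition char_form :: "4 \<Rightarrow> complex^5" where
  "char_form n = (\<chi> e. chars (axis e 1) $ n)"

lemma lin_form_char_form [simp]: "lin_form (char_form n) x = chars x $ n"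
proof -
  have ax: "axis i (1::complex) $ i = 1" "i \<noteq> j \<Longrightarrow> axis i (1::complex) $ j = 0" for i j :: 5
    by (simp_all add: axis_def)
  show ?thesis
    using exhaust_4[of n] unfolding lin_form_def sum_labels char_form_def vec_lambda_beta
    by (elim disjE) (simp_all add: chars_nth ax)
qed

text \<open>With \<open>v = 1\<close> and \<open>a = t\<close> the equations become \<open>u w = - 5 t\<^sup>3\<close> and \<open>u\<^sup>2 + w\<^sup>2 = - 1 - 5 t\<^sup>2\<close>, so that
  \<open>(u \<plusminus> w)\<^sup>2 = - 1 - 5 t\<^sup>2 \<mp> 10 t\<^sup>3\<close>.\<close>

definition bring_param :: "4 \<Rightarrow> 4 \<Rightarrow> 4 \<Rightarrow> complex \<Rightarrow> complex \<Rightarrow> complex \<Rightarrow> complex^5" where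
  "bring_param i j k r s t = (let \<alpha> = sqrt_near r (- 1 - 5 * t\<^sup>2 - 10 * t ^ 3);
     \<beta> = sqrt_near s (- 1 - 5 * t\<^sup>2 + 10 * t ^ 3) in
     unchars (vec_of i j k ((\<alpha> + \<beta>) / 2) 1 ((\<alpha> - \<beta>) / 2) t))"

definition bring_domain :: "complex \<Rightarrow> complex \<Rightarrow> complex set" where
  "bring_domain r s = (\<lambda>t. - 1 - 5 * t\<^sup>2 - 10 * t ^ 3) -` sqrt_domain r \<inter>
     (\<lambda>t. - 1 - 5 * t\<^sup>2 + 10 * t ^ 3) -` sqrt_domain s"

text \<open>Confines the sum and the difference of the coordinates \<open>i\<close> and
  \<open>k\<close> to one branch of the root each, so that \<open>t\<close> determines both.\<close>

definition bring_part :: "4 \<Rightarrow> 4 \<Rightarrow> complex \<Rightarrow> complex \<Rightarrow> (complex^5) set" where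
  "bring_part i k r s = {x. Re ((chars x $ i + chars x $ k) / r) > 0} \<inter> {x. Re ((chars x $ i - chars x $ k) / s) > 0}"

lemma open_bring_domain: "r \<noteq> 0 \<Longrightarrow> s \<noteq> 0 \<Longrightarrow> open (bring_domain r s)"
  unfolding bring_domain_def by (intro open_Int open_vimage open_sqrt_domain continuous_intros)

lemma continuous_on_chars: "continuous_on A (\<lambda>x. chars x $ n)"
  using continuous_on_lin_form[of A "\<lambda>x. x" "char_form n"] by simp

lemma open_bring_part: "open (bring_part i k r s)"
  unfolding bring_part_def by (intro open_Int open_Re_divide_pos continuous_intros continuous_on_chars)

lemma bring_param_holomorphic: "(\<lambda>t. bring_param i j k r s t $ n) holomorphic_on bring_domain r s"
  unfolding bring_param_def Let_def unchars_def vec_of_def vec_lambda_beta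
  by (intro holomorphic_on_if_const holomorphic_intros) (auto simp: bring_domain_def)

lemma bring_param:
  assumes ijk: "(i, j, k) \<in> perms" and r: "r \<noteq> 0" "s \<noteq> 0" and t: "t \<in> bring_domain r s"
  shows "bring_param i j k r s t \<in> bring_part i k r s" "chars (bring_param i j k r s t) $ j = 1"
    "chars (bring_param i j k r s t) $ 4 = t" "bring_param i j k r s t \<in> affine_cone bring"
proof -
  define \<alpha> \<beta> where "\<alpha> = sqrt_near r (- 1 - 5 * t\<^sup>2 - 10 * t ^ 3)" and "\<beta> = sqrt_near s (- 1 - 5 * t\<^sup>2 + 10 * t ^ 3)"
  have sq: "\<alpha>\<^sup>2 = - 1 - 5 * t\<^sup>2 - 10 * t ^ 3" "\<beta>\<^sup>2 = - 1 - 5 * t\<^sup>2 + 10 * t ^ 3"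
    unfolding \<alpha>_def \<beta>_def by (rule sqrt_near_square[OF r(1)], rule sqrt_near_square[OF r(2)])
  define y where "y = vec_of i j k ((\<alpha> + \<beta>) / 2) 1 ((\<alpha> - \<beta>) / 2) t"
  have \<sigma>: "bring_param i j k r s t = unchars y"
    by (simp add: bring_param_def y_def \<alpha>_def \<beta>_def Let_def)
  have nth: "y $ i = (\<alpha> + \<beta>) / 2" "y $ j = 1" "y $ k = (\<alpha> - \<beta>) / 2" "y $ 4 = t"
    unfolding y_def by (rule vec_of_nth[OF ijk])+
  have "Re (\<alpha> / r) > 0" "Re (\<beta> / s) > 0"
    unfolding \<alpha>_def \<beta>_def
    by (rule Re_sqrt_near[OF _ r(1)], use t in \<open>simp add: bring_domain_def\<close>)
      (rule Re_sqrt_near[OF _ r(2)], use t in \<open>simp add: bring_domain_def\<close>)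
  then show "bring_param i j k r s t \<in> bring_part i k r s"
    unfolding bring_part_def \<sigma> Int_iff mem_Collect_eq chars_unchars nth half_sum_difference by blast
  show "chars (bring_param i j k r s t) $ j = 1" "chars (bring_param i j k r s t) $ 4 = t"
    unfolding \<sigma> chars_unchars nth by (rule refl)+
  have prod: "(\<alpha> + \<beta>) / 2 * ((\<alpha> - \<beta>) / 2) = - 5 * t ^ 3"
    unfolding half_sum_difference sq by simp
  have "((\<alpha> + \<beta>) / 2)\<^sup>2 + ((\<alpha> - \<beta>) / 2)\<^sup>2 = (\<alpha>\<^sup>2 + \<beta>\<^sup>2) / 2"
    by (simp add: power2_eq_square field_simps)
  also have "\<dots> = - 1 - 5 * t\<^sup>2" unfolding sq by simp
  finally have sum: "((\<alpha> + \<beta>) / 2)\<^sup>2 + ((\<alpha> - \<beta>) / 2)\<^sup>2 = - 1 - 5 * t\<^sup>2" .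
  have "y $ i * y $ j * y $ k = - 5 * (y $ 4) ^ 3" using prod unfolding nth by simp
  moreover have "(y $ i)\<^sup>2 + (y $ j)\<^sup>2 + (y $ k)\<^sup>2 + 5 * (y $ 4)\<^sup>2 = ((\<alpha> + \<beta>) / 2)\<^sup>2 + ((\<alpha> - \<beta>) / 2)\<^sup>2 + (1 + 5 * t\<^sup>2)"
    unfolding nth by simp
  then have "(y $ i)\<^sup>2 + (y $ j)\<^sup>2 + (y $ k)\<^sup>2 + 5 * (y $ 4)\<^sup>2 = 0" unfolding sum by simp
  ultimately have "bring_eq y" unfolding bring_eq_def permsD(8)[OF ijk] permsD(10)[OF ijk] by blast
  moreover have "y \<noteq> 0" using nth(2) by auto
  ultimately show "bring_param i j k r s t \<in> affine_cone bring" unfolding \<sigma> by (intro unchars_in_cone)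
qed

lemma bring_param_unique:
  assumes ijk: "(i, j, k) \<in> perms" and x: "x \<in> bring_part i k r s" "chars x $ j = 1" "x \<in> affine_cone bring"
  shows "chars x $ 4 \<in> bring_domain r s" "bring_param i j k r s (chars x $ 4) = x"
proof -
  define y t where "y = chars x" and "t = chars x $ 4"
  have nth: "y $ j = 1" "y $ 4 = t" using x(2) by (simp_all add: y_def t_def)
  have "bring_eq y" using x(3) unfolding y_def by (simp add: cone_bring_chars)
  then have e: "y $ i * y $ k = - 5 * t ^ 3" "(y $ i)\<^sup>2 + 1 + (y $ k)\<^sup>2 + 5 * t\<^sup>2 = 0"
    unfolding bring_eq_def permsD(8)[OF ijk] permsD(10)[OF ijk] nth by simp_all
  have "((y $ i)\<^sup>2 + (y $ k)\<^sup>2) + (1 + 5 * t\<^sup>2) = 0" using e(2) by (simp add: add_ac)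
  then have s: "(y $ i)\<^sup>2 + (y $ k)\<^sup>2 = - (1 + 5 * t\<^sup>2)" by (simp only: eq_neg_iff_add_eq_0)
  have "(y $ i + y $ k)\<^sup>2 = ((y $ i)\<^sup>2 + (y $ k)\<^sup>2) + 2 * (y $ i * y $ k)"
    by (simp add: power2_eq_square algebra_simps)
  then have 1: "(y $ i + y $ k)\<^sup>2 = - 1 - 5 * t\<^sup>2 - 10 * t ^ 3" unfolding e(1) s by simp
  have "(y $ i - y $ k)\<^sup>2 = ((y $ i)\<^sup>2 + (y $ k)\<^sup>2) - 2 * (y $ i * y $ k)"
    by (simp add: power2_eq_square algebra_simps)
  then have 2: "(y $ i - y $ k)\<^sup>2 = - 1 - 5 * t\<^sup>2 + 10 * t ^ 3" unfolding e(1) s by simp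
  have part: "Re ((y $ i + y $ k) / r) > 0" "Re ((y $ i - y $ k) / s) > 0"
    using x(1) by (simp_all add: bring_part_def y_def)
  note u = sqrt_near_unique[OF part(1), unfolded 1] sqrt_near_unique[OF part(2), unfolded 2]
  show "chars x $ 4 \<in> bring_domain r s" using u(1,3) by (simp add: bring_domain_def t_def)
  have "bring_param i j k r s t = unchars (vec_of i j k (((y $ i + y $ k) + (y $ i - y $ k)) / 2) 1
      (((y $ i + y $ k) - (y $ i - y $ k)) / 2) t)"
    unfolding bring_param_def Let_def u ..
  also have "vec_of i j k (((y $ i + y $ k) + (y $ i - y $ k)) / 2) 1 (((y $ i + y $ k) - (y $ i - y $ k)) / 2) t = y"
    unfolding vec_eq_perms[OF ijk] vec_of_nth[OF ijk] nth by simp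
  also have "unchars y = x" unfolding y_def using x(3) by (intro unchars_chars) (simp add: cone_bring)
  finally show "bring_param i j k r s (chars x $ 4) = x" by (simp add: t_def)
qed

lemma bring_chart:
  assumes ijk: "(i, j, k) \<in> perms" and rs: "r \<noteq> 0" "s \<noteq> 0"
  defines "U \<equiv> (\<lambda>t. proj_point (bring_param i j k r s t)) ` bring_domain r s"
  shows "(U, lin_coord (char_form j) (char_form 4)) \<in> atlas bring_curve"
    "lin_coord (char_form j) (char_form 4) ` U = bring_domain r s"
    "\<And>t. t \<in> bring_domain r s \<Longrightarrow>
      inv_into U (lin_coord (char_form j) (char_form 4)) t = proj_point (bring_param i j k r s t)"
proof -
  have p1: "bring_param i j k r s t \<in> bring_part i k r s \<and> lin_form (char_form j) (bring_param i j k r s t) = 1 \<and>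
      lin_form (char_form 4) (bring_param i j k r s t) = t \<and> proj_point (bring_param i j k r s t) \<in> bring"
    if "t \<in> bring_domain r s" for t
    using bring_param[OF ijk rs that] by (simp add: affine_cone_def)
  have p2: "lin_form (char_form 4) x \<in> bring_domain r s \<and> bring_param i j k r s (lin_form (char_form 4) x) = x"
    if x: "x \<in> bring_part i k r s" "lin_form (char_form j) x = 1" "proj_point x \<in> bring" for x
  proof -
    have "x \<noteq> 0" using x(2) by (auto simp: lin_form_def)
    then have "x \<in> affine_cone bring" using x(3) by (simp add: affine_cone_def)
    then show ?thesis using bring_param_unique[OF ijk x(1)] x(2) by simp
  qed
  note ch = embedded_chartI[where \<sigma> = "bring_param i j k r s" and l = "char_form j" and m = "char_form 4",
      OF bring_subset open_bring_domain[OF rs] open_bring_part bring_param_holomorphic]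
  show "(U, lin_coord (char_form j) (char_form 4)) \<in> atlas bring_curve"
    using p1 p2 unfolding bring_curve_eq U_def by (rule ch(1))
  show "lin_coord (char_form j) (char_form 4) ` U = bring_domain r s"
    using p1 p2 unfolding U_def by (rule ch(2))
  show "inv_into U (lin_coord (char_form j) (char_form 4)) t = proj_point (bring_param i j k r s t)"
    if t: "t \<in> bring_domain r s" for t
    using p1 p2 t unfolding U_def by (rule ch(3))
qed

section \<open>The squaring map from Bring's curve to the cubic\<close>

definition quot_map :: "complex^5 \<Rightarrow> complex^4" where
  "quot_map x = squares (chars x)"

lemma quot_map_nth: "quot_map x $ n = (chars x $ n)\<^sup>2"
  by (simp add: quot_map_def squares_def)

lemma quadratic_quot_map: "quadratic quot_map"
  unfolding quadratic_def vec_eq_4 vector_smult_component quot_map_nth chars_scale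
  by (simp add: power_mult_distrib)

lemma continuous_on_quot_map: "continuous_on A quot_map"
  unfolding quot_map_def squares_def
  by (intro continuous_on_vec_lambda continuous_intros continuous_on_chars)

lemma holomorphic_quot_map:
  assumes "\<And>i. (\<lambda>w. \<sigma> w $ i) holomorphic_on N"
  shows "(\<lambda>w. quot_map (\<sigma> w) $ i) holomorphic_on N"
  unfolding quot_map_nth lin_form_char_form[symmetric] lin_form_def
  by (intro holomorphic_intros assms)

lemma quot_map_in_cone:
  assumes "x \<in> affine_cone bring"
  shows "quot_map x \<in> affine_cone cubic"
proof -
  let ?y = "chars x"
  have e: "?y $ 1 * ?y $ 2 * ?y $ 3 = - 5 * (?y $ 4) ^ 3"
    "(?y $ 1)\<^sup>2 + (?y $ 2)\<^sup>2 + (?y $ 3)\<^sup>2 + 5 * (?y $ 4)\<^sup>2 = 0"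
    using assms by (auto simp: cone_bring_chars bring_eq_def)
  have "(?y $ 1)\<^sup>2 * (?y $ 2)\<^sup>2 * (?y $ 3)\<^sup>2 = (?y $ 1 * ?y $ 2 * ?y $ 3)\<^sup>2"
    by (simp add: power_mult_distrib)
  also have "\<dots> = 25 * ((?y $ 4)\<^sup>2) ^ 3" unfolding e(1) by (simp add: power_mult_distrib flip: power_mult)
  finally have "cubic_eq (quot_map x)" using e(2) by (simp add: cubic_eq_def quot_map_nth)
  moreover have "quot_map x \<noteq> 0" using chars_nonzero[OF assms] by (auto simp: vec_eq_4 quot_map_nth)
  ultimately show ?thesis by (simp add: cone_cubic)
qed

end

section \<open>Klein four-groups in the alternating group\<close>

text \<open>An involution of five points is a product of at most two disjoint transpositions, and
  parity excludes a single one; two of them leave exactly one point fixed.\<close>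

lemma even_involution_fixpoint:
  fixes \<pi> :: "5 \<Rightarrow> 5"
  assumes \<pi>: "evenperm \<pi>" "\<pi> \<circ> \<pi> = id" "\<pi> \<noteq> id"
  shows "\<exists>!k. \<pi> k = k"
proof -
  have inv: "\<pi> (\<pi> x) = x" for x using \<pi>(2) by (metis comp_apply id_apply)
  obtain i where i: "\<pi> i \<noteq> i" using \<pi>(3) by (auto simp: fun_eq_iff)
  define j where "j = \<pi> i"
  have "\<exists>k. k \<noteq> i \<and> k \<noteq> j \<and> \<pi> k \<noteq> k"
  proof (rule ccontr)
    assume "\<not> ?thesis"
    then have "\<pi> = Transposition.transpose i j" using inv by (auto simp: fun_eq_iff Transposition.transpose_def j_def)
    then have "evenperm (Transposition.transpose i j)" using \<pi>(1) by simp
    then show False using i by (simp add: evenperm_swap j_def)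
  qed
  then obtain k where k: "k \<noteq> i" "k \<noteq> j" "\<pi> k \<noteq> k" by auto
  define l where "l = \<pi> k"
  have l: "l \<noteq> i" "l \<noteq> j" "l \<noteq> k" using k inv by (auto simp: l_def j_def) (metis inv)+
  have c4: "card {i, j, k, l} = 4" using i k l by (auto simp: j_def)
  have "{i, j, k, l} \<noteq> UNIV"
  proof
    assume "{i, j, k, l} = UNIV"
    then have "CARD(5) = 4" using c4 by simp
    then show False by simp
  qed
  then obtain m where m: "m \<notin> {i, j, k, l}" by auto
  have "card (insert m {i, j, k, l}) = 5" using c4 m by simp
  then have U: "insert m {i, j, k, l} = UNIV" by (intro card_subset_eq) auto
  have "\<pi> j = i" "\<pi> l = k" using inv by (simp_all add: j_def l_def)
  have "\<pi> m = m"
  proof (rule ccontr)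
    assume "\<pi> m \<noteq> m"
    then have "\<pi> m \<in> {i, j, k, l}" using U by blast
    then have "\<pi> (\<pi> m) \<in> {i, j, k, l}" using \<open>\<pi> j = i\<close> \<open>\<pi> l = k\<close> by (auto simp: j_def l_def)
    then show False using inv m by simp
  qed
  moreover have "x = m" if "\<pi> x = x" for x
  proof (rule ccontr)
    assume "x \<noteq> m"
    then have "x \<in> {i, j, k, l}" using U by blast
    then show False using that i k l \<open>\<pi> j = i\<close> \<open>\<pi> l = k\<close> by (auto simp: j_def l_def)
  qed
  ultimately show ?thesis by blast
qed

text \<open>The isomorphism transfers order four and exponent two. Commutativity follows from the
  latter, since p, q and their product are involutions.\<close>

lemma klein_four_alternatingE:
  assumes "klein_four_subgroup V (alternating_group :: (5 \<Rightarrow> 5) monoid)"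
  obtains p q where "V = {id, p, q, p \<circ> q}" "p \<noteq> id" "q \<noteq> id" "p \<noteq> q"
    "p \<circ> p = id" "q \<circ> q = id" "q \<circ> p = p \<circ> q" "evenperm p" "evenperm q" "evenperm (p \<circ> q)"
proof -
  let ?G = "alternating_group :: (5 \<Rightarrow> 5) monoid"
  let ?K = "integer_mod_group 2 \<times>\<times> integer_mod_group 2"
  have sub: "subgroup V ?G" and "?G\<lparr>carrier := V\<rparr> \<cong> ?K"
    using assms by (auto simp: klein_four_subgroup_def)
  then obtain h where h: "h \<in> iso (?G\<lparr>carrier := V\<rparr>) ?K" by (auto simp: is_iso_def)
  have closed: "x \<circ> y \<in> V" if "x \<in> V" "y \<in> V" for x y
    using subgroup.m_closed[OF sub that] by (simp add: alternating_group_def)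
  have id: "id \<in> V" using subgroup.one_closed[OF sub] by (simp add: alternating_group_def)
  have even: "evenperm x" if "x \<in> V" for x
    using subgroup.subset[OF sub] that by (auto simp: alternating_group_def)
  have hom: "h (x \<circ> y) = h x \<otimes>\<^bsub>?K\<^esub> h y" if "x \<in> V" "y \<in> V" for x y
    using h that by (auto simp: iso_def hom_def alternating_group_def)
  have bij: "bij_betw h V (carrier ?K)" using h by (auto simp: iso_def)
  have KK: "carrier ?K = {0..<2} \<times> {0..<2}"
    by (simp add: DirProd_def carrier_integer_mod_group)
  have sq: "z \<otimes>\<^bsub>?K\<^esub> z = (0, 0)" for z
    by (cases z) (simp add: DirProd_def integer_mod_group_def)
  have invol: "x \<circ> x = id" if "x \<in> V" for x
  proof -
    have "h (x \<circ> x) = h (id \<circ> id)" using hom[OF that that] hom[OF id id] sq by simp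
    then show ?thesis using bij closed[OF that that] id unfolding bij_betw_def inj_on_def by simp
  qed
  have card: "card V = 4" using bij_betw_same_card[OF bij] unfolding KK by simp
  then have fin: "finite V" by (intro card_ge_0_finite) simp
  have "\<not> V \<subseteq> {id}" using card card_mono[of "{id}" V] by auto
  then obtain p where p: "p \<in> V" "p \<noteq> id" by auto
  have "card {id, p} \<le> 2" by (simp add: card_insert_if)
  then have "\<not> V \<subseteq> {id, p}" using card card_mono[of "{id, p}" V] by auto
  then obtain q where q: "q \<in> V" "q \<noteq> id" "q \<noteq> p" by auto
  have pq: "p \<circ> q \<in> V" using closed p q by simp
  have pp: "p (p x) = x" for x using invol[OF p(1)] by (metis comp_apply id_apply)
  have qq: "q (q x) = x" for x using invol[OF q(1)] by (metis comp_apply id_apply)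
  have pqpq: "p (q (p (q x))) = x" for x using invol[OF pq] by (metis comp_apply id_apply)
  have comm: "q (p x) = p (q x)" for x by (metis pp qq pqpq)
  have "p \<circ> q \<noteq> id"
  proof
    assume "p \<circ> q = id"
    then have "p (q x) = x" for x by (metis comp_apply id_apply)
    then have "q x = p x" for x by (metis pp)
    then show False using q(3) by auto
  qed
  moreover have "p \<circ> q \<noteq> p"
  proof
    assume "p \<circ> q = p"
    then have "p (q x) = p x" for x by (metis comp_apply)
    then have "q x = id x" for x by (metis pp id_apply)
    then show False using q(2) by auto
  qed
  moreover have "p \<circ> q \<noteq> q"
  proof
    assume "p \<circ> q = q"
    then have "p (q x) = q x" for x by (metis comp_apply)
    then have "p x = id x" for x by (metis qq id_apply)
    then show False using p(2) by auto
  qed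
  ultimately have "card {id, p, q, p \<circ> q} = 4" using p q by auto
  then have "V = {id, p, q, p \<circ> q}"
    using card fin p q pq id by (intro card_subset_eq[symmetric]) auto
  then show thesis
  proof (rule that)
    show "q \<circ> p = p \<circ> q" using comm by (auto simp: fun_eq_iff)
  qed (use p q pq invol even in auto)
qed

text \<open>Commuting with \<open>p\<close>, the involution \<open>q\<close> preserves the only
  fixed point of \<open>p\<close>, so all three involutions share it. On the other four points the
  group acts freely, hence they form one orbit, and the labels are the images of
  \<open>e1\<close>.\<close>

lemma klein_four_labelling:
  assumes "klein_four_subgroup V (alternating_group :: (5 \<Rightarrow> 5) monoid)"
  obtains p q r e0 e1 e2 e3 e4 where "distinct [e0, e1, e2, e3, e4]" "V = {id, p, q, r}"
    "p e0 = e0" "p e1 = e2" "p e2 = e1" "p e3 = e4" "p e4 = e3"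
    "q e0 = e0" "q e1 = e3" "q e2 = e4" "q e3 = e1" "q e4 = e2"
    "r e0 = e0" "r e1 = e4" "r e2 = e3" "r e3 = e2" "r e4 = e1"
proof -
  obtain p q where V: "V = {id, p, q, p \<circ> q}" "p \<noteq> id" "q \<noteq> id" "p \<noteq> q"
    "p \<circ> p = id" "q \<circ> q = id" "q \<circ> p = p \<circ> q" "evenperm p" "evenperm q" "evenperm (p \<circ> q)"
    using assms by (rule klein_four_alternatingE)
  have pp: "p (p x) = x" for x using V(5) by (metis comp_apply id_apply)
  have qq: "q (q x) = x" for x using V(6) by (metis comp_apply id_apply)
  have comm: "q (p x) = p (q x)" for x using V(7) by (metis comp_apply)
  have "p \<circ> q \<noteq> id"
  proof
    assume "p \<circ> q = id"
    then have "p (q x) = x" for x by (metis comp_apply id_apply)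
    then have "q x = p x" for x by (metis pp)
    then show False using V(4) by auto
  qed
  moreover have "(p \<circ> q) \<circ> (p \<circ> q) = id" by (simp add: fun_eq_iff comm pp qq)
  ultimately have fr: "\<exists>!k. p (q k) = k" using even_involution_fixpoint[OF V(10)] by simp
  have fp: "\<exists>!k. p k = k" using even_involution_fixpoint V(2,5,8) by blast
  have fq: "\<exists>!k. q k = k" using even_involution_fixpoint V(3,6,9) by blast
  obtain e0 where e0: "p e0 = e0" using fp by auto
  have q0: "q e0 = e0" using fp e0 comm by metis
  have pfix: "p x = x \<Longrightarrow> x = e0" for x using fp e0 by metis
  have qfix: "q x = x \<Longrightarrow> x = e0" for x using fq q0 by metis
  have rfix: "p (q x) = x \<Longrightarrow> x = e0" for x using fr e0 q0 by metis
  obtain e1 :: 5 where e1: "e1 \<noteq> e0" by (metis zero_neq_one)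
  have "p e1 \<noteq> e0" "q e1 \<noteq> e0" "p (q e1) \<noteq> e0" using e1 e0 q0 pp qq by metis+
  moreover have "p e1 \<noteq> e1" "q e1 \<noteq> e1" "p (q e1) \<noteq> e1" using e1 pfix qfix rfix by blast+
  moreover have "p e1 \<noteq> q e1" using e1 rfix pp by metis
  moreover have "p (q e1) \<noteq> p e1" using e1 qfix pp by metis
  moreover have "p (q e1) \<noteq> q e1" using \<open>q e1 \<noteq> e0\<close> pfix by blast
  ultimately have "distinct [e0, e1, p e1, q e1, p (q e1)]" using e1 by auto
  then show thesis
    by (rule that[of e0 e1 "p e1" "q e1" "p (q e1)" p q "p \<circ> q"])
      (simp_all add: V(1) e0 q0 pp qq comm)
qed

section \<open>The quotient\<close>

text \<open>Here \<open>s = \<plusminus>1\<close>.  If \<open>d \<noteq> 0\<close> then \<open>s\<close> is determined by \<open>d' = s d\<close> and the equations fix the parity of the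
  number of sign changes; if \<open>d = 0\<close> then one of \<open>a, b, c\<close> vanishes, and its sign is free.\<close>

lemma sign_change_cases:
  fixes a b c d a' b' c' d' :: complex
  assumes sq: "a'\<^sup>2 = a\<^sup>2" "b'\<^sup>2 = b\<^sup>2" "c'\<^sup>2 = c\<^sup>2" "d'\<^sup>2 = d\<^sup>2"
    and e: "a * b * c = - 5 * d ^ 3" "a' * b' * c' = - 5 * d' ^ 3"
  obtains s where "s \<noteq> 0" "d' = s * d"
    "a' = s * a \<and> b' = s * b \<and> c' = s * c \<or> a' = s * a \<and> b' = s * - b \<and> c' = s * - c \<or>
     a' = s * - a \<and> b' = s * b \<and> c' = s * - c \<or> a' = s * - a \<and> b' = s * - b \<and> c' = s * c"
proof -
  have a: "a' = a \<or> a' = - a" and b: "b' = b \<or> b' = - b" and c: "c' = c \<or> c' = - c" and d: "d' = d \<or> d' = - d"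
    using sq by (simp_all only: power2_eq_iff)
  have "\<exists>s\<in>{1, -1}. d' = s * d \<and> (a' = s * a \<and> b' = s * b \<and> c' = s * c \<or>
      a' = s * a \<and> b' = s * - b \<and> c' = s * - c \<or> a' = s * - a \<and> b' = s * b \<and> c' = s * - c \<or>
      a' = s * - a \<and> b' = s * - b \<and> c' = s * c)"
  proof (cases "d = 0")
    case True
    then have "d' = 0" and "a = 0 \<or> b = 0 \<or> c = 0" using e(1) d by auto
    then show ?thesis using a b c True by (elim disjE) simp_all
  next
    case False
    then have abc: "a \<noteq> 0" "b \<noteq> 0" "c \<noteq> 0" using e(1) by auto
    from d show ?thesis
    proof
      assume d': "d' = d"
      then have "a' * b' * c' = a * b * c" using e by simp
      then show ?thesis using a b c d' abc by (elim disjE) simp_all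
    next
      assume d': "d' = - d"
      then have "a' * b' * c' = - (a * b * c)" using e by simp
      then show ?thesis using a b c d' abc by (elim disjE) simp_all
    qed
  qed
  then obtain s where "s \<in> {1, -1}" "d' = s * d" "a' = s * a \<and> b' = s * b \<and> c' = s * c \<or>
      a' = s * a \<and> b' = s * - b \<and> c' = s * - c \<or> a' = s * - a \<and> b' = s * b \<and> c' = s * - c \<or>
      a' = s * - a \<and> b' = s * - b \<and> c' = s * c" by blast
  then show thesis by (intro that[of s]) auto
qed

definition perm_vec :: "(5 \<Rightarrow> 5) \<Rightarrow> complex^5 \<Rightarrow> complex^5" where
  "perm_vec p x = (\<chi> i. x $ (Hilbert_Choice.inv p) i)"

lemma permute_coords_proj_point: "permute_coords p (proj_point x) = proj_point (perm_vec p x)"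
proof -
  have "perm_vec p (c *s x) = c *s perm_vec p x" for c by (simp add: perm_vec_def vec_eq_iff)
  then show ?thesis unfolding permute_coords_def perm_vec_def[symmetric] proj_point_def
    by (auto simp: image_iff) metis
qed

locale klein_labelling = labelling +
  fixes V :: "(5 \<Rightarrow> 5) set" and p q r :: "5 \<Rightarrow> 5"
  assumes V: "V = {id, p, q, r}"
    and p: "p e0 = e0" "p e1 = e2" "p e2 = e1" "p e3 = e4" "p e4 = e3"
    and q: "q e0 = e0" "q e1 = e3" "q e2 = e4" "q e3 = e1" "q e4 = e2"
    and r: "r e0 = e0" "r e1 = e4" "r e2 = e3" "r e3 = e2" "r e4 = e1"
begin

lemma inv_involution:
  assumes "g (g e0) = e0" "g (g e1) = e1" "g (g e2) = e2" "g (g e3) = e3" "g (g e4) = e4"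
  shows "Hilbert_Choice.inv g = g"
proof -
  have "g (g x) = x" for x
  proof -
    have "x \<in> {e0, e1, e2, e3, e4}" using UNIV_labels by blast
    then show ?thesis using assms by auto
  qed
  then show ?thesis by (intro inv_equality)
qed

lemma inv_pqr: "Hilbert_Choice.inv p = p" "Hilbert_Choice.inv q = q" "Hilbert_Choice.inv r = r"
  by (rule inv_involution; simp add: p q r)+

lemma chars_perm_vec:
  "chars (perm_vec id x) = chars x"
  "chars (perm_vec p x) = vec_of 1 2 3 (chars x $ 1) (- chars x $ 2) (- chars x $ 3) (chars x $ 4)"
  "chars (perm_vec q x) = vec_of 1 2 3 (- chars x $ 1) (chars x $ 2) (- chars x $ 3) (chars x $ 4)"
  "chars (perm_vec r x) = vec_of 1 2 3 (- chars x $ 1) (- chars x $ 2) (chars x $ 3) (chars x $ 4)"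
  unfolding vec_eq_4 vec_of_123 chars_nth perm_vec_def inv_pqr inv_id vec_lambda_beta p q r
  by simp_all

lemma sum_perm_vec:
  assumes "g \<in> V"
  shows "(\<Sum>i\<in>UNIV. perm_vec g x $ i) = (\<Sum>i\<in>UNIV. x $ i)"
  using assms unfolding V sum_labels perm_vec_def
  by (auto simp: inv_pqr p q r)

lemma quot_map_perm_vec: "g \<in> V \<Longrightarrow> quot_map (perm_vec g x) = quot_map x"
  unfolding V vec_eq_4 quot_map_nth by (auto simp: chars_perm_vec vec_of_123)

lemma bring_eq_perm_vec: "g \<in> V \<Longrightarrow> bring_eq (chars x) \<Longrightarrow> bring_eq (chars (perm_vec g x))"
  unfolding V bring_eq_def by (auto simp: chars_perm_vec vec_of_123)

lemma perm_vec_in_cone: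
  assumes g: "g \<in> V" and x: "x \<in> affine_cone bring"
  shows "perm_vec g x \<in> affine_cone bring"
proof -
  have "quot_map x \<noteq> 0" using quot_map_in_cone[OF x] by (simp add: affine_cone_def)
  then have "quot_map (perm_vec g x) \<noteq> 0" by (simp add: quot_map_perm_vec[OF g])
  moreover have "quot_map 0 = 0" unfolding vec_eq_4 quot_map_nth chars_nth by simp
  ultimately have "perm_vec g x \<noteq> 0" by metis
  then show ?thesis
    using x sum_perm_vec[OF g] bring_eq_perm_vec[OF g] unfolding cone_bring_chars by simp
qed

text \<open>Fibres of the squaring map are orbits: equal squares leave only signs, and the equation
  for the product restricts these to the sign changes realised by the group, up to a common
  factor.\<close>

lemma same_quot_map:
  assumes x: "x \<in> affine_cone bring" and x': "x' \<in> affine_cone bring"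
    and eq: "proj_point (quot_map x') = proj_point (quot_map x)"
  shows "\<exists>g\<in>V. proj_point x' = proj_point (perm_vec g x)"
proof -
  obtain c where c: "c \<noteq> 0" "quot_map x' = c *s quot_map x" using eq by (auto simp: proj_point_eq_iff)
  \<comment> \<open>The squares are only proportional; as \<open>quot_map\<close> is quadratic,
    rescaling by a square root of the factor makes them equal.\<close>
  define y where "y = csqrt c *s x"
  have cs: "csqrt c \<noteq> 0" using c(1) by simp
  have py: "proj_point (perm_vec g y) = proj_point (perm_vec g x)" for g
    unfolding permute_coords_proj_point[symmetric] y_def using cs by simp
  have "y \<noteq> 0" "proj_point y \<in> bring" using x cs by (simp_all add: affine_cone_def y_def)
  then have y: "y \<in> affine_cone bring" by (simp add: affine_cone_def)
  have sq: "(chars x' $ n)\<^sup>2 = (chars y $ n)\<^sup>2" for n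
    using arg_cong[OF c(2), of "\<lambda>v. v $ n"]
    by (simp add: quot_map_nth y_def chars_scale power_mult_distrib)
  have e: "chars y $ 1 * chars y $ 2 * chars y $ 3 = - 5 * (chars y $ 4) ^ 3"
    "chars x' $ 1 * chars x' $ 2 * chars x' $ 3 = - 5 * (chars x' $ 4) ^ 3"
    using y x' by (auto simp: cone_bring_chars bring_eq_def)
  obtain s where s: "s \<noteq> 0" "chars x' $ 4 = s * chars y $ 4"
    and cases: "chars x' $ 1 = s * chars y $ 1 \<and> chars x' $ 2 = s * chars y $ 2 \<and> chars x' $ 3 = s * chars y $ 3 \<or>
      chars x' $ 1 = s * chars y $ 1 \<and> chars x' $ 2 = s * - chars y $ 2 \<and> chars x' $ 3 = s * - chars y $ 3 \<or>
      chars x' $ 1 = s * - chars y $ 1 \<and> chars x' $ 2 = s * chars y $ 2 \<and> chars x' $ 3 = s * - chars y $ 3 \<or>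
      chars x' $ 1 = s * - chars y $ 1 \<and> chars x' $ 2 = s * - chars y $ 2 \<and> chars x' $ 3 = s * chars y $ 3"
    by (rule sign_change_cases[OF sq[of 1] sq[of 2] sq[of 3] sq[of 4] e])
  \<comment> \<open>The four sign patterns belong to \<open>id\<close>, \<open>p\<close>,
    \<open>q\<close> and \<open>r\<close>, in this order.\<close>
  have "\<exists>g\<in>V. chars x' = s *s chars (perm_vec g y)"
    using cases s(2) unfolding V vec_eq_4 vector_smult_component
    by (elim disjE) (simp_all add: chars_perm_vec vec_of_123)
  then obtain g where g: "g \<in> V" "chars x' = s *s chars (perm_vec g y)" by blast
  have "x' = unchars (chars x')" using x' by (intro unchars_chars[symmetric]) (simp add: cone_bring)
  also have "\<dots> = unchars (chars (s *s perm_vec g y))" by (simp only: g(2) chars_scale)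
  also have "\<dots> = s *s perm_vec g y"
  proof (rule unchars_chars)
    have "(\<Sum>i\<in>UNIV. perm_vec g y $ i) = 0" using sum_perm_vec[OF g(1)] y by (simp add: cone_bring)
    then show "(\<Sum>i\<in>UNIV. (s *s perm_vec g y) $ i) = 0" by (simp flip: sum_distrib_left)
  qed
  finally have "proj_point x' = proj_point (perm_vec g y)" using s(1) by simp
  then show ?thesis using g(1) py by auto
qed

section \<open>The orbit space and its homeomorphism with the cubic\<close>

definition orb :: "(complex^5) set \<Rightarrow> (complex^5) set set" where
  "orb = orbit (alternating_group\<lparr>carrier := V\<rparr>) permute_coords"

definition quot :: "(complex^5) set \<Rightarrow> (complex^4) set" where
  "quot = proj_map quot_map"

lemma quot_proj_point [simp]: "quot (proj_point x) = proj_point (quot_map x)"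
  unfolding quot_def by (rule proj_map_proj_point[OF quadratic_quot_map])

lemma orb_proj_point: "orb (proj_point x) = (\<lambda>g. proj_point (perm_vec g x)) ` V"
  unfolding orb_def orbit_def by (auto simp: permute_coords_proj_point)

text \<open>Makes the map induced on orbits both well defined and injective.\<close>

lemma orb_eq:
  assumes "L \<in> bring"
  shows "orb L = {M\<in>bring. quot M = quot L}"
proof -
  obtain x where x: "x \<in> affine_cone bring" "L = proj_point x" using assms bring_subset by (rule in_coneE)
  show ?thesis
  proof (intro subset_antisym subsetI)
    fix M assume "M \<in> orb L"
    then obtain g where g: "g \<in> V" "M = proj_point (perm_vec g x)" unfolding x(2) orb_proj_point by auto
    then show "M \<in> {M\<in>bring. quot M = quot L}"
      using perm_vec_in_cone[OF g(1) x(1)] by (simp add: affine_cone_def x(2) quot_map_perm_vec)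
  next
    fix M assume "M \<in> {M\<in>bring. quot M = quot L}"
    then have M: "M \<in> bring" "quot M = quot L" by auto
    obtain x' where x': "x' \<in> affine_cone bring" "M = proj_point x'" using M(1) bring_subset by (rule in_coneE)
    then show "M \<in> orb L"
      using same_quot_map[OF x(1) x'(1)] M(2) unfolding x(2) orb_proj_point by auto
  qed
qed

lemma quot_in_cubic: "L \<in> bring \<Longrightarrow> quot L \<in> cubic"
  using bring_subset quot_map_in_cone by (auto elim!: in_coneE simp: affine_cone_def)

text \<open>Square roots of all four coordinates satisfy the product equation up to sign; changing
  the sign of the first root corrects it.\<close>

lemma quot_surj:
  assumes "L \<in> cubic"
  shows "\<exists>M\<in>bring. quot M = L"
proof -
  obtain z where z: "z \<in> affine_cone cubic" "L = proj_point z" using assms cubic_subset by (rule in_coneE)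
  have e: "z $ 1 * z $ 2 * z $ 3 = 25 * (z $ 4) ^ 3" "z $ 1 + z $ 2 + z $ 3 + 5 * z $ 4 = 0"
    using z by (auto simp: cone_cubic cubic_eq_def)
  let ?s = "\<lambda>n. csqrt (z $ n)"
  have "(?s 1 * ?s 2 * ?s 3)\<^sup>2 = z $ 1 * z $ 2 * z $ 3" by (simp add: power_mult_distrib)
  also have "\<dots> = 25 * ((?s 4)\<^sup>2) ^ 3" by (simp add: e(1))
  also have "\<dots> = (- 5 * ?s 4 ^ 3)\<^sup>2" by (simp only: power_mult_distrib flip: power_mult) simp
  finally have "?s 1 * ?s 2 * ?s 3 = - 5 * ?s 4 ^ 3 \<or> ?s 1 * ?s 2 * ?s 3 = - (- 5 * ?s 4 ^ 3)"
    by (simp only: power2_eq_iff)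
  then obtain t where t: "t\<^sup>2 = z $ 1" "t * ?s 2 * ?s 3 = - 5 * ?s 4 ^ 3"
  proof
    assume "?s 1 * ?s 2 * ?s 3 = - 5 * ?s 4 ^ 3"
    then show thesis by (intro that[of "?s 1"]) simp_all
  next
    assume "?s 1 * ?s 2 * ?s 3 = - (- 5 * ?s 4 ^ 3)"
    then show thesis by (intro that[of "- ?s 1"]) simp_all
  qed
  define y where "y = vec_of 1 2 3 t (?s 2) (?s 3) (?s 4)"
  have sq: "squares y = z" unfolding vec_eq_4 by (simp add: squares_def y_def vec_of_123 t(1))
  have "bring_eq y" using t e(2) unfolding bring_eq_def y_def vec_of_123 by simp
  moreover have "y \<noteq> 0"
  proof
    assume "y = 0"
    then have "z = 0" using sq by (simp add: squares_def vec_eq_4)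
    then show False using z(1) by (simp add: affine_cone_def)
  qed
  ultimately have "unchars y \<in> affine_cone bring" by (intro unchars_in_cone)
  then show ?thesis
    using sq z(2) by (intro bexI[of _ "proj_point (unchars y)"]) (auto simp: quot_map_def affine_cone_def)
qed

lemma continuous_quot:
  "continuous_map (subtopology projective_space bring) (subtopology projective_space cubic) quot"
  unfolding quot_def using quot_map_in_cone
  by (intro continuous_proj_map bring_subset cubic_subset quadratic_quot_map continuous_on_quot_map)
    (auto simp: affine_cone_def)

definition quot_bar :: "(complex^5) set set \<Rightarrow> (complex^4) set" where
  "quot_bar O' = quot (SOME M. M \<in> O')"

lemma quot_bar_orb:
  assumes "L \<in> bring"
  shows "quot_bar (orb L) = quot L"
proof -
  have "L \<in> orb L" using assms by (simp add: orb_eq)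
  then have "(SOME M. M \<in> orb L) \<in> orb L" by (rule someI)
  then show ?thesis using assms by (simp add: orb_eq quot_bar_def)
qed

abbreviation "orb_space \<equiv> quotient_topology (subtopology projective_space bring) orb"

lemma points_bring_quotient: "points (bring_quotient V) = orb_space"
  by (simp add: bring_quotient_def quotient_surface_def bring_curve_eq orb_def)

lemma topspace_bring: "topspace (subtopology projective_space bring) = bring"
  using bring_subset by auto

lemma topspace_cubic: "topspace (subtopology projective_space cubic) = cubic"
  using cubic_subset by auto

lemma topspace_orb_space: "topspace orb_space = orb ` bring"
  unfolding topspace_quotient_topology topspace_bring ..

lemma continuous_orb: "continuous_map (subtopology projective_space bring) orb_space orb"
  by (rule quotient_imp_continuous_map[OF quotient_map_quotient_topology])

lemma compact_orb_space: "compact_space orb_space"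
  using image_compactin[OF _ continuous_orb, of "topspace (subtopology projective_space bring)"] compact_space_bring
  unfolding compact_space_def topspace_orb_space topspace_bring by blast

text \<open>A continuous bijection from a compact space onto a Hausdorff space, so continuity of the
  inverse comes for free.\<close>

lemma quot_bar_homeomorphic: "homeomorphic_map orb_space (subtopology projective_space cubic) quot_bar"
proof (rule continuous_imp_homeomorphic_map)
  have "continuous_map (subtopology projective_space bring) (subtopology projective_space cubic) (quot_bar \<circ> orb)"
    using continuous_quot by (rule continuous_map_eq) (use quot_bar_orb topspace_bring in auto)
  then show "continuous_map orb_space (subtopology projective_space cubic) quot_bar"
    using continuous_compose_quotient_map_eq[OF quotient_map_quotient_topology] by blast
  show "compact_space orb_space" by (rule compact_orb_space)
  show "Hausdorff_space (subtopology projective_space cubic)"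
    by (rule Hausdorff_space_subtopology[OF Hausdorff_projective_space])
  show "quot_bar ` topspace orb_space = topspace (subtopology projective_space cubic)"
    unfolding topspace_orb_space topspace_cubic
    using quot_bar_orb quot_in_cubic quot_surj by (force simp: image_iff)
  show "inj_on quot_bar (topspace orb_space)"
    unfolding topspace_orb_space using quot_bar_orb orb_eq by (auto simp: inj_on_def)
qed

section \<open>Charts of the quotient\<close>

lemma bring_quotient_atlas:
  "(U, \<phi>) \<in> atlas (bring_quotient V) \<longleftrightarrow> is_chart orb_space (U, \<phi>) \<and>
     (\<forall>(W, \<psi>)\<in>atlas bring_curve. (\<phi> \<circ> orb \<circ> inv_into W \<psi>) holomorphic_on \<psi> ` {L\<in>W. orb L \<in> U})"
  by (simp add: bring_quotient_def quotient_surface_def bring_curve_eq orb_def)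

text \<open>This provides charts around every orbit, including those of points with nontrivial
  stabiliser: \<open>quot\<close> is polynomial on lifts, so a chart of the cubic composed with it
  is holomorphic on Bring's curve.\<close>

lemma pullback_chart:
  assumes c: "(W, \<psi>) \<in> atlas (embedded_curve cubic)"
  shows "({P\<in>topspace orb_space. quot_bar P \<in> W}, \<psi> \<circ> quot_bar) \<in> atlas (bring_quotient V)" (is "(?U, _) \<in> _")
proof -
  have "is_chart orb_space (?U, \<psi> \<circ> quot_bar)"
    by (rule is_chart_pullback[OF quot_bar_homeomorphic embedded_chartD(1)[OF c]])
  moreover have "(\<psi> \<circ> quot_bar \<circ> orb \<circ> inv_into A \<alpha>) holomorphic_on \<alpha> ` {L\<in>A. orb L \<in> ?U}"
    if A: "(A, \<alpha>) \<in> atlas bring_curve" for A \<alpha>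
  proof -
    have A': "(A, \<alpha>) \<in> atlas (embedded_curve bring)" using A by (simp add: bring_curve_eq)
    note ch = is_chartD[OF embedded_chartD(1)[OF A']]
    have Ab: "A \<subseteq> bring" using ch(2) topspace_bring by simp
    have "orb L \<in> ?U \<longleftrightarrow> quot L \<in> W" if "L \<in> A" for L
    proof -
      have "L \<in> bring" using that Ab by blast
      then have "orb L \<in> topspace orb_space" unfolding topspace_orb_space by blast
      then show ?thesis using quot_bar_orb[OF \<open>L \<in> bring\<close>] by simp
    qed
    then have eq: "{L\<in>A. orb L \<in> ?U} = {L\<in>A. quot L \<in> W}" by blast
    let ?D = "\<alpha> ` {L\<in>A. quot L \<in> W}"
    have "open ?D"
      using open_chart_preimage[OF embedded_chartD(1)[OF A'] embedded_chartD(1)[OF c] continuous_quot] .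
    then have \<gamma>: "proj_holomorphic ?D (inv_into A \<alpha>)"
      by (intro proj_holomorphic_subset[OF proj_holomorphic_chart_inv[OF bring_subset A']]) auto
    have inv: "inv_into A \<alpha> z \<in> {L\<in>A. quot L \<in> W}" if "z \<in> ?D" for z using that ch(3) by auto
    have "proj_holomorphic ?D (proj_map quot_map \<circ> inv_into A \<alpha>)"
    proof (rule proj_holomorphic_proj_map[OF \<gamma> _ quadratic_quot_map _ holomorphic_quot_map])
      show "inv_into A \<alpha> z \<in> bring" if "z \<in> ?D" for z using inv[OF that] Ab by blast
      show "quot_map x \<noteq> 0" if "x \<in> affine_cone bring" for x
        using quot_map_in_cone[OF that] by (simp add: affine_cone_def)
    qed
    then have "(\<psi> \<circ> (quot \<circ> inv_into A \<alpha>)) holomorphic_on ?D"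
      unfolding quot_def[symmetric] using inv by (intro chart_comp_proj_holomorphic[OF cubic_subset c]) auto
    then show ?thesis
      unfolding eq
    proof (rule holomorphic_transform)
      fix z assume "z \<in> ?D"
      then have "inv_into A \<alpha> z \<in> bring" using inv[of z] Ab by blast
      then show "(\<psi> \<circ> (quot \<circ> inv_into A \<alpha>)) z = (\<psi> \<circ> quot_bar \<circ> orb \<circ> inv_into A \<alpha>) z"
        by (simp add: quot_bar_orb)
    qed
  qed
  ultimately show ?thesis unfolding bring_quotient_atlas by blast
qed

text \<open>The ordering is found at the image point on the cubic. Distinct squares make both the
  sum and the difference of the coordinates \<open>i\<close> and \<open>k\<close> nonzero, as the
  two square roots in the chart of Bring's curve require.\<close>

lemma bring_normal_form:
  assumes "L \<in> bring"
  obtains i j k x where "(i, j, k) \<in> perms" "L = proj_point x" "x \<in> affine_cone bring"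
    "chars x $ j = 1" "(chars x $ i)\<^sup>2 \<noteq> (chars x $ k)\<^sup>2"
proof -
  obtain x where x: "x \<in> affine_cone bring" "L = proj_point x" using assms bring_subset by (rule in_coneE)
  have "proj_point (quot_map x) \<in> cubic" using quot_map_in_cone[OF x(1)] by (simp add: affine_cone_def)
  then obtain i j k and w :: "complex^4" where w: "(i, j, k) \<in> perms" "proj_point (quot_map x) = proj_point w" "w $ j = 1" "w $ i \<noteq> w $ k"
    by (rule cubic_normal_form)
  then obtain c where c: "c \<noteq> 0" "quot_map x = c *s w" by (auto simp: proj_point_eq_iff)
  have nz: "chars x $ j \<noteq> 0" using arg_cong[OF c(2), of "\<lambda>v. v $ j"] c(1) w(3) by (auto simp: quot_map_nth)
  have ne: "(chars x $ i)\<^sup>2 \<noteq> (chars x $ k)\<^sup>2"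
    using c(1) w(4) by (simp flip: quot_map_nth add: c(2))
  let ?x = "(1 / chars x $ j) *s x"
  show thesis
  proof (rule that[OF w(1)])
    show "L = proj_point ?x" using x(2) nz by simp
    then show "?x \<in> affine_cone bring" using x assms nz by (simp add: affine_cone_def)
    show "chars ?x $ j = 1" using nz by (simp add: chars_scale)
    show "(chars ?x $ i)\<^sup>2 \<noteq> (chars ?x $ k)\<^sup>2"
      using nz ne by (simp add: chars_scale power_mult_distrib power_divide)
  qed
qed

text \<open>In the charts \<open>t\<close> of Bring's curve and \<open>d\<close> of the cubic the quotient map is \<open>d = t\<^sup>2\<close>, also at the branch
  points \<open>t = 0\<close>.\<close>

lemma quotient_chart_holomorphic:
  assumes U: "(U, \<phi>) \<in> atlas (bring_quotient V)" and P: "P \<in> U"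
  shows "\<exists>W \<psi> N. (W, \<psi>) \<in> atlas (embedded_curve cubic) \<and> quot_bar P \<in> W \<and> open N \<and> \<psi> (quot_bar P) \<in> N \<and>
    (\<phi> \<circ> inv_into (topspace orb_space) quot_bar \<circ> inv_into W \<psi>) holomorphic_on N"
proof -
  have chU: "is_chart orb_space (U, \<phi>)" using U bring_quotient_atlas by blast
  have "P \<in> orb ` bring" using is_chartD(2)[OF chU] P topspace_orb_space by auto
  then obtain L where L: "L \<in> bring" "P = orb L" by auto
  obtain i j k x where x: "(i, j, k) \<in> perms" "L = proj_point x" "x \<in> affine_cone bring"
    "chars x $ j = 1" "(chars x $ i)\<^sup>2 \<noteq> (chars x $ k)\<^sup>2" using L(1) by (rule bring_normal_form)
  \<comment> \<open>The values at \<open>x\<close> itself select the branches, so that the two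
    charts contain \<open>L\<close> and its image.\<close>
  define \<rho> where "\<rho> = quot_map x $ i - quot_map x $ k"
  define r1 r2 where "r1 = chars x $ i + chars x $ k" and "r2 = chars x $ i - chars x $ k"
  have \<rho>: "\<rho> \<noteq> 0" using x(5) by (simp add: \<rho>_def quot_map_nth)
  have r: "r1 \<noteq> 0" "r2 \<noteq> 0"
    using x(5) by (auto simp: r1_def r2_def power2_eq_iff eq_neg_iff_add_eq_0)
  define W where "W = (\<lambda>d. proj_point (cubic_param i j k \<rho> d)) ` cubic_domain \<rho>"
  define \<psi> :: "(complex^4) set \<Rightarrow> complex" where "\<psi> = lin_coord (axis j 1) (axis 4 1)"
  have W: "(W, \<psi>) \<in> atlas (embedded_curve cubic)"
    unfolding W_def \<psi>_def by (rule cubic_chart[OF x(1) \<rho>])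
  note chW = embedded_chartD(1)[OF W]
  define A where "A = (\<lambda>t. proj_point (bring_param i j k r1 r2 t)) ` bring_domain r1 r2"
  define \<alpha> where "\<alpha> = lin_coord (char_form j) (char_form 4)"
  have A: "(A, \<alpha>) \<in> atlas bring_curve" and \<alpha>A: "\<alpha> ` A = bring_domain r1 r2"
    and inv\<alpha>: "\<And>t. t \<in> bring_domain r1 r2 \<Longrightarrow> inv_into A \<alpha> t = proj_point (bring_param i j k r1 r2 t)"
    using bring_chart[OF x(1) r] unfolding A_def \<alpha>_def by auto
  have chA: "is_chart (subtopology projective_space bring) (A, \<alpha>)"
    using A embedded_chartD(1) unfolding bring_curve_eq by blast
  have Ab: "A \<subseteq> bring" using is_chartD(2)[OF chA] topspace_bring by simp
  have "x \<in> bring_part i k r1 r2" using r by (simp add: bring_part_def r1_def[symmetric] r2_def[symmetric])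
  note u = bring_param_unique[OF x(1) this x(4,3)]
  have LA: "L \<in> A" unfolding A_def x(2)
    using u(1) by (rule image_eqI[rotated]) (simp only: u(2))
  have quotL: "quot L = proj_point (quot_map x)" by (simp add: x(2))
  have LW: "quot L \<in> W"
  proof -
    have c: "proj_point (quot_map x) \<in> cubic" using quot_in_cubic[OF L(1)] quotL by simp
    have "quot_map x \<in> cubic_part i k \<rho>" using \<rho> by (simp add: cubic_part_def \<rho>_def[symmetric])
    moreover have "quot_map x $ j = 1" using x(4) by (simp add: quot_map_nth)
    ultimately have v: "quot_map x $ 4 \<in> cubic_domain \<rho>" "cubic_param i j k \<rho> (quot_map x $ 4) = quot_map x"
      using cubic_param_unique[OF x(1) _ _ c] by auto
    show ?thesis unfolding W_def quotL
      using v(1) by (rule image_eqI[rotated]) (simp only: v(2))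
  qed
  \<comment> \<open>The parameters \<open>t\<close> at which the image on the cubic stays in the
    chart \<open>W\<close> and the orbit stays in \<open>U\<close>.\<close>
  define N where "N = \<alpha> ` {M\<in>A. quot M \<in> W} \<inter> \<alpha> ` {M\<in>A. orb M \<in> U}"
  have "open N" unfolding N_def
    by (intro open_Int open_chart_preimage[OF chA chW continuous_quot] open_chart_preimage[OF chA chU continuous_orb])
  have N: "M \<in> A \<and> quot M \<in> W \<and> orb M \<in> U \<and> t \<in> bring_domain r1 r2 \<and> \<psi> (quot M) = t\<^sup>2"
    if t: "t \<in> N" and M: "M = inv_into A \<alpha> t" for t M
  proof -
    have td: "t \<in> bring_domain r1 r2" using t \<alpha>A unfolding N_def by auto
    obtain M' M'' where M': "M' \<in> A" "quot M' \<in> W" "t = \<alpha> M'" and M'': "M'' \<in> A" "orb M'' \<in> U" "t = \<alpha> M''"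
      using t unfolding N_def by blast
    have "M = M'" "M = M''"
      unfolding M using inv_into_f_f[OF is_chartD(3)[OF chA]] M' M'' by metis+
    then have "M \<in> A" "quot M \<in> W" "orb M \<in> U" using M' M'' by simp_all
    moreover have "\<psi> (quot M) = t\<^sup>2"
      using bring_param(2,3)[OF x(1) r td] unfolding M inv\<alpha>[OF td] \<psi>_def by (simp add: quot_map_nth)
    ultimately show ?thesis using td by blast
  qed
  \<comment> \<open>This is \<open>\<phi>\<close> read in the coordinate d. Its composite with
    squaring is \<open>\<phi>\<close> pulled back to Bring's curve, which is holomorphic by
    definition of the quotient atlas.\<close>
  define H where "H = \<phi> \<circ> inv_into (topspace orb_space) quot_bar \<circ> inv_into W \<psi>"
  have "(\<phi> \<circ> orb \<circ> inv_into A \<alpha>) holomorphic_on \<alpha> ` {M\<in>A. orb M \<in> U}"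
    using U A unfolding bring_quotient_atlas by blast
  then have "(\<phi> \<circ> orb \<circ> inv_into A \<alpha>) holomorphic_on N"
    by (rule holomorphic_on_subset) (auto simp: N_def)
  moreover have "(\<phi> \<circ> orb \<circ> inv_into A \<alpha>) t = H (t\<^sup>2)" if "t \<in> N" for t
  proof -
    let ?M = "inv_into A \<alpha> t"
    have M: "?M \<in> A" "quot ?M \<in> W" "\<psi> (quot ?M) = t\<^sup>2" using N[OF that refl] by auto
    have "inv_into W \<psi> (t\<^sup>2) = quot ?M"
      unfolding M(3)[symmetric] by (rule inv_into_f_f[OF is_chartD(3)[OF chW] M(2)])
    also have "\<dots> = quot_bar (orb ?M)" using quot_bar_orb M(1) Ab by auto
    finally have "inv_into (topspace orb_space) quot_bar (inv_into W \<psi> (t\<^sup>2)) = orb ?M"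
      using inv_into_f_f[OF homeomorphic_imp_injective_map[OF quot_bar_homeomorphic], of "orb ?M"]
        M(1) Ab topspace_orb_space by auto
    then show ?thesis by (simp add: H_def)
  qed
  ultimately have "(\<lambda>t. H (t\<^sup>2)) holomorphic_on N" by (rule holomorphic_transform)
  then have "H holomorphic_on (\<lambda>t. t\<^sup>2) ` N" by (rule holomorphic_on_square_image[OF \<open>open N\<close>])
  moreover have "\<alpha> L \<in> N" using LA LW P L(2) by (auto simp: N_def)
  then have "\<psi> (quot_bar P) \<in> (\<lambda>t. t\<^sup>2) ` N"
    using N[OF \<open>\<alpha> L \<in> N\<close> refl] inv_into_f_f[OF is_chartD(3)[OF chA] LA] quot_bar_orb[OF L(1)] L(2) by auto
  moreover have "quot_bar P \<in> W" using LW quot_bar_orb[OF L(1)] L(2) by simp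
  ultimately show ?thesis
    using W open_image_square[OF \<open>open N\<close>] unfolding H_def by blast
qed

lemma bring_quotient_transfer: "surface_transfer (bring_quotient V) (embedded_curve cubic) quot_bar"
proof
  show "riemann_surface (embedded_curve cubic)" by (rule riemann_surface_cubic)
  show "homeomorphic_map (points (bring_quotient V)) (points (embedded_curve cubic)) quot_bar"
    unfolding points_bring_quotient points_embedded_curve by (rule quot_bar_homeomorphic)
  show "is_chart (points (bring_quotient V)) (U, \<phi>)" if "(U, \<phi>) \<in> atlas (bring_quotient V)" for U \<phi>
    using that unfolding bring_quotient_atlas points_bring_quotient by blast
  show "\<exists>U \<phi>. (U, \<phi>) \<in> atlas (bring_quotient V) \<and> P \<in> U" if P: "P \<in> topspace (points (bring_quotient V))" for P
  proof -
    have "quot_bar P \<in> cubic"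
      using P homeomorphic_imp_surjective_map[OF quot_bar_homeomorphic]
      unfolding points_bring_quotient topspace_cubic by blast
    then obtain W \<psi> where "(W, \<psi>) \<in> atlas (embedded_curve cubic)" "quot_bar P \<in> W"
      using cubic_chart_ex by blast
    then show ?thesis using pullback_chart P unfolding points_bring_quotient by blast
  qed
  fix U \<phi> P assume "(U, \<phi>) \<in> atlas (bring_quotient V)" "P \<in> U"
  then obtain W \<psi> N where *: "(W, \<psi>) \<in> atlas (embedded_curve cubic)" "quot_bar P \<in> W" "open N" "\<psi> (quot_bar P) \<in> N"
    "(\<phi> \<circ> inv_into (topspace orb_space) quot_bar \<circ> inv_into W \<psi>) holomorphic_on N"
    using quotient_chart_holomorphic by blast
  have "(\<phi> \<circ> inv_into (topspace orb_space) quot_bar \<circ> inv_into W \<psi>) holomorphic_on (N \<inter> \<psi> ` (W \<inter> quot_bar ` U))"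
    by (rule holomorphic_on_subset[OF *(5)]) blast
  with * show "\<exists>W \<psi> N. (W, \<psi>) \<in> atlas (embedded_curve cubic) \<and> quot_bar P \<in> W \<and> open N \<and> \<psi> (quot_bar P) \<in> N \<and>
      (\<phi> \<circ> inv_into (topspace (points (bring_quotient V))) quot_bar \<circ> inv_into W \<psi>) holomorphic_on
        (N \<inter> \<psi> ` (W \<inter> quot_bar ` U))"
    unfolding points_bring_quotient by blast
qed

lemma bring_quotient_cubic:
  "compact_riemann_surface (bring_quotient V)" "biholomorphic (bring_quotient V) (embedded_curve cubic)"
  using surface_transfer.riemann_surface[OF bring_quotient_transfer]
    surface_transfer.biholomorphic[OF bring_quotient_transfer] compact_orb_space
  by (simp_all add: compact_riemann_surface_def points_bring_quotient)

end

theorem proposition7p2: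
  fixes V4 :: "(5 \<Rightarrow> 5) set"
  assumes "klein_four_subgroup V4 alternating_group"
  shows "compact_riemann_surface (bring_quotient V4) \<and>
    (\<exists>S :: (complex^4) set set.
       smooth_projective_model S {(x, y). y^2 = x^4 + 10 * x^3 + 25 * x^2 - 100 * x} \<and>
       biholomorphic (bring_quotient V4) (embedded_curve S))"
proof -
  obtain p q r e0 e1 e2 e3 e4 where *: "distinct [e0, e1, e2, e3, e4]" "V4 = {id, p, q, r}"
    "p e0 = e0" "p e1 = e2" "p e2 = e1" "p e3 = e4" "p e4 = e3"
    "q e0 = e0" "q e1 = e3" "q e2 = e4" "q e3 = e1" "q e4 = e2"
    "r e0 = e0" "r e1 = e4" "r e2 = e3" "r e3 = e2" "r e4 = e1"
    using assms by (rule klein_four_labelling)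
  interpret klein_labelling e0 e1 e2 e3 e4 V4 p q r by unfold_locales (fact *)+
  show ?thesis
    using bring_quotient_cubic smooth_projective_model_cubic unfolding quartic_def by blast
qed

end
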